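(* Let the setting below hold, and suppose Assumption A holds and that, for every $N$ and every $n\le N-1$, the Semi-Discrete step equation has a unique strong solution on $[t_n,t_{n+1}]$. Assume $x_0\in\mathcal L^p(\Omega,\mathbb R)$, $x_0>0$ a.s., and that there exist $p>2$ and $A>0$, with $A$ independent of the step size $\Delta$, such that $$\mathbb E\Big(\sup_{0\le t\le T}|x_t|^p\Big)\vee\mathbb E\Big(\sup_{0\le t\le T}|y_t|^p\Big)<A .$$ Then the Semi-Discrete scheme converges to the true solution in the mean square sense: $$\lim_{\Delta\to 0}\mathbb E\sup_{0\le t\le T}|y_t-x_t|^2=0 .$$
   Context: Let $T>0$, let $(\Omega,\mathcal F,(\mathcal F_t)_{0\le t\le T},\mathbb P)$ be a complete filtered probability space satisfying the usual conditions, and let $W$ be a one-dimensional $(\mathcal F_t)$-Wiener process. Let $a,b:[0,T]\times\mathbb R\to\mathbb R$ be measurable, and let $x_0$ be $\mathcal F_0$-measurable, independent of $W$, with $x_0>0$ a.s. Assume the SDE $x_t=x_0+\int_0^t a(s,x_s)\,ds+\int_0^t b(s,x_s)\,dW_s$, $t\in[0,T]$, has a unique strong solution $x$. Assumption A: there are functions $f,g:[0,T]^2\times\mathbb R^2\to\mathbb R$ with $f(s,s,x,x)=a(s,x)$ and $g(s,s,x,x)=b(s,x)$ such that for every $R>0$ there is a constant $C_R$ with, for all $s_i,r_i\in[0,T]$ and all $x_i,y_i$ with $|x_1|\vee|x_2|\vee|y_1|\vee|y_2|\le R$, $|f(s_1,r_1,x_1,y_1)-f(s_2,r_2,x_2,y_2)|\le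 C_R(|s_1-s_2|+|r_1-r_2|+|x_1-x_2|+|y_1-y_2|)$ and $|g(s_1,r_1,x_1,y_1)-g(s_2,r_2,x_2,y_2)|\le C_R(|s_1-s_2|+|r_1-r_2|+|x_1-x_2|+|y_1-y_2|+\sqrt{|x_1-x_2|})$. Semi-Discrete scheme: for $N\in\mathbb N$ let $\Delta=T/N$, $t_n=n\Delta$, and for $s\in[t_n,t_{n+1})$ put $\hat s=t_n$. The process $y$ is defined by $y_0=x_0$ and, for each $n\le N-1$ and $t\in[t_n,t_{n+1}]$, $y_t=y_{t_n}+\int_{t_n}^t f(t_n,s,y_{t_n},y_s)\,ds+\int_{t_n}^t g(t_n,s,y_{t_n},y_s)\,dW_s$; equivalently $y_t=y_0+\int_0^t f(\hat s,s,y_{\hat s},y_s)\,ds+\int_0^t g(\hat s,s,y_{\hat s},y_s)\,dW_s$. *)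

theory Defs
  imports "HOL-Probability.Probability"
begin

definition usual_filtration :: "'a measure \<Rightarrow> (real \<Rightarrow> 'a measure) \<Rightarrow> real \<Rightarrow> bool" where
  "usual_filtration M F T \<longleftrightarrow>
     (\<forall>t. sets (F t) \<subseteq> sets M \<and> space (F t) = space M) \<and>
     (\<forall>s t. s \<le> t \<longrightarrow> sets (F s) \<subseteq> sets (F t)) \<and>
     (\<forall>A B. A \<in> null_sets M \<longrightarrow> B \<subseteq> A \<longrightarrow> B \<in> sets M) \<and>
     null_sets M \<subseteq> sets (F 0) \<and>
     (\<forall>t\<in>{0..<T}. (\<Inter>s\<in>{t<..T}. sets (F s)) \<subseteq> sets (F t))"

definition wiener_process :: "'a measure \<Rightarrow> (real \<Rightarrow> 'a measure) \<Rightarrow> real \<Rightarrow> (real \<Rightarrow> 'a \<Rightarrow> real) \<Rightarrow> bool" where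
  "wiener_process M F T W \<longleftrightarrow>
     (AE \<omega> in M. W 0 \<omega> = 0) \<and>
     (AE \<omega> in M. continuous_on {0..T} (\<lambda>t. W t \<omega>)) \<and>
     (\<forall>t\<in>{0..T}. W t \<in> borel_measurable (F t)) \<and>
     (\<forall>s t. 0 \<le> s \<longrightarrow> s < t \<longrightarrow> t \<le> T \<longrightarrow>
        distributed M lborel (\<lambda>\<omega>. W t \<omega> - W s \<omega>)
          (\<lambda>z. ennreal (normal_density 0 (sqrt (t - s)) z)) \<and>
        (\<forall>A\<in>sets (F s). \<forall>B\<in>sets borel.
           measure M (A \<inter> ((\<lambda>\<omega>. W t \<omega> - W s \<omega>) -` B \<inter> space M)) =
           measure M A * measure M ((\<lambda>\<omega>. W t \<omega> - W s \<omega>) -` B \<inter> space M)))"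

definition ito_sum :: "(real \<Rightarrow> 'a \<Rightarrow> real) \<Rightarrow> (real \<Rightarrow> 'a \<Rightarrow> real) \<Rightarrow> real \<Rightarrow> real \<Rightarrow> nat \<Rightarrow> 'a \<Rightarrow> real" where
  "ito_sum W H u t k \<omega> =
     (\<Sum>i<k. H (u + (t - u) * real i / real k) \<omega> *
        (W (u + (t - u) * real (Suc i) / real k) \<omega> - W (u + (t - u) * real i / real k) \<omega>))"

text \<open>I is (a version of) the Ito integral of H over [u,t] w.r.t. W. For the integrands of this
  paper (continuous adapted processes) the Ito integral is the limit in probability of the
  left-point Riemann sums, which we take as definition.\<close>
definition is_ito_integral :: "'a measure \<Rightarrow> (real \<Rightarrow> 'a \<Rightarrow> real) \<Rightarrow> (real \<Rightarrow> 'a \<Rightarrow> real) \<Rightarrow> real \<Rightarrow> real \<Rightarrow> ('a \<Rightarrow> real) \<Rightarrow> bool" where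
  "is_ito_integral M W H u t I \<longleftrightarrow>
     I \<in> borel_measurable M \<and>
     (\<forall>\<epsilon>>0. (\<lambda>k. measure M {\<omega>\<in>space M. \<bar>ito_sum W H u t k \<omega> - I \<omega>\<bar> > \<epsilon>}) \<longlonglongrightarrow> 0)"

definition is_sde_solution :: "'a measure \<Rightarrow> (real \<Rightarrow> 'a measure) \<Rightarrow> real \<Rightarrow> (real \<Rightarrow> 'a \<Rightarrow> real)
    \<Rightarrow> (real \<Rightarrow> real \<Rightarrow> real) \<Rightarrow> (real \<Rightarrow> real \<Rightarrow> real) \<Rightarrow> ('a \<Rightarrow> real) \<Rightarrow> (real \<Rightarrow> 'a \<Rightarrow> real) \<Rightarrow> bool" where
  "is_sde_solution M F T W a b x0 x \<longleftrightarrow>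
     (\<forall>t\<in>{0..T}. x t \<in> borel_measurable (F t)) \<and>
     (AE \<omega> in M. continuous_on {0..T} (\<lambda>t. x t \<omega>)) \<and>
     (\<forall>t\<in>{0..T}. \<exists>I. is_ito_integral M W (\<lambda>s \<omega>. b s (x s \<omega>)) 0 t I \<and>
        (AE \<omega> in M. x t \<omega> = x0 \<omega> + integral {0..t} (\<lambda>s. a s (x s \<omega>)) + I \<omega>))"

definition is_sd_solution :: "'a measure \<Rightarrow> (real \<Rightarrow> 'a measure) \<Rightarrow> real \<Rightarrow> (real \<Rightarrow> 'a \<Rightarrow> real)
    \<Rightarrow> (real \<Rightarrow> real \<Rightarrow> real \<Rightarrow> real \<Rightarrow> real) \<Rightarrow> (real \<Rightarrow> real \<Rightarrow> real \<Rightarrow> real \<Rightarrow> real)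
    \<Rightarrow> ('a \<Rightarrow> real) \<Rightarrow> nat \<Rightarrow> (real \<Rightarrow> 'a \<Rightarrow> real) \<Rightarrow> bool" where
  "is_sd_solution M F T W f g x0 N y \<longleftrightarrow>
     (\<forall>t\<in>{0..T}. y t \<in> borel_measurable (F t)) \<and>
     (AE \<omega> in M. continuous_on {0..T} (\<lambda>t. y t \<omega>)) \<and>
     (AE \<omega> in M. y 0 \<omega> = x0 \<omega>) \<and>
     (\<forall>n<N. let tn = real n * (T / real N); tn1 = real (Suc n) * (T / real N) in
        \<forall>t\<in>{tn..tn1}. \<exists>I. is_ito_integral M W (\<lambda>s \<omega>. g tn s (y tn \<omega>) (y s \<omega>)) tn t I \<and>
          (AE \<omega> in M. y t \<omega> = y tn \<omega> + integral {tn..t} (\<lambda>s. f tn s (y tn \<omega>) (y s \<omega>)) + I \<omega>))"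

definition assumption_A :: "real \<Rightarrow> (real \<Rightarrow> real \<Rightarrow> real) \<Rightarrow> (real \<Rightarrow> real \<Rightarrow> real)
    \<Rightarrow> (real \<Rightarrow> real \<Rightarrow> real \<Rightarrow> real \<Rightarrow> real) \<Rightarrow> (real \<Rightarrow> real \<Rightarrow> real \<Rightarrow> real \<Rightarrow> real) \<Rightarrow> bool" where
  "assumption_A T a b f g \<longleftrightarrow>
     (\<forall>s x. f s s x x = a s x \<and> g s s x x = b s x) \<and>
     (\<forall>R>0. \<exists>C. \<forall>s1\<in>{0..T}. \<forall>s2\<in>{0..T}. \<forall>r1\<in>{0..T}. \<forall>r2\<in>{0..T}. \<forall>x1 x2 y1 y2.
        max (max \<bar>x1\<bar> \<bar>x2\<bar>) (max \<bar>y1\<bar> \<bar>y2\<bar>) \<le> R \<longrightarrow>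
        \<bar>f s1 r1 x1 y1 - f s2 r2 x2 y2\<bar> \<le> C * (\<bar>s1 - s2\<bar> + \<bar>r1 - r2\<bar> + \<bar>x1 - x2\<bar> + \<bar>y1 - y2\<bar>) \<and>
        \<bar>g s1 r1 x1 y1 - g s2 r2 x2 y2\<bar> \<le> C * (\<bar>s1 - s2\<bar> + \<bar>r1 - r2\<bar> + \<bar>x1 - x2\<bar> + \<bar>y1 - y2\<bar> + sqrt \<bar>x1 - x2\<bar>))"

end

theory Submission
  imports Defs
begin

text \<open>The error \<open>y - x\<close> is compared with its left-point sums on a grid with \<open>N m l\<close> points that refines the
  grid of the scheme, so that every estimate concerns a discrete walk with adapted coefficients and independent
  Gaussian increments and no Ito formula is needed. The walk is stopped as soon as it leaves a small interval,
  the paths leave a ball, or the sums stop approximating the error. Up to that time Assumption A bounds the drift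
  and the square of the diffusion coefficient by a multiple of the current error plus small terms; a third order
  Taylor expansion of a Yamada-Watanabe function together with the discrete Gronwall inequality makes the
  \<open>L\<^sup>1\<close> norm of the final value small. Choosing \<open>N\<close>, then \<open>m\<close> (path continuity of the error), then \<open>l\<close>
  (convergence of the Riemann sums) gives \<open>sup |y - x| \<longlongrightarrow> 0\<close> in probability, and the
  moment bound of order \<open>p > 2\<close> provides the uniform integrability needed for mean square convergence.\<close>

text \<open>Two obstacles shape the proof. Since \<open>g\<close> is only Hoelder of order 1/2 in
  its third argument, the squared diffusion error is bounded linearly, not quadratically, by the
  error, and a Gronwall argument for second moments does not close. A function close to
  \<bar>u\<bar> whose second derivative is small compared with 1 / \<bar>u\<bar> makes exactly this
  linear term harmless. Secondly, the stochastic integrals are known only as limits in probability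
  of left-point sums, one time at a time. The sums can therefore approximate the error only at
  finitely many points fixed beforehand; these are the points of the intermediate grid with N m
  steps. The coefficients, however, are evaluated at all points of the finest grid, so the error
  there is replaced by the walk at the preceding intermediate point. The price is a walk increment
  over a short lag, whose mean absolute value is small. The size of the admissible lags and errors
  depends only on bounds for the coefficients, not on the grid, and this uniformity is what allows
  N, m and l to be chosen in succession.\<close>

subsection \<open>A Yamada-Watanabe function\<close>

text \<open>The function is the second primitive of \<open>1 / (L * sqrt (u\<^sup>2 + e\<^sup>2))\<close>; the choice \<open>e = 1 / sinh L\<close> makes
  its derivative equal to 1 at \<open>u = 1\<close>, while \<open>\<bar>u\<bar> \<Phi>''\<close> is at most \<open>1 / L\<close>.\<close>

lemma yamada_function:
  fixes \<epsilon> :: real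
  assumes "\<epsilon> > 0"
  obtains \<Phi> \<Phi>' \<Phi>'' :: "real \<Rightarrow> real" and b B :: real where
    "\<Phi> \<in> borel_measurable borel" "\<Phi>' \<in> borel_measurable borel" "\<Phi>'' \<in> borel_measurable borel"
    "\<Phi> 0 = 0" "\<And>u. \<Phi> u \<ge> 0" "\<And>u. \<Phi> u \<le> b * u\<^sup>2" "\<And>u. \<bar>u\<bar> \<le> 2 * \<Phi> u + \<epsilon>"
    "\<And>u. \<bar>u\<bar> \<le> 1 \<Longrightarrow> \<bar>\<Phi>' u\<bar> \<le> 1"
    "\<And>u. \<Phi>'' u \<ge> 0" "\<And>u. \<Phi>'' u \<le> b" "\<And>u. \<bar>u\<bar> * \<Phi>'' u \<le> \<epsilon>" "B \<ge> 0"
    "\<And>u h. \<Phi> (u + h) \<le> \<Phi> u + \<Phi>' u * h + \<Phi>'' u * h\<^sup>2 + B * \<bar>h\<bar> ^ 3"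
proof -
  \<comment> \<open>With this choice 1 / L = \<epsilon> / 2 covers the bound on \<bar>u\<bar>
    \<Phi>'' u, and 2 / L = \<epsilon> is the bound on the point \<open>w\<close> beyond which
    \<Phi> has slope at least 1/2.\<close>
  define L where "L = 2 / \<epsilon>"
  define e where "e = 1 / sinh L"
  have L: "L > 0" using assms by (simp add: L_def)
  have e: "e > 0" using L by (simp add: e_def)
  define \<Phi> where "\<Phi> = (\<lambda>u. (u * arsinh (u / e) - sqrt (u\<^sup>2 + e\<^sup>2) + e) / L)"
  define \<Phi>' where "\<Phi>' = (\<lambda>u. arsinh (u / e) / L)"
  define s where "s = (\<lambda>u. sqrt (u\<^sup>2 + e\<^sup>2))"
  define d2 where "d2 = (\<lambda>u. 1 / (L * s u))"
  define d3 where "d3 = (\<lambda>u. - u / (L * s u ^ 3))"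
  have s_pos: "s u > 0" for u
    using e by (auto simp: s_def intro: add_nonneg_pos)
  have s_ge_e: "s u \<ge> e" for u
    using e by (simp add: s_def real_le_rsqrt)
  have s_ge_abs: "s u \<ge> \<bar>u\<bar>" for u
    by (simp add: s_def real_le_rsqrt)
  have s_alt: "sqrt ((u / e)\<^sup>2 + 1) = s u / e" for u
  proof -
    have "(u / e)\<^sup>2 + 1 = (u\<^sup>2 + e\<^sup>2) / e\<^sup>2"
      using e by (simp add: field_simps power2_eq_square)
    then show ?thesis using e by (simp add: s_def real_sqrt_divide)
  qed
  have ds: "(s has_real_derivative u / s u) (at u)" for u
    unfolding s_def using s_pos[of u] e
    by (auto intro!: derivative_eq_intros add_nonneg_pos simp: s_def field_simps)
  have da: "((\<lambda>u. arsinh (u / e)) has_real_derivative 1 / s u) (at u)" for u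
    using DERIV_chain2[OF arsinh_real_has_field_derivative DERIV_cdivide[OF DERIV_ident, of e], of u UNIV] e
    by (simp add: s_alt)
  have D0: "(\<Phi> has_real_derivative \<Phi>' u) (at u)" for u
  proof -
    have "((\<lambda>u. (u * arsinh (u / e) - s u + e) / L) has_real_derivative \<Phi>' u) (at u)"
      using L s_pos[of u] by (auto intro!: derivative_eq_intros ds da simp: \<Phi>'_def)
    then show ?thesis by (simp add: \<Phi>_def s_def)
  qed
  have D1: "(\<Phi>' has_real_derivative d2 u) (at u)" for u
    unfolding \<Phi>'_def using L s_pos[of u] by (auto intro!: derivative_eq_intros da simp: d2_def)
  have D2: "(d2 has_real_derivative d3 u) (at u)" for u
  proof -
    have "((\<lambda>u. inverse (s u) / L) has_real_derivative - (inverse (s u) * (u / s u) * inverse (s u)) / L) (at u)"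
      using s_pos[of u] by (intro DERIV_cdivide DERIV_inverse' ds) auto
    then show ?thesis
      using L by (simp add: d2_def d3_def divide_inverse power3_eq_cube mult_ac)
  qed
  have d2_nonneg: "d2 u \<ge> 0" for u using L s_pos[of u] by (simp add: d2_def)
  have d2_le: "d2 u \<le> 1 / (L * e)" for u
    unfolding d2_def using L e s_ge_e[of u] by (auto intro!: divide_left_mono mult_left_mono)
  have d3_le: "\<bar>d3 u\<bar> \<le> 1 / (L * e\<^sup>2)" for u
  proof -
    have "\<bar>d3 u\<bar> = \<bar>u\<bar> / s u * (1 / (L * s u ^ 2))"
      using L s_pos[of u] by (simp add: d3_def power3_eq_cube power2_eq_square abs_mult)
    also have "\<dots> \<le> 1 * (1 / (L * e\<^sup>2))"
      using L e s_pos[of u] s_ge_abs[of u] s_ge_e[of u]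
      by (intro mult_mono divide_left_mono mult_left_mono power_mono mult_pos_pos) auto
    finally show ?thesis by simp
  qed
  have \<Phi>0: "\<Phi> 0 = 0" using e by (simp add: \<Phi>_def)
  have even: "\<Phi> (- u) = \<Phi> u" for u by (simp add: \<Phi>_def)
  have \<Phi>'_mono: "\<Phi>' u \<le> \<Phi>' v" if "u \<le> v" for u v
  proof (rule DERIV_nonneg_imp_nondecreasing[OF that])
    fix x show "\<exists>y. (\<Phi>' has_real_derivative y) (at x) \<and> 0 \<le> y"
      using D1[of x] d2_nonneg[of x] by blast
  qed
  have \<Phi>'0: "\<Phi>' 0 = 0" by (simp add: \<Phi>'_def)
  have \<Phi>_convex: "\<Phi> u \<ge> \<Phi> v + \<Phi>' v * (u - v)" if "v \<le> u" for u v
  proof (cases "v = u")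
    case False
    with that have "v < u" by simp
    then obtain z where "v < z" "z < u" "\<Phi> u - \<Phi> v = (u - v) * \<Phi>' z"
      using MVT2[of v u \<Phi> \<Phi>'] D0 by auto
    moreover have "(u - v) * \<Phi>' v \<le> (u - v) * \<Phi>' z"
      using \<open>v < z\<close> that by (intro mult_left_mono \<Phi>'_mono) auto
    ultimately show ?thesis unfolding mult.commute[of "u - v"] by linarith
  qed simp
  have \<Phi>_abs: "\<Phi> u = \<Phi> \<bar>u\<bar>" for u using even[of u] by (simp add: abs_if)
  have \<Phi>_nonneg: "\<Phi> u \<ge> 0" for u
    using \<Phi>_convex[of 0 "\<bar>u\<bar>"] \<Phi>_abs[of u] \<Phi>0 \<Phi>'0 by simp
  \<comment> \<open>The list indexed by the order of differentiation has the shape that Taylor's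
    theorem expects; n \<le> 3 keeps the index in range.\<close>
  have diffs: "\<forall>m t. m < n \<and> lo \<le> t \<and> t \<le> hi \<longrightarrow>
       DERIV ((\<lambda>m. [\<Phi>, \<Phi>', d2, d3] ! m) m) t :> ((\<lambda>m. [\<Phi>, \<Phi>', d2, d3] ! m) (Suc m) t)"
    if "n \<le> 3" for lo hi :: real and n :: nat
  proof (intro allI impI)
    fix m :: nat and t assume "m < n \<and> lo \<le> t \<and> t \<le> hi"
    with that have "m = 0 \<or> m = 1 \<or> m = 2" by auto
    then show "DERIV ((\<lambda>m. [\<Phi>, \<Phi>', d2, d3] ! m) m) t :> ((\<lambda>m. [\<Phi>, \<Phi>', d2, d3] ! m) (Suc m) t)"
      using D0 D1 D2 by (elim disjE) (auto simp: numeral_2_eq_2)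
  qed
  define B where "B = 1 / (L * e\<^sup>2)"
  have B: "B \<ge> 0" using L by (simp add: B_def)
  have taylor3: "\<Phi> (u + h) \<le> \<Phi> u + \<Phi>' u * h + d2 u * h\<^sup>2 + B * \<bar>h\<bar> ^ 3" for u h
  proof (cases "h = 0")
    case False
    obtain t where "\<Phi> (u + h) = (\<Sum>m<3. ([\<Phi>, \<Phi>', d2, d3] ! m) u / fact m * (u + h - u) ^ m)
        + ([\<Phi>, \<Phi>', d2, d3] ! 3) t / fact 3 * (u + h - u) ^ 3"
      using Taylor[of 3 "\<lambda>m. [\<Phi>, \<Phi>', d2, d3] ! m" \<Phi> "min u (u + h)" "max u (u + h)" u "u + h"]
        diffs[of 3 "min u (u + h)" "max u (u + h)"] False by auto
    then have "\<Phi> (u + h) = \<Phi> u + \<Phi>' u * h + d2 u * h\<^sup>2 / 2 + d3 t / 6 * h ^ 3"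
      by (simp add: numeral_3_eq_3 lessThan_Suc fact_numeral power2_eq_square)
    moreover have "d3 t / 6 * h ^ 3 \<le> B * \<bar>h\<bar> ^ 3"
    proof -
      have "d3 t / 6 * h ^ 3 \<le> \<bar>d3 t / 6\<bar> * \<bar>h\<bar> ^ 3"
        by (metis abs_ge_self abs_mult power_abs)
      also have "\<dots> \<le> B * \<bar>h\<bar> ^ 3"
        using d3_le[of t] by (intro mult_right_mono) (auto simp: B_def)
      finally show ?thesis .
    qed
    moreover have "d2 u * h\<^sup>2 \<ge> 0" using d2_nonneg by simp
    ultimately show ?thesis by linarith
  qed simp
  define b where "b = 1 / (L * e)"
  have \<Phi>_le: "\<Phi> u \<le> b * u\<^sup>2" for u
  proof (cases "u = 0")
    case False
    obtain t where "\<Phi> u = (\<Sum>m<2. ([\<Phi>, \<Phi>', d2, d3] ! m) 0 / fact m * (u - 0) ^ m)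
        + ([\<Phi>, \<Phi>', d2, d3] ! 2) t / fact 2 * (u - 0) ^ 2"
      using Taylor[of 2 "\<lambda>m. [\<Phi>, \<Phi>', d2, d3] ! m" \<Phi> "min 0 u" "max 0 u" 0 u]
        diffs[of 2 "min 0 u" "max 0 u"] False by auto
    then have "\<Phi> u = d2 t / 2 * u\<^sup>2"
      by (simp add: numeral_2_eq_2 lessThan_Suc \<Phi>0 \<Phi>'0)
    also have "\<dots> \<le> b * u\<^sup>2"
      using d2_le[of t] d2_nonneg[of t] by (intro mult_right_mono) (auto simp: b_def)
    finally show ?thesis .
  qed (simp add: \<Phi>0)
  \<comment> \<open>\<Phi>' equals 1/2 at \<open>w\<close>. Where \<bar>u\<bar> is at most
    \<open>w\<close> it is at most \<epsilon>; beyond \<open>w\<close>, convexity puts \<Phi> above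
    a line of slope 1/2, hence \<bar>u\<bar> \<le> w + 2 \<Phi> u.\<close>
  define w where "w = e * sinh (L / 2)"
  have w: "w \<ge> 0" using e L by (simp add: w_def)
  have \<Phi>'w: "\<Phi>' w = 1 / 2"
    using e L by (simp add: \<Phi>'_def w_def arsinh_sinh_real)
  have w_le: "w \<le> \<epsilon>"
  proof -
    have "sinh L = 2 * sinh (L / 2) * cosh (L / 2)"
      using sinh_double[of "L / 2"] by simp
    moreover have sp: "sinh (L / 2) > 0" using L by simp
    ultimately have "w = 1 / (2 * cosh (L / 2))"
      by (simp add: w_def e_def)
    moreover have "2 * cosh (L / 2) \<ge> L / 2"
    proof -
      have "exp (L / 2) \<ge> 1 + L / 2" by simp
      moreover have "2 * cosh (L / 2) \<ge> exp (L / 2)"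
        by (simp add: cosh_field_def)
      ultimately show ?thesis by linarith
    qed
    ultimately have "w \<le> 1 / (L / 2)"
      using L by (simp add: divide_left_mono del: divide_divide_eq_right)
    then show ?thesis by (simp add: L_def)
  qed
  have abs_le: "\<bar>u\<bar> \<le> 2 * \<Phi> u + \<epsilon>" for u
  proof (cases "\<bar>u\<bar> \<le> w")
    case True
    then show ?thesis using w_le \<Phi>_nonneg[of u] by linarith
  next
    case False
    then have "\<Phi> \<bar>u\<bar> \<ge> \<Phi> w + 1 / 2 * (\<bar>u\<bar> - w)"
      using \<Phi>_convex[of w "\<bar>u\<bar>"] by (simp add: \<Phi>'w)
    then show ?thesis using w_le \<Phi>_nonneg[of w] \<Phi>_abs[of u] by (simp add: field_simps)
  qed
  have \<Phi>'_le: "\<bar>\<Phi>' u\<bar> \<le> 1" if "\<bar>u\<bar> \<le> 1" for u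
  proof -
    have "\<Phi>' 1 = 1" using L by (simp add: \<Phi>'_def e_def arsinh_sinh_real)
    moreover have "\<Phi>' (- 1) = - \<Phi>' 1"
      by (simp add: \<Phi>'_def)
    ultimately show ?thesis
      using \<Phi>'_mono[of u 1] \<Phi>'_mono[of "-1" u] that by (simp add: abs_le_iff)
  qed
  have d2_abs: "\<bar>u\<bar> * d2 u \<le> \<epsilon>" for u
  proof -
    have "\<bar>u\<bar> * d2 u = \<bar>u\<bar> / s u / L" by (simp add: d2_def)
    also have "\<dots> \<le> 1 / L"
      using s_ge_abs[of u] s_pos[of u] L by (intro divide_right_mono) auto
    also have "\<dots> \<le> \<epsilon>" using assms by (simp add: L_def)
    finally show ?thesis .
  qed
  have meas: "h \<in> borel_measurable borel" if "\<And>u. (h has_real_derivative h' u) (at u)" for h h' :: "real \<Rightarrow> real"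
    using that by (intro borel_measurable_continuous_onI continuous_at_imp_continuous_on ballI DERIV_isCont) blast
  show thesis
    using that[of \<Phi> \<Phi>' d2 b B, OF meas[OF D0] meas[OF D1] meas[OF D2] \<Phi>0 \<Phi>_nonneg \<Phi>_le abs_le
        \<Phi>'_le d2_nonneg d2_le[folded b_def] d2_abs B taylor3] .
qed

subsection \<open>Walks with Gaussian increments\<close>

definition walk :: "real \<Rightarrow> (nat \<Rightarrow> 'a \<Rightarrow> real) \<Rightarrow> (nat \<Rightarrow> 'a \<Rightarrow> real) \<Rightarrow> (nat \<Rightarrow> 'a \<Rightarrow> real) \<Rightarrow> nat \<Rightarrow> 'a \<Rightarrow> real" where
  "walk \<delta> \<xi> \<alpha> \<beta> i \<omega> = (\<Sum>j<i. \<alpha> j \<omega> * \<delta> + \<beta> j \<omega> * \<xi> j \<omega>)"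

lemma walk_0 [simp]: "walk \<delta> \<xi> \<alpha> \<beta> 0 \<omega> = 0"
  by (simp add: walk_def)

lemma walk_Suc: "walk \<delta> \<xi> \<alpha> \<beta> (Suc i) \<omega> = walk \<delta> \<xi> \<alpha> \<beta> i \<omega> + (\<alpha> i \<omega> * \<delta> + \<beta> i \<omega> * \<xi> i \<omega>)"
  by (simp add: walk_def)

lemma (in prob_space) integrable_sqD:
  fixes X :: "'a \<Rightarrow> real"
  assumes [measurable]: "X \<in> borel_measurable M" and "integrable M (\<lambda>\<omega>. (X \<omega>)\<^sup>2)"
  shows "integrable M X"
proof (rule Bochner_Integration.integrable_bound[where f = "\<lambda>\<omega>. 1 + (X \<omega>)\<^sup>2"])
  have "\<bar>u\<bar> \<le> 1 + u\<^sup>2" for u :: real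
  proof -
    have "0 \<le> (\<bar>u\<bar> - 1 / 2)\<^sup>2" by simp
    also have "\<dots> = u\<^sup>2 - \<bar>u\<bar> + 1 / 4" by (simp add: power2_eq_square algebra_simps)
    finally show ?thesis by simp
  qed
  then show "AE \<omega> in M. norm (X \<omega>) \<le> norm (1 + (X \<omega>)\<^sup>2)" by simp
qed (use assms in auto)

lemma (in prob_space) integrable_sq_add:
  fixes X Y :: "'a \<Rightarrow> real"
  assumes [measurable]: "X \<in> borel_measurable M" "Y \<in> borel_measurable M"
    and "integrable M (\<lambda>\<omega>. (X \<omega>)\<^sup>2)" "integrable M (\<lambda>\<omega>. (Y \<omega>)\<^sup>2)"
  shows "integrable M (\<lambda>\<omega>. (X \<omega> + Y \<omega>)\<^sup>2)"
proof (rule Bochner_Integration.integrable_bound[where f = "\<lambda>\<omega>. 2 * (X \<omega>)\<^sup>2 + 2 * (Y \<omega>)\<^sup>2"])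
  have "(u + v)\<^sup>2 \<le> 2 * u\<^sup>2 + 2 * v\<^sup>2" for u v :: real
    using sum_squares_bound[of u v] by (simp add: power2_sum)
  then show "AE \<omega> in M. norm ((X \<omega> + Y \<omega>)\<^sup>2) \<le> norm (2 * (X \<omega>)\<^sup>2 + 2 * (Y \<omega>)\<^sup>2)" by simp
qed (use assms in auto)

text \<open>What remains of a Wiener process on a uniform grid of mesh \<delta>: \<open>G i\<close>
  stands for the sigma-algebra at the i-th point. Independence has the product form for events
  because this is the form in which \<open>wiener_process\<close> supplies it.\<close>

locale gaussian_steps = prob_space M for M :: "'a measure" +
  fixes G :: "nat \<Rightarrow> 'a measure" and \<xi> :: "nat \<Rightarrow> 'a \<Rightarrow> real" and \<delta> :: real and n :: nat
  assumes subalg: "i \<le> n \<Longrightarrow> subalgebra M (G i)"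
    and filtration: "i \<le> j \<Longrightarrow> j \<le> n \<Longrightarrow> sets (G i) \<subseteq> sets (G j)"
    and \<delta>_pos: "\<delta> > 0"
    and step_adapted: "i < n \<Longrightarrow> \<xi> i \<in> borel_measurable (G (Suc i))"
    and step_normal: "i < n \<Longrightarrow> distributed M lborel (\<xi> i) (\<lambda>z. ennreal (normal_density 0 (sqrt \<delta>) z))"
    and step_indep: "i < n \<Longrightarrow> A \<in> sets (G i) \<Longrightarrow> B \<in> sets borel \<Longrightarrow>
      prob (A \<inter> (\<xi> i -` B \<inter> space M)) = prob A * prob (\<xi> i -` B \<inter> space M)"
begin

lemma measurable_G_M: "i \<le> n \<Longrightarrow> X \<in> borel_measurable (G i) \<Longrightarrow> X \<in> borel_measurable M"
  using measurable_from_subalg[OF subalg] by blast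

lemma measurable_G_mono: "i \<le> j \<Longrightarrow> j \<le> n \<Longrightarrow> X \<in> borel_measurable (G i) \<Longrightarrow> X \<in> borel_measurable (G j)"
  using filtration[of i j] subalg[of i] subalg[of j]
  by (intro measurable_from_subalg[of "G j" "G i"]) (auto simp: subalgebra_def)

lemma step_measurable: "i < n \<Longrightarrow> \<xi> i \<in> borel_measurable M"
  using step_adapted[of i] measurable_G_M[of "Suc i"] by simp

lemma step_integrable:
  assumes "i < n"
  shows "integrable M (\<xi> i)" "integrable M (\<lambda>\<omega>. (\<xi> i \<omega>)\<^sup>2)" "integrable M (\<lambda>\<omega>. \<bar>\<xi> i \<omega>\<bar> ^ 3)"
proof -
  have \<sigma>: "sqrt \<delta> > 0" using \<delta>_pos by simp
  have *: "integrable M (\<lambda>\<omega>. g (\<xi> i \<omega>))"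
    if "integrable lborel (\<lambda>z. normal_density 0 (sqrt \<delta>) z * g z)" "g \<in> borel_measurable borel" for g :: "real \<Rightarrow> real"
    using distributed_integrable[OF step_normal[OF assms], of g] that by simp
  show "integrable M (\<xi> i)"
    using *[of "\<lambda>z. z"] integrable_normal_moment[OF \<sigma>, of 0 1] by simp
  show "integrable M (\<lambda>\<omega>. (\<xi> i \<omega>)\<^sup>2)"
    using *[of "\<lambda>z. z\<^sup>2"] integrable_normal_moment[OF \<sigma>, of 0 2] by simp
  show "integrable M (\<lambda>\<omega>. \<bar>\<xi> i \<omega>\<bar> ^ 3)"
    using *[of "\<lambda>z. \<bar>z\<bar> ^ 3"] normal_moment_abs_odd[OF \<sigma>, of 0 1] by (simp add: has_bochner_integral_iff numeral_3_eq_3)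
qed

lemma step_moments:
  assumes "i < n"
  shows "expectation (\<xi> i) = 0" "expectation (\<lambda>\<omega>. (\<xi> i \<omega>)\<^sup>2) = \<delta>"
    "expectation (\<lambda>\<omega>. \<bar>\<xi> i \<omega>\<bar> ^ 3) \<le> 2 * (\<delta> * sqrt \<delta>)"
proof -
  have \<sigma>: "sqrt \<delta> > 0" using \<delta>_pos by simp
  have *: "expectation (\<lambda>\<omega>. g (\<xi> i \<omega>)) = (\<integral>z. normal_density 0 (sqrt \<delta>) z * g z \<partial>lborel)"
    if "g \<in> borel_measurable borel" for g :: "real \<Rightarrow> real"
    using distributed_integral[OF step_normal[OF assms], of g] that by simp
  show "expectation (\<xi> i) = 0"
    using *[of "\<lambda>z. z"] integral_normal_moment_nz_1[OF \<sigma>, of 0] by simp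
  show "expectation (\<lambda>\<omega>. (\<xi> i \<omega>)\<^sup>2) = \<delta>"
    using *[of "\<lambda>z. z\<^sup>2"] integral_normal_moment_even[OF \<sigma>, of 0 1] \<delta>_pos by simp
  have "expectation (\<lambda>\<omega>. \<bar>\<xi> i \<omega>\<bar> ^ 3) = 2 * sqrt \<delta> ^ 3 * sqrt (2 / pi)"
    using *[of "\<lambda>z. \<bar>z\<bar> ^ 3"] integral_normal_moment_abs_odd[OF \<sigma>, of 0 1] by (simp add: numeral_3_eq_3)
  also have "\<dots> \<le> 2 * sqrt \<delta> ^ 3 * 1"
    using \<delta>_pos pi_gt3 by (intro mult_left_mono) auto
  also have "\<dots> = 2 * (\<delta> * sqrt \<delta>)"
    using \<delta>_pos by (simp add: numeral_3_eq_3)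
  finally show "expectation (\<lambda>\<omega>. \<bar>\<xi> i \<omega>\<bar> ^ 3) \<le> 2 * (\<delta> * sqrt \<delta>)" .
qed

text \<open>The product formula holds on events, and the preimages of Borel sets form
  intersection-stable generators, so it extends to the generated sigma-algebras.\<close>

lemma indep_var_step:
  fixes Z :: "'a \<Rightarrow> real"
  assumes i: "i < n" and Z: "Z \<in> borel_measurable (G i)"
  shows "indep_var borel Z borel (\<xi> i)"
  unfolding indep_var_eq
proof (intro conjI indep_set_sigma_sets indep_setI)
  show "random_variable borel Z" "random_variable borel (\<xi> i)"
    using measurable_G_M[of i Z] step_measurable i Z by auto
  then show "{Z -` A \<inter> space M |A. A \<in> sets borel} \<subseteq> events" "{\<xi> i -` A \<inter> space M |A. A \<in> sets borel} \<subseteq> events"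
    by (auto intro: measurable_sets)
  show "prob (a \<inter> b) = prob a * prob b"
    if "a \<in> {Z -` A \<inter> space M |A. A \<in> sets borel}" "b \<in> {\<xi> i -` A \<inter> space M |A. A \<in> sets borel}" for a b
  proof -
    have "space (G i) = space M" using subalg[of i] i by (simp add: subalgebra_def)
    then have "a \<in> sets (G i)" using that(1) measurable_sets[OF Z] by auto
    then show ?thesis using step_indep[OF i] that(2) by auto
  qed
  have "Int_stable {X -` A \<inter> space M |A. A \<in> sets borel}" for X :: "'a \<Rightarrow> real"
  proof (rule Int_stableI)
    fix a b assume "a \<in> {X -` A \<inter> space M |A. A \<in> sets borel}" "b \<in> {X -` A \<inter> space M |A. A \<in> sets borel}"
    then obtain A B where "A \<in> sets borel" "B \<in> sets borel" "a = X -` A \<inter> space M" "b = X -` B \<inter> space M"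
      by auto
    then show "a \<inter> b \<in> {X -` A \<inter> space M |A. A \<in> sets borel}"
      by (intro CollectI exI[of _ "A \<inter> B"]) auto
  qed
  then show "Int_stable {Z -` A \<inter> space M |A. A \<in> sets borel}" "Int_stable {\<xi> i -` A \<inter> space M |A. A \<in> sets borel}"
    by auto
qed

text \<open>This takes the place of conditioning on \<open>G i\<close>: a factor known before the
  step separates from any function of the increment. With the identity it gives the martingale
  property, with the square the factor \<delta>.\<close>

lemma
  fixes Z :: "'a \<Rightarrow> real" and g :: "real \<Rightarrow> real"
  assumes i: "i < n" and Z: "Z \<in> borel_measurable (G i)" "integrable M Z"
    and g: "g \<in> borel_measurable borel" "integrable M (\<lambda>\<omega>. g (\<xi> i \<omega>))"
  shows step_mult_integrable: "integrable M (\<lambda>\<omega>. Z \<omega> * g (\<xi> i \<omega>))"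
    and step_mult_expectation:
      "expectation (\<lambda>\<omega>. Z \<omega> * g (\<xi> i \<omega>)) = expectation Z * expectation (\<lambda>\<omega>. g (\<xi> i \<omega>))"
proof -
  have "indep_var borel Z borel (\<lambda>\<omega>. g (\<xi> i \<omega>))"
    using indep_var_compose[OF indep_var_step[OF i Z(1)], of "\<lambda>z. z" borel g borel] g(1) by (simp add: o_def)
  from indep_var_integrable[OF this Z(2) g(2)] indep_var_lebesgue_integral[OF this Z(2) g(2)]
  show "integrable M (\<lambda>\<omega>. Z \<omega> * g (\<xi> i \<omega>))"
    "expectation (\<lambda>\<omega>. Z \<omega> * g (\<xi> i \<omega>)) = expectation Z * expectation (\<lambda>\<omega>. g (\<xi> i \<omega>))" by simp_all
qed

lemma walk_measurable:
  assumes "\<And>i. i < n \<Longrightarrow> \<alpha> i \<in> borel_measurable (G i)" "\<And>i. i < n \<Longrightarrow> \<beta> i \<in> borel_measurable (G i)"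
  shows "i \<le> n \<Longrightarrow> walk \<delta> \<xi> \<alpha> \<beta> i \<in> borel_measurable (G i)"
proof (induction i)
  case (Suc i)
  have [measurable]: "walk \<delta> \<xi> \<alpha> \<beta> i \<in> borel_measurable (G (Suc i))" "\<alpha> i \<in> borel_measurable (G (Suc i))"
      "\<beta> i \<in> borel_measurable (G (Suc i))" "\<xi> i \<in> borel_measurable (G (Suc i))"
    using Suc measurable_G_mono[of i "Suc i"] assms[of i] step_adapted[of i] by auto
  show ?case unfolding walk_Suc[abs_def] by measurable
qed (simp add: walk_0[abs_def])

end

text \<open>The induction bounds the whole right-hand side, D plus c times the sum, instead of
  \<open>a\<close> itself: that quantity grows by a factor of at most 1 + c per step.\<close>

lemma discrete_gronwall:
  fixes a :: "nat \<Rightarrow> real"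
  assumes "\<And>i. i \<le> n \<Longrightarrow> a i \<le> D + c * (\<Sum>j<i. a j)" "c \<ge> 0" "D \<ge> 0" "\<And>i. a i \<ge> 0"
  shows "a n \<le> D * exp (c * n)"
proof -
  have *: "D + c * (\<Sum>j<i. a j) \<le> D * (1 + c) ^ i" if "i \<le> n" for i
    using that
  proof (induction i)
    case (Suc i)
    have "D + c * (\<Sum>j<Suc i. a j) = (D + c * (\<Sum>j<i. a j)) + c * a i"
      by (simp add: algebra_simps)
    also have "\<dots> \<le> (D + c * (\<Sum>j<i. a j)) + c * (D + c * (\<Sum>j<i. a j))"
      using assms(1)[of i] assms(2) Suc.prems by (intro add_left_mono mult_left_mono) auto
    also have "\<dots> = (D + c * (\<Sum>j<i. a j)) * (1 + c)" by (simp add: algebra_simps)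
    also have "\<dots> \<le> D * (1 + c) ^ i * (1 + c)"
      using Suc assms(2) by (intro mult_right_mono) auto
    finally show ?case by (simp add: mult_ac)
  qed simp
  have "a n \<le> D * (1 + c) ^ n" using *[of n] assms(1)[of n] by simp
  also have "\<dots> \<le> D * exp c ^ n"
    using assms(2,3) by (intro mult_left_mono power_mono) auto
  finally show ?thesis by (simp add: exp_of_nat_mult[symmetric] mult.commute)
qed

text \<open>The bound \<open>K\<close> will come from stopping. It makes everything integrable, and
  in \<open>X_estimate\<close> it occurs only next to factors that vanish with \<rho>, so its size
  does not matter in the end.\<close>

locale bounded_walk = gaussian_steps M G \<xi> \<delta> n
  for M :: "'a measure" and G \<xi> \<delta> n +
  fixes \<alpha> \<beta> :: "nat \<Rightarrow> 'a \<Rightarrow> real" and K :: real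
  assumes drift_adapted: "i < n \<Longrightarrow> \<alpha> i \<in> borel_measurable (G i)"
    and diffusion_adapted: "i < n \<Longrightarrow> \<beta> i \<in> borel_measurable (G i)"
    and K_nonneg: "K \<ge> 0"
    and drift_bound: "i < n \<Longrightarrow> \<omega> \<in> space M \<Longrightarrow> \<bar>\<alpha> i \<omega>\<bar> \<le> K"
    and diffusion_bound: "i < n \<Longrightarrow> \<omega> \<in> space M \<Longrightarrow> \<bar>\<beta> i \<omega>\<bar> \<le> K"
begin

abbreviation X :: "nat \<Rightarrow> 'a \<Rightarrow> real" where "X \<equiv> walk \<delta> \<xi> \<alpha> \<beta>"

lemma drift_measurable [measurable]: "i < n \<Longrightarrow> \<alpha> i \<in> borel_measurable M"
  and diffusion_measurable [measurable]: "i < n \<Longrightarrow> \<beta> i \<in> borel_measurable M"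
  using measurable_G_M[of i] drift_adapted diffusion_adapted by auto

lemma X_adapted: "i \<le> n \<Longrightarrow> X i \<in> borel_measurable (G i)"
  using walk_measurable[of \<alpha> \<beta>] drift_adapted diffusion_adapted by blast

lemma X_measurable [measurable]: "i \<le> n \<Longrightarrow> X i \<in> borel_measurable M"
  using X_adapted measurable_G_M by blast

lemma integrable_mult_bounded:
  fixes Y Z :: "'a \<Rightarrow> real"
  assumes Y: "integrable M Y" and Z: "Z \<in> borel_measurable M" and "\<And>\<omega>. \<omega> \<in> space M \<Longrightarrow> \<bar>Z \<omega>\<bar> \<le> k"
  shows "integrable M (\<lambda>\<omega>. Z \<omega> * Y \<omega>)"
proof (rule Bochner_Integration.integrable_bound[where f = "\<lambda>\<omega>. k * Y \<omega>"])
  show "AE \<omega> in M. norm (Z \<omega> * Y \<omega>) \<le> norm (k * Y \<omega>)"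
  proof (rule AE_I2)
    fix \<omega> assume "\<omega> \<in> space M"
    then have "\<bar>Z \<omega>\<bar> \<le> \<bar>k\<bar>" using assms(3)[of \<omega>] by linarith
    then show "norm (Z \<omega> * Y \<omega>) \<le> norm (k * Y \<omega>)" by (simp add: abs_mult mult_right_mono)
  qed
qed (use Y Z in auto)

text \<open>A discrete Ito isometry, as an inequality. The cross term of the square has mean 0
  because the increment is independent of the past. Measurability and square integrability are
  carried along since the induction step uses both.\<close>

lemma martingale_part_sq:
  assumes "j \<le> i" "i \<le> n"
  defines "N \<equiv> \<lambda>i \<omega>. \<Sum>k=j..<i. \<beta> k \<omega> * \<xi> k \<omega>"
  shows "N i \<in> borel_measurable (G i) \<and> integrable M (\<lambda>\<omega>. (N i \<omega>)\<^sup>2) \<and>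
    expectation (\<lambda>\<omega>. (N i \<omega>)\<^sup>2) \<le> K\<^sup>2 * (real (i - j) * \<delta>)"
  using assms(1,2)
proof (induction i rule: dec_induct)
  case base
  then show ?case by (simp add: N_def)
next
  case (step i)
  then have i: "i < n" and N: "N i \<in> borel_measurable (G i)" "integrable M (\<lambda>\<omega>. (N i \<omega>)\<^sup>2)"
      "expectation (\<lambda>\<omega>. (N i \<omega>)\<^sup>2) \<le> K\<^sup>2 * (real (i - j) * \<delta>)" by auto
  note [measurable] = diffusion_adapted[OF i] N(1)
  have NM [measurable]: "N i \<in> borel_measurable M" using measurable_G_M[OF _ N(1)] i by simp
  have N_Suc: "N (Suc i) = (\<lambda>\<omega>. N i \<omega> + \<beta> i \<omega> * \<xi> i \<omega>)"
    using step.hyps by (auto simp: N_def fun_eq_iff)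
  have meas: "N (Suc i) \<in> borel_measurable (G (Suc i))"
  proof -
    have [measurable]: "N i \<in> borel_measurable (G (Suc i))" "\<beta> i \<in> borel_measurable (G (Suc i))"
        "\<xi> i \<in> borel_measurable (G (Suc i))"
      using i measurable_G_mono[OF _ _ N(1), of "Suc i"] measurable_G_mono[OF _ _ diffusion_adapted[OF i], of "Suc i"]
        step_adapted[OF i] by auto
    show ?thesis unfolding N_Suc by measurable
  qed
  have sq: "(N (Suc i) \<omega>)\<^sup>2 = (N i \<omega>)\<^sup>2 + 2 * (\<beta> i \<omega> * N i \<omega> * \<xi> i \<omega>) + (\<beta> i \<omega>)\<^sup>2 * (\<xi> i \<omega>)\<^sup>2" for \<omega>
    by (simp add: N_Suc power2_sum power_mult_distrib mult_ac)
  have int1: "integrable M (\<lambda>\<omega>. \<beta> i \<omega> * N i \<omega>)"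
    using integrable_sqD[OF NM N(2)] diffusion_bound[OF i] i by (intro integrable_mult_bounded) auto
  have \<beta>2: "(\<beta> i \<omega>)\<^sup>2 \<le> K\<^sup>2" if "\<omega> \<in> space M" for \<omega>
    using diffusion_bound[OF i that] by (metis abs_ge_zero power2_abs power_mono)
  have int2: "integrable M (\<lambda>\<omega>. (\<beta> i \<omega>)\<^sup>2)"
    using i \<beta>2 by (intro integrable_const_bound[where B = "K\<^sup>2"]) auto
  have \<beta>N: "(\<lambda>\<omega>. \<beta> i \<omega> * N i \<omega>) \<in> borel_measurable (G i)" and \<beta>2M: "(\<lambda>\<omega>. (\<beta> i \<omega>)\<^sup>2) \<in> borel_measurable (G i)"
    by measurable
  have int1': "integrable M (\<lambda>\<omega>. \<beta> i \<omega> * N i \<omega> * \<xi> i \<omega>)"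
    by (rule step_mult_integrable[OF i \<beta>N int1, of "\<lambda>z. z", OF _ step_integrable(1)[OF i]]) simp
  have int2': "integrable M (\<lambda>\<omega>. (\<beta> i \<omega>)\<^sup>2 * (\<xi> i \<omega>)\<^sup>2)"
    by (rule step_mult_integrable[OF i \<beta>2M int2, of "\<lambda>z. z\<^sup>2", OF _ step_integrable(2)[OF i]]) simp
  have "expectation (\<lambda>\<omega>. (N (Suc i) \<omega>)\<^sup>2) =
      expectation (\<lambda>\<omega>. (N i \<omega>)\<^sup>2) + 2 * expectation (\<lambda>\<omega>. \<beta> i \<omega> * N i \<omega> * \<xi> i \<omega>)
      + expectation (\<lambda>\<omega>. (\<beta> i \<omega>)\<^sup>2 * (\<xi> i \<omega>)\<^sup>2)"
    using N(2) int1' int2' by (simp add: sq)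
  also have "expectation (\<lambda>\<omega>. \<beta> i \<omega> * N i \<omega> * \<xi> i \<omega>) = 0"
    using step_mult_expectation[OF i \<beta>N int1, of "\<lambda>z. z", OF _ step_integrable(1)[OF i]] step_moments(1)[OF i] by simp
  also have "expectation (\<lambda>\<omega>. (\<beta> i \<omega>)\<^sup>2 * (\<xi> i \<omega>)\<^sup>2) = expectation (\<lambda>\<omega>. (\<beta> i \<omega>)\<^sup>2) * \<delta>"
    using step_mult_expectation[OF i \<beta>2M int2, of "\<lambda>z. z\<^sup>2", OF _ step_integrable(2)[OF i]] step_moments(2)[OF i] by simp
  also have "expectation (\<lambda>\<omega>. (\<beta> i \<omega>)\<^sup>2) \<le> K\<^sup>2"
    using integral_mono[OF int2, of "\<lambda>_. K\<^sup>2"] \<beta>2 by (simp add: prob_space)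
  finally have "expectation (\<lambda>\<omega>. (N (Suc i) \<omega>)\<^sup>2) \<le> K\<^sup>2 * (real (i - j) * \<delta>) + K\<^sup>2 * \<delta>"
    using N(3) \<delta>_pos by (simp add: mult_right_mono)
  also have "\<dots> = K\<^sup>2 * (real (Suc i - j) * \<delta>)"
    using step.hyps by (simp add: algebra_simps Suc_diff_le)
  finally show ?case
    using meas N(2) int1' int2' by (simp add: sq)
qed

lemma X_diff_eq:
  "j \<le> i \<Longrightarrow> X i \<omega> - X j \<omega> = (\<Sum>k=j..<i. \<alpha> k \<omega>) * \<delta> + (\<Sum>k=j..<i. \<beta> k \<omega> * \<xi> k \<omega>)"
  using sum_diff_nat_ivl[of 0 j i "\<lambda>k. \<alpha> k \<omega> * \<delta> + \<beta> k \<omega> * \<xi> k \<omega>"]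
  by (simp add: walk_def atLeast0LessThan sum.distrib sum_distrib_right)

lemma drift_sum_bound:
  assumes "i \<le> n" "\<omega> \<in> space M"
  shows "\<bar>(\<Sum>k=j..<i. \<alpha> k \<omega>) * \<delta>\<bar> \<le> K * (real (i - j) * \<delta>)"
proof -
  have "\<bar>\<Sum>k=j..<i. \<alpha> k \<omega>\<bar> \<le> (\<Sum>k=j..<i. K)"
    using assms drift_bound by (intro order.trans[OF sum_abs] sum_mono) auto
  then show ?thesis using \<delta>_pos by (simp add: abs_mult algebra_simps)
qed

lemma X_sq_integrable:
  assumes "i \<le> n"
  shows "integrable M (\<lambda>\<omega>. (X i \<omega>)\<^sup>2)"
proof -
  let ?A = "\<lambda>\<omega>. (\<Sum>k=0..<i. \<alpha> k \<omega>) * \<delta>" and ?N = "\<lambda>\<omega>. \<Sum>k=0..<i. \<beta> k \<omega> * \<xi> k \<omega>"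
  have "X i = (\<lambda>\<omega>. ?A \<omega> + ?N \<omega>)"
    using X_diff_eq[of 0 i] by (auto simp: fun_eq_iff)
  moreover have "integrable M (\<lambda>\<omega>. (?A \<omega> + ?N \<omega>)\<^sup>2)"
  proof (rule integrable_sq_add)
    show A: "?A \<in> borel_measurable M"
      using assms by (intro borel_measurable_times borel_measurable_sum) auto
    show "?N \<in> borel_measurable M" "integrable M (\<lambda>\<omega>. (?N \<omega>)\<^sup>2)"
      using martingale_part_sq[OF le0 assms] measurable_G_M[OF assms, of ?N] by blast+
    show "integrable M (\<lambda>\<omega>. (?A \<omega>)\<^sup>2)"
    proof (rule integrable_const_bound[where B = "(K * (real (i - 0) * \<delta>))\<^sup>2"])
      show "AE \<omega> in M. norm ((?A \<omega>)\<^sup>2) \<le> (K * (real (i - 0) * \<delta>))\<^sup>2"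
        using drift_sum_bound[OF assms, of _ 0]
        by (intro AE_I2) (metis abs_ge_zero norm_power power2_abs power_mono real_norm_def)
    qed (use A in auto)
  qed
  ultimately show ?thesis by simp
qed

lemma X_integrable: "i \<le> n \<Longrightarrow> integrable M (X i)"
  using X_sq_integrable integrable_sqD X_measurable by blast

text \<open>The noise is controlled in the second moment, while the estimates to come are in the
  first; \<bar>u\<bar> \<le> u^2 / \<theta> + \<theta> converts one into the other. For a lag of
  length \<rho> the choice \<theta> = sqrt \<rho> makes the result of order sqrt \<rho>.\<close>

lemma X_increment:
  assumes "j \<le> i" "i \<le> n" "\<theta> > 0"
  shows "expectation (\<lambda>\<omega>. \<bar>X i \<omega> - X j \<omega>\<bar>) \<le> K * (real (i - j) * \<delta>) + (K\<^sup>2 * (real (i - j) * \<delta>) / \<theta> + \<theta>)"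
proof -
  define N where "N = (\<lambda>\<omega>. \<Sum>k=j..<i. \<beta> k \<omega> * \<xi> k \<omega>)"
  have N: "integrable M (\<lambda>\<omega>. (N \<omega>)\<^sup>2)" "expectation (\<lambda>\<omega>. (N \<omega>)\<^sup>2) \<le> K\<^sup>2 * (real (i - j) * \<delta>)"
    using martingale_part_sq[OF assms(1,2)] unfolding N_def by blast+
  have "\<bar>u\<bar> \<le> u\<^sup>2 / \<theta> + \<theta>" for u :: real
  proof -
    have "2 * \<bar>u\<bar> * \<theta> \<le> \<bar>u\<bar>\<^sup>2 + \<theta>\<^sup>2" by (rule sum_squares_bound)
    moreover have "\<bar>u\<bar> * \<theta> \<ge> 0" using assms(3) by simp
    ultimately have "\<bar>u\<bar> * \<theta> \<le> u\<^sup>2 + \<theta>\<^sup>2" by (simp add: power2_abs)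
    then show ?thesis using assms(3) by (simp add: field_simps power2_eq_square)
  qed
  then have N_abs: "\<bar>N \<omega>\<bar> \<le> (N \<omega>)\<^sup>2 / \<theta> + \<theta>" for \<omega> .
  have *: "\<bar>X i \<omega> - X j \<omega>\<bar> \<le> K * (real (i - j) * \<delta>) + ((N \<omega>)\<^sup>2 / \<theta> + \<theta>)" if "\<omega> \<in> space M" for \<omega>
    unfolding N_def X_diff_eq[OF assms(1), of \<omega>]
    by (intro order.trans[OF abs_triangle_ineq] add_mono drift_sum_bound assms that N_abs[of \<omega>, unfolded N_def])
  have "expectation (\<lambda>\<omega>. \<bar>X i \<omega> - X j \<omega>\<bar>) \<le> expectation (\<lambda>\<omega>. K * (real (i - j) * \<delta>) + ((N \<omega>)\<^sup>2 / \<theta> + \<theta>))"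
    using * N(1) X_integrable[of i] X_integrable[of j] assms(1,2) by (intro integral_mono) auto
  also have "\<dots> = K * (real (i - j) * \<delta>) + (expectation (\<lambda>\<omega>. (N \<omega>)\<^sup>2) / \<theta> + \<theta>)"
    using N(1) by (simp add: prob_space)
  also have "\<dots> \<le> K * (real (i - j) * \<delta>) + (K\<^sup>2 * (real (i - j) * \<delta>) / \<theta> + \<theta>)"
    using N(2) assms(3) by (simp add: divide_right_mono)
  finally show ?thesis .
qed

end

section \<open>One-step Taylor expansion and the first moment estimate for walks\<close>

lemma cube_sum_le:
  fixes a b :: real
  assumes "a \<ge> 0" "b \<ge> 0"
  shows "(a + b) ^ 3 \<le> 4 * (a ^ 3 + b ^ 3)"
proof -
  have "4 * (a ^ 3 + b ^ 3) - (a + b) ^ 3 = 3 * ((a + b) * (a - b)\<^sup>2)"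
    by (simp add: power2_eq_square power3_eq_cube algebra_simps)
  moreover have "0 \<le> (a + b) * (a - b)\<^sup>2" using assms by simp
  ultimately show ?thesis by linarith
qed

context bounded_walk
begin

text \<open>The first and second order noise terms are kept in a form whose means are computable:
  the one with a single factor \<open>\<xi> i\<close> averages to 0, the one with its square to
  \<delta> times a mean. What is bounded through \<open>K\<close> has a mean of higher order than
  \<delta>. The premise \<open>active\<close> is there because \<Phi>' is bounded by 1 only on
  [-1, 1]; outside, both coefficients vanish.\<close>

lemma X_step:
  fixes \<Phi> \<Phi>' \<Phi>'' :: "real \<Rightarrow> real" and b B :: real
  assumes i: "i < n" and \<omega>: "\<omega> \<in> space M"
    and \<Phi>': "\<And>u. \<bar>u\<bar> \<le> 1 \<Longrightarrow> \<bar>\<Phi>' u\<bar> \<le> 1"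
    and \<Phi>'': "\<And>u. \<Phi>'' u \<ge> 0" "\<And>u. \<Phi>'' u \<le> b" "B \<ge> 0"
    and taylor: "\<And>u h. \<Phi> (u + h) \<le> \<Phi> u + \<Phi>' u * h + \<Phi>'' u * h\<^sup>2 + B * \<bar>h\<bar> ^ 3"
    and active: "\<alpha> i \<omega> \<noteq> 0 \<or> \<beta> i \<omega> \<noteq> 0 \<Longrightarrow> \<bar>X i \<omega>\<bar> \<le> 1"
  shows "\<Phi> (X (Suc i) \<omega>) \<le> \<Phi> (X i \<omega>) + \<delta> * \<bar>\<alpha> i \<omega>\<bar> + \<Phi>' (X i \<omega>) * \<beta> i \<omega> * \<xi> i \<omega>
      + 2 * (b * K\<^sup>2 * \<delta>\<^sup>2) + 2 * (\<Phi>'' (X i \<omega>) * (\<beta> i \<omega>)\<^sup>2 * (\<xi> i \<omega>)\<^sup>2) + 4 * B * K ^ 3 * (\<delta> ^ 3 + \<bar>\<xi> i \<omega>\<bar> ^ 3)"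
proof -
  define u where "u = X i \<omega>"
  define h where "h = \<alpha> i \<omega> * \<delta> + \<beta> i \<omega> * \<xi> i \<omega>"
  note bd = drift_bound[OF i \<omega>] diffusion_bound[OF i \<omega>]
  have "\<Phi>' u * \<alpha> i \<omega> \<le> \<bar>\<alpha> i \<omega>\<bar>"
  proof (cases "\<alpha> i \<omega> = 0")
    case False
    then have "\<bar>\<Phi>' u\<bar> \<le> 1" using \<Phi>' active by (simp add: u_def)
    then have "\<bar>\<Phi>' u * \<alpha> i \<omega>\<bar> \<le> 1 * \<bar>\<alpha> i \<omega>\<bar>" unfolding abs_mult by (intro mult_right_mono) auto
    then show ?thesis by linarith
  qed simp
  then have 1: "\<Phi>' u * h \<le> \<delta> * \<bar>\<alpha> i \<omega>\<bar> + \<Phi>' u * \<beta> i \<omega> * \<xi> i \<omega>"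
    using mult_left_mono[of "\<Phi>' u * \<alpha> i \<omega>" "\<bar>\<alpha> i \<omega>\<bar>" \<delta>] \<delta>_pos by (simp add: h_def algebra_simps)
  have "h\<^sup>2 \<le> 2 * (\<alpha> i \<omega> * \<delta>)\<^sup>2 + 2 * (\<beta> i \<omega> * \<xi> i \<omega>)\<^sup>2"
    using sum_squares_bound[of "\<alpha> i \<omega> * \<delta>" "\<beta> i \<omega> * \<xi> i \<omega>"] by (simp add: h_def power2_sum)
  then have "\<Phi>'' u * h\<^sup>2 \<le> \<Phi>'' u * (2 * (\<alpha> i \<omega> * \<delta>)\<^sup>2 + 2 * (\<beta> i \<omega> * \<xi> i \<omega>)\<^sup>2)"
    using \<Phi>''(1) by (intro mult_left_mono) auto
  also have "\<dots> = 2 * (\<Phi>'' u * (\<alpha> i \<omega>)\<^sup>2 * \<delta>\<^sup>2) + 2 * (\<Phi>'' u * (\<beta> i \<omega>)\<^sup>2 * (\<xi> i \<omega>)\<^sup>2)"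
    by (simp add: algebra_simps power_mult_distrib)
  also have "\<Phi>'' u * (\<alpha> i \<omega>)\<^sup>2 * \<delta>\<^sup>2 \<le> b * K\<^sup>2 * \<delta>\<^sup>2"
  proof (intro mult_right_mono mult_mono)
    show "(\<alpha> i \<omega>)\<^sup>2 \<le> K\<^sup>2" using bd(1) by (metis abs_ge_zero power2_abs power_mono)
    show "0 \<le> b" using \<Phi>''(1)[of 0] \<Phi>''(2)[of 0] by linarith
  qed (use \<Phi>'' in auto)
  finally have 2: "\<Phi>'' u * h\<^sup>2 \<le> 2 * (b * K\<^sup>2 * \<delta>\<^sup>2) + 2 * (\<Phi>'' u * (\<beta> i \<omega>)\<^sup>2 * (\<xi> i \<omega>)\<^sup>2)" by simp
  have "\<bar>h\<bar> \<le> K * \<delta> + K * \<bar>\<xi> i \<omega>\<bar>"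
    unfolding h_def using bd \<delta>_pos
    by (intro order.trans[OF abs_triangle_ineq] add_mono) (auto simp: abs_mult intro!: mult_right_mono)
  then have "\<bar>h\<bar> ^ 3 \<le> (K * \<delta> + K * \<bar>\<xi> i \<omega>\<bar>) ^ 3" by (intro power_mono) auto
  also have "\<dots> \<le> 4 * ((K * \<delta>) ^ 3 + (K * \<bar>\<xi> i \<omega>\<bar>) ^ 3)"
    using K_nonneg \<delta>_pos by (intro cube_sum_le) auto
  also have "\<dots> = 4 * K ^ 3 * (\<delta> ^ 3 + \<bar>\<xi> i \<omega>\<bar> ^ 3)"
    by (simp add: algebra_simps power_mult_distrib)
  finally have 3: "B * \<bar>h\<bar> ^ 3 \<le> 4 * B * K ^ 3 * (\<delta> ^ 3 + \<bar>\<xi> i \<omega>\<bar> ^ 3)"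
    using mult_left_mono[of "\<bar>h\<bar> ^ 3" _ B] \<Phi>''(3) by (metis (no_types, lifting) mult.assoc mult.left_commute)
  show ?thesis
    using taylor[of u h] 1 2 3 by (simp add: walk_Suc u_def h_def)
qed

text \<open>The critical term is \<Phi>'' times the squared diffusion coefficient. The latter is at
  most C \<bar>X i\<bar> plus small terms, and \<bar>u\<bar> \<Phi>'' u \<le> \<epsilon> reduces the
  main contribution to C \<epsilon>, however large \<Phi>'' is near 0. Here \<open>z\<close> bounds
  the mean of a walk increment over a lag of length \<rho>, and \<open>q\<close> collects, per unit
  of time, everything except C times the mean of \<bar>X i\<bar>. Summation together with
  \<bar>u\<bar> \<le> 2 \<Phi> u + \<epsilon> gives a Gronwall inequality for that mean.\<close>

lemma X_estimate:
  fixes \<Phi> \<Phi>' \<Phi>'' :: "real \<Rightarrow> real" and b B \<epsilon> C \<rho> T :: real and \<kappa> \<gamma> :: "nat \<Rightarrow> nat"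
  assumes meas [measurable]: "\<Phi> \<in> borel_measurable borel" "\<Phi>' \<in> borel_measurable borel" "\<Phi>'' \<in> borel_measurable borel"
    and \<Phi>: "\<Phi> 0 = 0" "\<And>u. \<Phi> u \<ge> 0" "\<And>u. \<Phi> u \<le> b * u\<^sup>2" "\<And>u. \<bar>u\<bar> \<le> 2 * \<Phi> u + \<epsilon>"
    and \<Phi>': "\<And>u. \<bar>u\<bar> \<le> 1 \<Longrightarrow> \<bar>\<Phi>' u\<bar> \<le> 1"
    and \<Phi>'': "\<And>u. \<Phi>'' u \<ge> 0" "\<And>u. \<Phi>'' u \<le> b" "\<And>u. \<bar>u\<bar> * \<Phi>'' u \<le> \<epsilon>" "B \<ge> 0"
    and taylor: "\<And>u h. \<Phi> (u + h) \<le> \<Phi> u + \<Phi>' u * h + \<Phi>'' u * h\<^sup>2 + B * \<bar>h\<bar> ^ 3"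
    and C: "C \<ge> 0" and T: "real n * \<delta> \<le> T" and \<rho>: "\<rho> > 0" "\<delta> \<le> \<rho>"
    and idx: "\<And>i. i < n \<Longrightarrow> \<kappa> i \<le> i \<and> real (i - \<kappa> i) * \<delta> \<le> \<rho>" "\<And>i. i < n \<Longrightarrow> \<gamma> i \<le> i \<and> real (i - \<gamma> i) * \<delta> \<le> \<rho>"
    and active: "\<And>i \<omega>. i < n \<Longrightarrow> \<omega> \<in> space M \<Longrightarrow> \<alpha> i \<omega> \<noteq> 0 \<or> \<beta> i \<omega> \<noteq> 0 \<Longrightarrow> \<bar>X i \<omega>\<bar> \<le> 1"
    and drift: "\<And>i \<omega>. i < n \<Longrightarrow> \<omega> \<in> space M \<Longrightarrow>
       \<bar>\<alpha> i \<omega>\<bar> \<le> C * (\<rho> + \<bar>X i \<omega>\<bar> + \<bar>X i \<omega> - X (\<kappa> i) \<omega>\<bar> + \<bar>X i \<omega> - X (\<gamma> i) \<omega>\<bar>)"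
    and diffusion: "\<And>i \<omega>. i < n \<Longrightarrow> \<omega> \<in> space M \<Longrightarrow>
       (\<beta> i \<omega>)\<^sup>2 \<le> C * (\<rho> + \<bar>X i \<omega>\<bar> + \<bar>X i \<omega> - X (\<kappa> i) \<omega>\<bar> + \<bar>X i \<omega> - X (\<gamma> i) \<omega>\<bar>)"
  defines "z \<equiv> K * \<rho> + (K\<^sup>2 * \<rho> / sqrt \<rho> + sqrt \<rho>)"
  defines "q \<equiv> C * (\<rho> + 2 * z) + 2 * (b * K\<^sup>2 * \<rho>) + 2 * (C * (b * (\<rho> + 2 * z) + \<epsilon>)) + 4 * B * K ^ 3 * (\<rho>\<^sup>2 + 2 * sqrt \<rho>)"
  shows "expectation (\<lambda>\<omega>. \<bar>X n \<omega>\<bar>) \<le> (\<epsilon> + 2 * T * q) * exp (2 * C * T)"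
proof -
  define a where "a = (\<lambda>i. expectation (\<lambda>\<omega>. \<bar>X i \<omega>\<bar>))"
  have b: "b \<ge> 0" using \<Phi>''(1)[of 0] \<Phi>''(2)[of 0] by linarith
  have \<epsilon>: "\<epsilon> \<ge> 0" using \<Phi>(4)[of 0] \<Phi>(1) by simp
  have z: "z \<ge> 0" using K_nonneg \<rho> by (simp add: z_def)
  have q: "q \<ge> 0" unfolding q_def using C b \<epsilon> z \<rho> K_nonneg \<Phi>''(4) by (intro add_nonneg_nonneg mult_nonneg_nonneg) auto
  have intX: "integrable M (X i)" if "i \<le> n" for i using X_integrable that .
  have int\<Phi>: "integrable M (\<lambda>\<omega>. \<Phi> (X i \<omega>))" if i: "i \<le> n" for i
  proof (rule Bochner_Integration.integrable_bound[where f = "\<lambda>\<omega>. b * (X i \<omega>)\<^sup>2"])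
    show "integrable M (\<lambda>\<omega>. b * (X i \<omega>)\<^sup>2)" using X_sq_integrable[OF i] by simp
    show "(\<lambda>\<omega>. \<Phi> (X i \<omega>)) \<in> borel_measurable M"
      using measurable_compose[OF X_measurable[OF i] meas(1)] .
    show "AE \<omega> in M. norm (\<Phi> (X i \<omega>)) \<le> norm (b * (X i \<omega>)\<^sup>2)"
      using \<Phi>(2,3) b by (intro AE_I2) simp
  qed
  have inc: "expectation (\<lambda>\<omega>. \<bar>X i \<omega> - X j \<omega>\<bar>) \<le> z" if "j \<le> i" "i \<le> n" "real (i - j) * \<delta> \<le> \<rho>" for i j
  proof -
    have "expectation (\<lambda>\<omega>. \<bar>X i \<omega> - X j \<omega>\<bar>) \<le> K * (real (i - j) * \<delta>) + (K\<^sup>2 * (real (i - j) * \<delta>) / sqrt \<rho> + sqrt \<rho>)"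
      using X_increment[OF that(1,2), of "sqrt \<rho>"] \<rho> by simp
    also have "\<dots> \<le> z" unfolding z_def
      using that(3) K_nonneg \<rho> by (intro add_mono mult_left_mono divide_right_mono) auto
    finally show ?thesis .
  qed
  have step: "expectation (\<lambda>\<omega>. \<Phi> (X (Suc i) \<omega>)) \<le> expectation (\<lambda>\<omega>. \<Phi> (X i \<omega>)) + \<delta> * (C * a i + q)"
    if i: "i < n" for i
  proof -
    define Z where "Z = (\<lambda>\<omega>. \<bar>X i \<omega> - X (\<kappa> i) \<omega>\<bar> + \<bar>X i \<omega> - X (\<gamma> i) \<omega>\<bar>)"
    have le: "\<kappa> i \<le> n" "\<gamma> i \<le> n" "i \<le> n" "Suc i \<le> n" using idx[OF i] i by auto
    have intZ: "integrable M Z"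
      unfolding Z_def using le by (intro Bochner_Integration.integrable_add integrable_abs Bochner_Integration.integrable_diff intX)
    have EZ: "expectation Z \<le> 2 * z"
      unfolding Z_def using le idx[OF i] inc[of "\<kappa> i" i] inc[of "\<gamma> i" i]
      by (subst Bochner_Integration.integral_add) (auto intro!: integrable_abs Bochner_Integration.integrable_diff intX)
    have Xi: "X i \<in> borel_measurable (G i)" using X_adapted le by simp
    note \<beta>i = diffusion_adapted[OF i]
    have G1: "(\<lambda>\<omega>. \<Phi>' (X i \<omega>) * \<beta> i \<omega>) \<in> borel_measurable (G i)"
      and G2: "(\<lambda>\<omega>. \<Phi>'' (X i \<omega>) * (\<beta> i \<omega>)\<^sup>2) \<in> borel_measurable (G i)"
      by (intro borel_measurable_times borel_measurable_power measurable_compose[OF Xi] meas \<beta>i)+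
    have I1: "integrable M (\<lambda>\<omega>. \<Phi>' (X i \<omega>) * \<beta> i \<omega>)"
    proof (rule integrable_const_bound[where B = K])
      have "\<bar>\<Phi>' (X i \<omega>) * \<beta> i \<omega>\<bar> \<le> K" if \<omega>: "\<omega> \<in> space M" for \<omega>
      proof (cases "\<beta> i \<omega> = 0")
        case False
        then have "\<bar>\<Phi>' (X i \<omega>)\<bar> * \<bar>\<beta> i \<omega>\<bar> \<le> 1 * K"
          using \<Phi>' active[OF i \<omega>] diffusion_bound[OF i \<omega>] by (intro mult_mono) auto
        then show ?thesis by (simp add: abs_mult)
      qed (use K_nonneg in simp)
      then show "AE \<omega> in M. norm (\<Phi>' (X i \<omega>) * \<beta> i \<omega>) \<le> K" by simp
    qed (rule measurable_G_M[OF le(3) G1])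
    have \<Phi>''\<beta>: "\<Phi>'' (X i \<omega>) * (\<beta> i \<omega>)\<^sup>2 \<le> C * (b * (\<rho> + Z \<omega>) + \<epsilon>)" if \<omega>: "\<omega> \<in> space M" for \<omega>
    proof -
      have "\<Phi>'' (X i \<omega>) * (\<beta> i \<omega>)\<^sup>2 \<le> \<Phi>'' (X i \<omega>) * (C * (\<rho> + \<bar>X i \<omega>\<bar> + Z \<omega>))"
        using diffusion[OF i \<omega>] \<Phi>''(1) by (intro mult_left_mono) (auto simp: Z_def add.assoc)
      also have "\<dots> = C * (\<Phi>'' (X i \<omega>) * (\<rho> + Z \<omega>) + \<bar>X i \<omega>\<bar> * \<Phi>'' (X i \<omega>))"
        by (simp add: algebra_simps)
      also have "\<dots> \<le> C * (b * (\<rho> + Z \<omega>) + \<epsilon>)"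
        using C \<Phi>'' \<rho> by (intro mult_left_mono add_mono mult_right_mono) (auto simp: Z_def)
      finally show ?thesis .
    qed
    have I2: "integrable M (\<lambda>\<omega>. \<Phi>'' (X i \<omega>) * (\<beta> i \<omega>)\<^sup>2)"
    proof (rule Bochner_Integration.integrable_bound[where f = "\<lambda>\<omega>. C * (b * (\<rho> + Z \<omega>) + \<epsilon>)"])
      show "AE \<omega> in M. norm (\<Phi>'' (X i \<omega>) * (\<beta> i \<omega>)\<^sup>2) \<le> norm (C * (b * (\<rho> + Z \<omega>) + \<epsilon>))"
        using \<Phi>''\<beta> \<Phi>''(1) by (intro AE_I2) (simp add: order.trans[OF _ abs_ge_self])
    qed (use intZ measurable_G_M[OF le(3) G2] in auto)
    have J1: "integrable M (\<lambda>\<omega>. \<Phi>' (X i \<omega>) * \<beta> i \<omega> * \<xi> i \<omega>)"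
      by (rule step_mult_integrable[OF i G1 I1, of "\<lambda>z. z", OF _ step_integrable(1)[OF i]]) simp
    have E1: "expectation (\<lambda>\<omega>. \<Phi>' (X i \<omega>) * \<beta> i \<omega> * \<xi> i \<omega>) = 0"
      using step_mult_expectation[OF i G1 I1, of "\<lambda>z. z", OF _ step_integrable(1)[OF i]] step_moments(1)[OF i] by simp
    have J2: "integrable M (\<lambda>\<omega>. \<Phi>'' (X i \<omega>) * (\<beta> i \<omega>)\<^sup>2 * (\<xi> i \<omega>)\<^sup>2)"
      by (rule step_mult_integrable[OF i G2 I2, of "\<lambda>z. z\<^sup>2", OF _ step_integrable(2)[OF i]]) simp
    have E2: "expectation (\<lambda>\<omega>. \<Phi>'' (X i \<omega>) * (\<beta> i \<omega>)\<^sup>2 * (\<xi> i \<omega>)\<^sup>2) =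
        expectation (\<lambda>\<omega>. \<Phi>'' (X i \<omega>) * (\<beta> i \<omega>)\<^sup>2) * \<delta>"
      using step_mult_expectation[OF i G2 I2, of "\<lambda>z. z\<^sup>2", OF _ step_integrable(2)[OF i]] step_moments(2)[OF i] by simp
    have E2': "expectation (\<lambda>\<omega>. \<Phi>'' (X i \<omega>) * (\<beta> i \<omega>)\<^sup>2) \<le> C * (b * (\<rho> + 2 * z) + \<epsilon>)"
    proof -
      have "expectation (\<lambda>\<omega>. \<Phi>'' (X i \<omega>) * (\<beta> i \<omega>)\<^sup>2) \<le> expectation (\<lambda>\<omega>. C * (b * (\<rho> + Z \<omega>) + \<epsilon>))"
        using I2 intZ \<Phi>''\<beta> by (intro integral_mono) auto
      also have "\<dots> = C * (b * (\<rho> + expectation Z) + \<epsilon>)" using intZ by (simp add: prob_space)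
      also have "\<dots> \<le> C * (b * (\<rho> + 2 * z) + \<epsilon>)"
        using EZ C b by (intro mult_left_mono add_mono) auto
      finally show ?thesis .
    qed
    have int\<alpha>: "integrable M (\<lambda>\<omega>. \<bar>\<alpha> i \<omega>\<bar>)"
      using drift_bound[OF i] drift_measurable[OF i] by (intro integrable_const_bound[where B = K]) auto
    have E0: "expectation (\<lambda>\<omega>. \<bar>\<alpha> i \<omega>\<bar>) \<le> C * (\<rho> + a i + 2 * z)"
    proof -
      have "expectation (\<lambda>\<omega>. \<bar>\<alpha> i \<omega>\<bar>) \<le> expectation (\<lambda>\<omega>. C * (\<rho> + \<bar>X i \<omega>\<bar> + Z \<omega>))"
        using int\<alpha> intZ intX[OF le(3)] drift[OF i] by (intro integral_mono) (auto simp: Z_def add.assoc)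
      also have "\<dots> = C * (\<rho> + a i + expectation Z)" using intZ intX[OF le(3)] by (simp add: prob_space a_def)
      also have "\<dots> \<le> C * (\<rho> + a i + 2 * z)" using EZ C by (intro mult_left_mono add_mono) auto
      finally show ?thesis .
    qed
    have "expectation (\<lambda>\<omega>. \<Phi> (X (Suc i) \<omega>)) \<le> expectation (\<lambda>\<omega>. \<Phi> (X i \<omega>) + \<delta> * \<bar>\<alpha> i \<omega>\<bar> + \<Phi>' (X i \<omega>) * \<beta> i \<omega> * \<xi> i \<omega>
      + 2 * (b * K\<^sup>2 * \<delta>\<^sup>2) + 2 * (\<Phi>'' (X i \<omega>) * (\<beta> i \<omega>)\<^sup>2 * (\<xi> i \<omega>)\<^sup>2) + 4 * B * K ^ 3 * (\<delta> ^ 3 + \<bar>\<xi> i \<omega>\<bar> ^ 3))"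
      using X_step[OF i _ \<Phi>' \<Phi>''(1,2,4) taylor active[OF i]] int\<Phi>[OF le(4)] int\<Phi>[OF le(3)] J1 J2 int\<alpha> step_integrable(3)[OF i]
      by (intro integral_mono Bochner_Integration.integrable_add integrable_mult_right) auto
    also have "\<dots> = expectation (\<lambda>\<omega>. \<Phi> (X i \<omega>)) + \<delta> * expectation (\<lambda>\<omega>. \<bar>\<alpha> i \<omega>\<bar>) + 2 * (b * K\<^sup>2 * \<delta>\<^sup>2)
      + 2 * (expectation (\<lambda>\<omega>. \<Phi>'' (X i \<omega>) * (\<beta> i \<omega>)\<^sup>2) * \<delta>)
      + 4 * B * K ^ 3 * (\<delta> ^ 3 + expectation (\<lambda>\<omega>. \<bar>\<xi> i \<omega>\<bar> ^ 3))"
      using int\<Phi>[OF le(3)] J1 J2 int\<alpha> step_integrable(3)[OF i] by (simp add: E1 E2 prob_space)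
    \<comment> \<open>Each remainder is reduced to \<delta> times a function of \<rho> by trading
      the surplus powers of \<delta> for powers of \<rho>. Summing n steps then costs only n
      \<delta> \<le> T, however fine the grid is.\<close>
    also have "\<dots> \<le> expectation (\<lambda>\<omega>. \<Phi> (X i \<omega>)) + \<delta> * (C * (\<rho> + a i + 2 * z)) + 2 * (b * K\<^sup>2 * (\<delta> * \<rho>))
      + 2 * (C * (b * (\<rho> + 2 * z) + \<epsilon>) * \<delta>) + 4 * B * K ^ 3 * (\<delta> * \<rho>\<^sup>2 + 2 * (\<delta> * sqrt \<rho>))"
    proof (intro add_mono mult_left_mono mult_right_mono E0 E2' order.refl)
      show "\<delta>\<^sup>2 \<le> \<delta> * \<rho>" using \<rho> \<delta>_pos by (simp add: power2_eq_square)
      show "\<delta> ^ 3 \<le> \<delta> * \<rho>\<^sup>2" using \<rho> \<delta>_pos power_mono[of \<delta> \<rho> 2] by (simp add: power3_eq_cube power2_eq_square mult.assoc)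
      show "expectation (\<lambda>\<omega>. \<bar>\<xi> i \<omega>\<bar> ^ 3) \<le> 2 * (\<delta> * sqrt \<rho>)"
        using \<rho> \<delta>_pos by (intro order.trans[OF step_moments(3)[OF i]]) simp
    qed (use b K_nonneg \<Phi>''(4) \<delta>_pos in auto)
    also have "\<dots> = expectation (\<lambda>\<omega>. \<Phi> (X i \<omega>)) + \<delta> * (C * a i + q)"
      by (simp add: q_def algebra_simps)
    finally show ?thesis .
  qed
  have E\<Phi>: "expectation (\<lambda>\<omega>. \<Phi> (X i \<omega>)) \<le> \<delta> * C * (\<Sum>j<i. a j) + real i * \<delta> * q" if "i \<le> n" for i
    using that
  proof (induction i)
    case (Suc i)
    then show ?case using step[of i] by (simp add: algebra_simps)
  qed (simp add: \<Phi>(1))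
  have "a n \<le> (\<epsilon> + 2 * T * q) * exp (2 * \<delta> * C * real n)"
  proof (rule discrete_gronwall)
    fix i assume i: "i \<le> n"
    have "a i \<le> expectation (\<lambda>\<omega>. 2 * \<Phi> (X i \<omega>) + \<epsilon>)"
      unfolding a_def using int\<Phi>[OF i] intX[OF i] \<Phi>(4) by (intro integral_mono) auto
    also have "\<dots> = 2 * expectation (\<lambda>\<omega>. \<Phi> (X i \<omega>)) + \<epsilon>"
      using int\<Phi>[OF i] by (simp add: prob_space)
    also have "\<dots> \<le> 2 * (\<delta> * C * (\<Sum>j<i. a j) + T * q) + \<epsilon>"
    proof -
      have "real i * \<delta> \<le> T" using T i \<delta>_pos by (meson mult_right_mono of_nat_le_iff order.trans less_imp_le)
      then have "real i * \<delta> * q \<le> T * q" using q by (intro mult_right_mono)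
      then show ?thesis using E\<Phi>[OF i] by simp
    qed
    finally show "a i \<le> \<epsilon> + 2 * T * q + 2 * \<delta> * C * (\<Sum>j<i. a j)" by (simp add: algebra_simps)
  next
    have "0 \<le> real n * \<delta>" using \<delta>_pos by simp
    then show "0 \<le> \<epsilon> + 2 * T * q" using \<epsilon> q T by simp
  qed (use \<delta>_pos C in \<open>auto simp: a_def\<close>)
  also have "\<dots> \<le> (\<epsilon> + 2 * T * q) * exp (2 * C * T)"
  proof (intro mult_left_mono)
    have "2 * C * (real n * \<delta>) \<le> 2 * C * T" using T C by (intro mult_left_mono) auto
    then show "exp (2 * \<delta> * C * real n) \<le> exp (2 * C * T)" by (simp add: algebra_simps)
    have "0 \<le> real n * \<delta>" using \<delta>_pos by simp
    then show "0 \<le> \<epsilon> + 2 * T * q" using \<epsilon> q T by simp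
  qed
  finally show ?thesis by (simp add: a_def)
qed

end

text \<open>The order of the quantifiers is the content. The Yamada-Watanabe function is fixed by
  \<epsilon> alone, and in the bound of \<open>X_estimate\<close> its constants b and B, like
  \<open>K\<close>, stand next to factors that vanish with \<rho>. So one \<rho> serves every
  measure, filtration, grid and pair of index maps, and all of these may be chosen later in
  dependence on \<rho>.\<close>

lemma walk_L1_small:
  fixes C K T tol :: real
  assumes "C \<ge> 0" "T \<ge> 0" "tol > 0"
  obtains \<rho> where "\<rho> > 0"
    "\<And>(M :: 'a measure) G \<xi> \<delta> n \<alpha> \<beta> \<kappa> \<gamma>.
      bounded_walk M G \<xi> \<delta> n \<alpha> \<beta> K \<Longrightarrow> real n * \<delta> \<le> T \<Longrightarrow> \<delta> \<le> \<rho> \<Longrightarrow>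
      (\<And>i. i < n \<Longrightarrow> \<kappa> i \<le> i \<and> real (i - \<kappa> i) * \<delta> \<le> \<rho>) \<Longrightarrow> (\<And>i. i < n \<Longrightarrow> \<gamma> i \<le> i \<and> real (i - \<gamma> i) * \<delta> \<le> \<rho>) \<Longrightarrow>
      (\<And>i \<omega>. i < n \<Longrightarrow> \<omega> \<in> space M \<Longrightarrow> \<alpha> i \<omega> \<noteq> 0 \<or> \<beta> i \<omega> \<noteq> 0 \<Longrightarrow> \<bar>walk \<delta> \<xi> \<alpha> \<beta> i \<omega>\<bar> \<le> 1) \<Longrightarrow>
      (\<And>i \<omega>. i < n \<Longrightarrow> \<omega> \<in> space M \<Longrightarrow> \<bar>\<alpha> i \<omega>\<bar> \<le> C * (\<rho> + \<bar>walk \<delta> \<xi> \<alpha> \<beta> i \<omega>\<bar>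
         + \<bar>walk \<delta> \<xi> \<alpha> \<beta> i \<omega> - walk \<delta> \<xi> \<alpha> \<beta> (\<kappa> i) \<omega>\<bar> + \<bar>walk \<delta> \<xi> \<alpha> \<beta> i \<omega> - walk \<delta> \<xi> \<alpha> \<beta> (\<gamma> i) \<omega>\<bar>)) \<Longrightarrow>
      (\<And>i \<omega>. i < n \<Longrightarrow> \<omega> \<in> space M \<Longrightarrow> (\<beta> i \<omega>)\<^sup>2 \<le> C * (\<rho> + \<bar>walk \<delta> \<xi> \<alpha> \<beta> i \<omega>\<bar>
         + \<bar>walk \<delta> \<xi> \<alpha> \<beta> i \<omega> - walk \<delta> \<xi> \<alpha> \<beta> (\<kappa> i) \<omega>\<bar> + \<bar>walk \<delta> \<xi> \<alpha> \<beta> i \<omega> - walk \<delta> \<xi> \<alpha> \<beta> (\<gamma> i) \<omega>\<bar>)) \<Longrightarrow>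
      integrable M (walk \<delta> \<xi> \<alpha> \<beta> n) \<and> (\<integral>\<omega>. \<bar>walk \<delta> \<xi> \<alpha> \<beta> n \<omega>\<bar> \<partial>M) \<le> tol"
proof -
  \<comment> \<open>As \<rho> tends to 0, \<open>q\<close> tends to 2 C \<epsilon>, so the bound of
    \<open>X_estimate\<close> tends to \<epsilon> D. With \<epsilon> = tol / (2 D) this is tol / 2,
    which leaves room for a strict inequality.\<close>
  define D where "D = (1 + 4 * T * C) * exp (2 * C * T)"
  define \<epsilon> where "\<epsilon> = tol / (2 * D)"
  have D: "D > 0" using assms by (simp add: D_def add_pos_nonneg)
  have "\<epsilon> > 0" using assms D by (simp add: \<epsilon>_def)
  then obtain \<Phi> \<Phi>' \<Phi>'' b B where Y:
    "\<Phi> \<in> borel_measurable borel" "\<Phi>' \<in> borel_measurable borel" "\<Phi>'' \<in> borel_measurable borel"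
    "\<Phi> 0 = 0" "\<And>u. \<Phi> u \<ge> 0" "\<And>u. \<Phi> u \<le> b * u\<^sup>2" "\<And>u. \<bar>u\<bar> \<le> 2 * \<Phi> u + \<epsilon>"
    "\<And>u. \<bar>u\<bar> \<le> 1 \<Longrightarrow> \<bar>\<Phi>' u\<bar> \<le> 1"
    "\<And>u. \<Phi>'' u \<ge> 0" "\<And>u. \<Phi>'' u \<le> b" "\<And>u. \<bar>u\<bar> * \<Phi>'' u \<le> \<epsilon>" "B \<ge> 0"
    "\<And>u h. \<Phi> (u + h) \<le> \<Phi> u + \<Phi>' u * h + \<Phi>'' u * h\<^sup>2 + B * \<bar>h\<bar> ^ 3"
    by (rule yamada_function) blast
  define z where "z = (\<lambda>\<rho>. K * \<rho> + (K\<^sup>2 * \<rho> / sqrt \<rho> + sqrt \<rho>))"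
  define q where "q = (\<lambda>\<rho>. C * (\<rho> + 2 * z \<rho>) + 2 * (b * K\<^sup>2 * \<rho>) + 2 * (C * (b * (\<rho> + 2 * z \<rho>) + \<epsilon>))
      + 4 * B * K ^ 3 * (\<rho>\<^sup>2 + 2 * sqrt \<rho>))"
  have "((\<lambda>\<rho>. K * \<rho> + (K\<^sup>2 * sqrt \<rho> + sqrt \<rho>)) \<longlongrightarrow> K * 0 + (K\<^sup>2 * sqrt 0 + sqrt 0)) (at_right 0)"
    by (intro tendsto_intros)
  moreover have "\<forall>\<^sub>F \<rho> in at_right 0. K * \<rho> + (K\<^sup>2 * sqrt \<rho> + sqrt \<rho>) = z \<rho>"
    using eventually_at_right_less[of "0 :: real"]
    by eventually_elim (simp add: z_def real_div_sqrt flip: times_divide_eq_right)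
  ultimately have z0: "(z \<longlongrightarrow> 0) (at_right 0)"
    by (simp add: tendsto_cong)
  have "((\<lambda>\<rho>. (\<epsilon> + 2 * T * q \<rho>) * exp (2 * C * T)) \<longlongrightarrow>
      (\<epsilon> + 2 * T * (C * (0 + 2 * 0) + 2 * (b * K\<^sup>2 * 0) + 2 * (C * (b * (0 + 2 * 0) + \<epsilon>))
      + 4 * B * K ^ 3 * (0\<^sup>2 + 2 * sqrt 0))) * exp (2 * C * T)) (at_right 0)"
    unfolding q_def by (intro tendsto_intros z0)
  moreover have "(\<epsilon> + 2 * T * (C * (0 + 2 * 0) + 2 * (b * K\<^sup>2 * 0) + 2 * (C * (b * (0 + 2 * 0) + \<epsilon>))
      + 4 * B * K ^ 3 * (0\<^sup>2 + 2 * sqrt 0))) * exp (2 * C * T) = tol / 2"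
  proof -
    have "(\<epsilon> + 2 * T * (2 * (C * \<epsilon>))) * exp (2 * C * T) = \<epsilon> * D"
      by (simp add: D_def algebra_simps)
    also have "\<dots> = tol / 2" using D by (simp add: \<epsilon>_def)
    finally show ?thesis by simp
  qed
  ultimately have "((\<lambda>\<rho>. (\<epsilon> + 2 * T * q \<rho>) * exp (2 * C * T)) \<longlongrightarrow> tol / 2) (at_right 0)" by metis
  moreover have "tol / 2 < tol" using assms by simp
  ultimately have "\<forall>\<^sub>F \<rho> in at_right 0. (\<epsilon> + 2 * T * q \<rho>) * exp (2 * C * T) < tol"
    by (rule order_tendstoD(2))
  with eventually_at_right_less[of "0 :: real"]
  have "\<forall>\<^sub>F \<rho> in at_right 0. 0 < \<rho> \<and> (\<epsilon> + 2 * T * q \<rho>) * exp (2 * C * T) < tol"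
    by eventually_elim simp
  then obtain \<rho> where \<rho>: "\<rho> > 0" "(\<epsilon> + 2 * T * q \<rho>) * exp (2 * C * T) < tol"
    using eventually_happens[of _ "at_right (0 :: real)"] by auto
  show thesis
  proof (rule that[OF \<rho>(1)])
    fix M :: "'a measure" and G \<xi> \<delta> n \<alpha> \<beta> and \<kappa> \<gamma> :: "nat \<Rightarrow> nat"
    assume "bounded_walk M G \<xi> \<delta> n \<alpha> \<beta> K" and *: "real n * \<delta> \<le> T" "\<delta> \<le> \<rho>"
      "\<And>i. i < n \<Longrightarrow> \<kappa> i \<le> i \<and> real (i - \<kappa> i) * \<delta> \<le> \<rho>" "\<And>i. i < n \<Longrightarrow> \<gamma> i \<le> i \<and> real (i - \<gamma> i) * \<delta> \<le> \<rho>"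
      "\<And>i \<omega>. i < n \<Longrightarrow> \<omega> \<in> space M \<Longrightarrow> \<alpha> i \<omega> \<noteq> 0 \<or> \<beta> i \<omega> \<noteq> 0 \<Longrightarrow> \<bar>walk \<delta> \<xi> \<alpha> \<beta> i \<omega>\<bar> \<le> 1"
      "\<And>i \<omega>. i < n \<Longrightarrow> \<omega> \<in> space M \<Longrightarrow> \<bar>\<alpha> i \<omega>\<bar> \<le> C * (\<rho> + \<bar>walk \<delta> \<xi> \<alpha> \<beta> i \<omega>\<bar>
         + \<bar>walk \<delta> \<xi> \<alpha> \<beta> i \<omega> - walk \<delta> \<xi> \<alpha> \<beta> (\<kappa> i) \<omega>\<bar> + \<bar>walk \<delta> \<xi> \<alpha> \<beta> i \<omega> - walk \<delta> \<xi> \<alpha> \<beta> (\<gamma> i) \<omega>\<bar>)"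
      "\<And>i \<omega>. i < n \<Longrightarrow> \<omega> \<in> space M \<Longrightarrow> (\<beta> i \<omega>)\<^sup>2 \<le> C * (\<rho> + \<bar>walk \<delta> \<xi> \<alpha> \<beta> i \<omega>\<bar>
         + \<bar>walk \<delta> \<xi> \<alpha> \<beta> i \<omega> - walk \<delta> \<xi> \<alpha> \<beta> (\<kappa> i) \<omega>\<bar> + \<bar>walk \<delta> \<xi> \<alpha> \<beta> i \<omega> - walk \<delta> \<xi> \<alpha> \<beta> (\<gamma> i) \<omega>\<bar>)"
    then interpret bounded_walk M G \<xi> \<delta> n \<alpha> \<beta> K by simp
    have "expectation (\<lambda>\<omega>. \<bar>X n \<omega>\<bar>) \<le> (\<epsilon> + 2 * T * q \<rho>) * exp (2 * C * T)"
      unfolding q_def z_def by (rule X_estimate[OF Y assms(1) *(1) \<rho>(1) *(2-)])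
    then show "integrable M (X n) \<and> expectation (\<lambda>\<omega>. \<bar>X n \<omega>\<bar>) \<le> tol"
      using X_integrable[of n] \<rho>(2) by simp
  qed
qed

subsection \<open>Convergence in probability of Riemann sums\<close>

lemma countable_dense_subset:
  fixes S :: "real set"
  obtains D where "countable D" "D \<subseteq> S" "S \<subseteq> closure D"
  using separable[of S] by blast

text \<open>Each cell contributes at most \<eta> times its length, since the mesh is below d; the
  induction adds one cell at a time.\<close>

lemma riemann_sum_error:
  fixes c :: "real \<Rightarrow> real"
  assumes cont: "continuous_on {u..t} c" and "u \<le> t" and k: "k > 0" and "(t - u) / real k < d"
    and mod: "\<And>r s. r \<in> {u..t} \<Longrightarrow> s \<in> {u..t} \<Longrightarrow> \<bar>r - s\<bar> < d \<Longrightarrow> \<bar>c r - c s\<bar> \<le> \<eta>"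
  shows "\<bar>(\<Sum>i<k. c (u + (t - u) * real i / real k) * ((t - u) / real k)) - integral {u..t} c\<bar> \<le> \<eta> * (t - u)"
proof -
  define h where "h = (t - u) / real k"
  have h: "h \<ge> 0" using assms by (simp add: h_def)
  have hk: "h * real k = t - u" using k by (simp add: h_def)
  have pt: "u + h * real i \<in> {u..t}" if "i \<le> k" for i
  proof -
    have "h * real i \<le> h * real k" using that h by (intro mult_left_mono) auto
    then show ?thesis using h hk by simp
  qed
  have int: "c integrable_on {r..s}" if "u \<le> r" "s \<le> t" for r s
    using that by (intro integrable_continuous_interval continuous_on_subset[OF cont]) auto
  have "\<bar>(\<Sum>i<j. c (u + h * real i) * h) - integral {u..u + h * real j} c\<bar> \<le> \<eta> * (h * real j)" if "j \<le> k" for j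
    using that
  proof (induction j)
    case (Suc j)
    define p where "p = u + h * real j"
    have p: "p \<in> {u..t}" "p + h \<in> {u..t}"
      using pt[of j] pt[of "Suc j"] Suc.prems by (auto simp: p_def algebra_simps)
    have "integral {u..p + h} c = integral {u..p} c + integral {p..p + h} c"
      using Henstock_Kurzweil_Integration.integral_combine[of u p "p + h" c] p h int[of u "p + h"] by simp
    moreover have "\<bar>c p * h - integral {p..p + h} c\<bar> \<le> \<eta> * h"
    proof -
      have "norm (integral {p..p + h} (\<lambda>s. c s - c p)) \<le> \<eta> * (p + h - p)"
      proof (rule integral_bound)
        show "continuous_on {p..p + h} (\<lambda>s. c s - c p)"
          using p by (intro continuous_intros continuous_on_subset[OF cont]) auto
        show "norm (c s - c p) \<le> \<eta>" if "s \<in> {p..p + h}" for s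
          using that p assms(4) mod[of s p] by (auto simp: h_def)
      qed (use h in auto)
      moreover have "integral {p..p + h} (\<lambda>s. c s - c p) = integral {p..p + h} c - c p * h"
        using Henstock_Kurzweil_Integration.integral_diff[OF int[of p "p + h"] integrable_const_ivl[of "c p"]] p h
        by (simp add: mult.commute)
      ultimately show ?thesis by (simp add: abs_minus_commute)
    qed
    ultimately show ?case
      using Suc by (simp add: p_def algebra_simps)
  qed simp
  from this[of k] show ?thesis
    unfolding hk by (simp add: h_def mult.commute)
qed

section \<open>Statements valid outside events of small probability\<close>

context prob_space
begin

text \<open>Only the exceptional set has to be measurable. The property itself may not be: it
  typically speaks of all times of an interval at once.\<close>

definition holds_except :: "real \<Rightarrow> ('a \<Rightarrow> bool) \<Rightarrow> bool" where
  "holds_except \<epsilon> P \<longleftrightarrow> (\<exists>B\<in>events. prob B < \<epsilon> \<and> (\<forall>\<omega>\<in>space M - B. P \<omega>))"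

lemma holds_exceptI_AE:
  assumes B: "B \<in> events" "prob B < \<epsilon>" and Q: "AE \<omega> in M. Q \<omega>"
    and P: "\<And>\<omega>. Q \<omega> \<Longrightarrow> \<omega> \<in> space M \<Longrightarrow> \<omega> \<notin> B \<Longrightarrow> P \<omega>"
  shows "holds_except \<epsilon> P"
proof -
  from Q obtain N where N: "{\<omega>\<in>space M. \<not> Q \<omega>} \<subseteq> N" "emeasure M N = 0" "N \<in> sets M" by (rule AE_E)
  have "prob (N \<union> B) < \<epsilon>" using measure_Un_le[of N M B] B N by (simp add: measure_def)
  moreover have "\<forall>\<omega>\<in>space M - (N \<union> B). P \<omega>" using N P by auto
  ultimately show ?thesis unfolding holds_except_def using N B by blast
qed

lemma holds_exceptI: "B \<in> events \<Longrightarrow> prob B < \<epsilon> \<Longrightarrow> (\<And>\<omega>. \<omega> \<in> space M \<Longrightarrow> \<omega> \<notin> B \<Longrightarrow> P \<omega>) \<Longrightarrow> holds_except \<epsilon> P"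
  by (auto simp: holds_except_def)

lemma holds_except_AE:
  assumes "holds_except \<epsilon> P" "AE \<omega> in M. Q \<omega>" "\<And>\<omega>. \<omega> \<in> space M \<Longrightarrow> P \<omega> \<Longrightarrow> Q \<omega> \<Longrightarrow> P' \<omega>"
  shows "holds_except \<epsilon> P'"
proof -
  from assms(1) obtain B where "B \<in> events" "prob B < \<epsilon>" "\<forall>\<omega>\<in>space M - B. P \<omega>" by (auto simp: holds_except_def)
  then show ?thesis using assms(3) by (intro holds_exceptI_AE[OF _ _ assms(2)]) auto
qed

lemma holds_except_mono:
  assumes "holds_except \<epsilon> P" "\<epsilon> \<le> \<epsilon>'" "\<And>\<omega>. \<omega> \<in> space M \<Longrightarrow> P \<omega> \<Longrightarrow> P' \<omega>"
  shows "holds_except \<epsilon>' P'"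
proof -
  from assms(1) obtain B where "B \<in> events" "prob B < \<epsilon>" "\<forall>\<omega>\<in>space M - B. P \<omega>" by (auto simp: holds_except_def)
  then show ?thesis using assms(2,3) by (intro holds_exceptI[of B]) auto
qed

lemma holds_except_conj:
  assumes "holds_except \<epsilon> P" "holds_except \<epsilon>' Q"
  shows "holds_except (\<epsilon> + \<epsilon>') (\<lambda>\<omega>. P \<omega> \<and> Q \<omega>)"
proof -
  from assms obtain B B' where B: "B \<in> events" "prob B < \<epsilon>" "\<forall>\<omega>\<in>space M - B. P \<omega>"
      "B' \<in> events" "prob B' < \<epsilon>'" "\<forall>\<omega>\<in>space M - B'. Q \<omega>" by (auto simp: holds_except_def)
  have "prob (B \<union> B') < \<epsilon> + \<epsilon>'" using measure_Un_le[of B M B'] B by linarith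
  then show ?thesis using B by (intro holds_exceptI[of "B \<union> B'"]) auto
qed

text \<open>The extra share \<epsilon> pays for the strict bound on the exceptional probability,
  which fails at 0 when \<open>I\<close> is empty.\<close>

lemma holds_except_ball:
  assumes "finite I" "\<And>i. i \<in> I \<Longrightarrow> holds_except \<epsilon> (P i)" "\<epsilon> > 0"
  shows "holds_except (real (card I + 1) * \<epsilon>) (\<lambda>\<omega>. \<forall>i\<in>I. P i \<omega>)"
  using assms(1,2)
proof (induction I rule: finite_induct)
  case empty
  then show ?case using assms(3) by (intro holds_exceptI[of "{}"]) auto
next
  case (insert i I)
  then have "holds_except (\<epsilon> + real (card I + 1) * \<epsilon>) (\<lambda>\<omega>. P i \<omega> \<and> (\<forall>i\<in>I. P i \<omega>))"
    by (intro holds_except_conj) auto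
  then show ?case using insert by (simp add: algebra_simps)
qed

text \<open>On a countable dense set \<open>D\<close> of times, the event that some pair closer than
  1 / (k + 1) has values more than \<eta> apart is measurable. These events decrease with k, and a
  path lying in all of them is not uniformly continuous. So their intersection is null, and
  continuity from above yields a d that does not depend on the path.\<close>

lemma path_modulus:
  fixes Z :: "real \<Rightarrow> 'a \<Rightarrow> real"
  assumes meas: "\<And>t. t \<in> S \<Longrightarrow> Z t \<in> borel_measurable M"
    and cont: "AE \<omega> in M. continuous_on S (\<lambda>t. Z t \<omega>)" and S: "compact S" and "\<eta> > 0" "\<epsilon> > 0"
  shows "\<exists>d>0. holds_except \<epsilon> (\<lambda>\<omega>. \<forall>s\<in>S. \<forall>t\<in>S. \<bar>s - t\<bar> < d \<longrightarrow> \<bar>Z s \<omega> - Z t \<omega>\<bar> \<le> \<eta>)"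
proof -
  obtain D where D: "countable D" "D \<subseteq> S" "S \<subseteq> closure D" by (rule countable_dense_subset)
  from cont obtain N where N: "{\<omega>\<in>space M. \<not> continuous_on S (\<lambda>t. Z t \<omega>)} \<subseteq> N" "emeasure M N = 0" "N \<in> sets M"
    by (rule AE_E)
  define P where "P = (\<lambda>k. {p \<in> D \<times> D. \<bar>fst p - snd p\<bar> < 1 / real (Suc k)})"
  define B where "B = (\<lambda>k. \<Union>p\<in>P k. {\<omega>\<in>space M. \<bar>Z (fst p) \<omega> - Z (snd p) \<omega>\<bar> > \<eta>})"
  have B: "B k \<in> events" for k
    unfolding B_def
  proof (rule sets.countable_UN'')
    show "countable (P k)" unfolding P_def using D(1) by (intro countable_Collect countable_SIGMA)
    show "{\<omega>\<in>space M. \<bar>Z (fst p) \<omega> - Z (snd p) \<omega>\<bar> > \<eta>} \<in> events" if "p \<in> P k" for p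
    proof -
      have [measurable]: "Z (fst p) \<in> borel_measurable M" "Z (snd p) \<in> borel_measurable M"
        using that D(2) meas by (auto simp: P_def)
      show ?thesis by measurable
    qed
  qed
  have "decseq B"
  proof (intro decseq_SucI)
    fix k
    have "1 / real (Suc (Suc k)) \<le> 1 / real (Suc k)" by (simp add: field_simps)
    then have "P (Suc k) \<subseteq> P k" by (auto simp: P_def)
    then show "B (Suc k) \<subseteq> B k" by (auto simp: B_def)
  qed
  then have "(\<lambda>k. prob (B k)) \<longlonglongrightarrow> prob (\<Inter>k. B k)"
    using B by (intro finite_Lim_measure_decseq) auto
  moreover have "(\<Inter>k. B k) \<subseteq> N"
  proof
    fix \<omega> assume \<omega>: "\<omega> \<in> (\<Inter>k. B k)"
    show "\<omega> \<in> N"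
    proof (rule ccontr)
      assume "\<omega> \<notin> N"
      moreover have "\<omega> \<in> space M" using \<omega> by (auto simp: B_def)
      ultimately have "continuous_on S (\<lambda>t. Z t \<omega>)" using N(1) by auto
      then have "uniformly_continuous_on S (\<lambda>t. Z t \<omega>)"
        using S by (intro compact_uniformly_continuous) auto
      then obtain d where d: "d > 0" "\<And>s t. s \<in> S \<Longrightarrow> t \<in> S \<Longrightarrow> dist s t < d \<Longrightarrow> dist (Z s \<omega>) (Z t \<omega>) < \<eta>"
        using \<open>\<eta> > 0\<close> unfolding uniformly_continuous_on_def by metis
      obtain k where k: "1 / real (Suc k) < d"
        using nat_approx_posE[OF d(1)] by blast
      have "\<omega> \<in> B k" using \<omega> by auto
      then obtain p where "p \<in> P k" "\<bar>Z (fst p) \<omega> - Z (snd p) \<omega>\<bar> > \<eta>" by (auto simp: B_def)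
      then show False using d(2)[of "fst p" "snd p"] k D(2) by (force simp: P_def dist_real_def)
    qed
  qed
  then have "prob (\<Inter>k. B k) = 0"
    using N(2,3) by (metis measure_def emeasure_eq_0 enn2real_0)
  ultimately have "(\<lambda>k. prob (B k)) \<longlonglongrightarrow> 0" by simp
  then have "\<forall>\<^sub>F k in sequentially. prob (B k) < \<epsilon>"
    using \<open>\<epsilon> > 0\<close> by (rule order_tendstoD(2))
  then obtain k where k: "prob (B k) < \<epsilon>" by (auto simp: eventually_sequentially)
  show ?thesis
  proof (intro exI[of _ "1 / real (Suc k)"] conjI)
    show "holds_except \<epsilon> (\<lambda>\<omega>. \<forall>s\<in>S. \<forall>t\<in>S. \<bar>s - t\<bar> < 1 / real (Suc k) \<longrightarrow> \<bar>Z s \<omega> - Z t \<omega>\<bar> \<le> \<eta>)"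
    proof (rule holds_exceptI_AE[OF B k cont], intro ballI impI)
      fix \<omega> s t assume cont: "continuous_on S (\<lambda>t. Z t \<omega>)" and \<omega>: "\<omega> \<in> space M" "\<omega> \<notin> B k"
        and st: "s \<in> S" "t \<in> S" "\<bar>s - t\<bar> < 1 / real (Suc k)"
    obtain s' where s': "\<And>n. s' n \<in> D" "s' \<longlonglongrightarrow> s" using subsetD[OF D(3) st(1)] unfolding closure_sequential by blast
    obtain t' where t': "\<And>n. t' n \<in> D" "t' \<longlonglongrightarrow> t" using subsetD[OF D(3) st(2)] unfolding closure_sequential by blast
    have "(\<lambda>n. Z (s' n) \<omega>) \<longlonglongrightarrow> Z s \<omega>"
      using s' D(2) st by (intro continuous_on_tendsto_compose[OF cont]) (auto intro!: always_eventually)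
    moreover have "(\<lambda>n. Z (t' n) \<omega>) \<longlonglongrightarrow> Z t \<omega>"
      using t' D(2) st by (intro continuous_on_tendsto_compose[OF cont]) (auto intro!: always_eventually)
    ultimately have "(\<lambda>n. \<bar>Z (s' n) \<omega> - Z (t' n) \<omega>\<bar>) \<longlonglongrightarrow> \<bar>Z s \<omega> - Z t \<omega>\<bar>"
      by (intro tendsto_intros)
    \<comment> \<open>The distance condition is strict, hence open: approximating times from
      \<open>D\<close> eventually satisfy it too. The bound by \<eta> is not strict and passes to
      the limit.\<close>
    moreover have "\<forall>\<^sub>F n in sequentially. \<bar>Z (s' n) \<omega> - Z (t' n) \<omega>\<bar> \<le> \<eta>"
    proof -
      have "(\<lambda>n. \<bar>s' n - t' n\<bar>) \<longlonglongrightarrow> \<bar>s - t\<bar>" using s' t' by (intro tendsto_intros)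
      from order_tendstoD(2)[OF this st(3)] show ?thesis
      proof eventually_elim
        case (elim n)
        then have "(s' n, t' n) \<in> P k" using s' t' by (auto simp: P_def)
        then show ?case using \<omega> by (fastforce simp: B_def)
      qed
    qed
    ultimately show "\<bar>Z s \<omega> - Z t \<omega>\<bar> \<le> \<eta>"
      by (intro tendsto_upperbound) auto
    qed
  qed simp
qed

text \<open>Convergence to 0 in probability. In terms of \<open>holds_except\<close> it is stable
  under sums and under almost everywhere domination without any measurability of the
  sequence.\<close>

definition vanishes_in_prob :: "(nat \<Rightarrow> 'a \<Rightarrow> real) \<Rightarrow> bool" where
  "vanishes_in_prob Y \<longleftrightarrow> (\<forall>\<epsilon>>0. \<forall>\<eta>>0. \<forall>\<^sub>F k in sequentially. holds_except \<epsilon> (\<lambda>\<omega>. \<bar>Y k \<omega>\<bar> \<le> \<eta>))"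

lemma vanishes_in_probD:
  "vanishes_in_prob Y \<Longrightarrow> \<epsilon> > 0 \<Longrightarrow> \<eta> > 0 \<Longrightarrow> \<forall>\<^sub>F k in sequentially. holds_except \<epsilon> (\<lambda>\<omega>. \<bar>Y k \<omega>\<bar> \<le> \<eta>)"
  by (simp add: vanishes_in_prob_def)

lemma vanishes_in_prob_add:
  assumes "vanishes_in_prob Y" "vanishes_in_prob Z"
  shows "vanishes_in_prob (\<lambda>k \<omega>. Y k \<omega> + Z k \<omega>)"
  unfolding vanishes_in_prob_def
proof (intro allI impI)
  fix \<epsilon> \<eta> :: real assume "\<epsilon> > 0" "\<eta> > 0"
  then have *: "\<epsilon> / 2 > 0" "\<eta> / 2 > 0" by auto
  from vanishes_in_probD[OF assms(1) *] vanishes_in_probD[OF assms(2) *]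
  show "\<forall>\<^sub>F k in sequentially. holds_except \<epsilon> (\<lambda>\<omega>. \<bar>Y k \<omega> + Z k \<omega>\<bar> \<le> \<eta>)"
  proof eventually_elim
    case (elim k)
    from holds_except_conj[OF this] show ?case by (rule holds_except_mono) auto
  qed
qed

text \<open>Mostly a means of rewriting: it transfers the limit between expressions that agree
  almost everywhere for large k, so that degenerate grids with zero subdivisions can be
  ignored.\<close>

lemma vanishes_in_prob_AE_bound:
  assumes "vanishes_in_prob Y" and "\<forall>\<^sub>F k in sequentially. AE \<omega> in M. \<bar>Z k \<omega>\<bar> \<le> \<bar>Y k \<omega>\<bar>"
  shows "vanishes_in_prob Z"
  unfolding vanishes_in_prob_def
proof (intro allI impI)
  fix \<epsilon> \<eta> :: real assume "\<epsilon> > 0" "\<eta> > 0"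
  from vanishes_in_probD[OF assms(1) this] assms(2)
  show "\<forall>\<^sub>F k in sequentially. holds_except \<epsilon> (\<lambda>\<omega>. \<bar>Z k \<omega>\<bar> \<le> \<eta>)"
  proof eventually_elim
    case (elim k)
    from holds_except_AE[OF this] show ?case by auto
  qed
qed

lemma vanishes_in_prob_diff:
  assumes "vanishes_in_prob Y" "vanishes_in_prob Z"
  shows "vanishes_in_prob (\<lambda>k \<omega>. Y k \<omega> - Z k \<omega>)"
proof -
  have "vanishes_in_prob (\<lambda>k \<omega>. - Z k \<omega>)"
    by (rule vanishes_in_prob_AE_bound[OF assms(2)]) simp
  from vanishes_in_prob_add[OF assms(1) this] show ?thesis by simp
qed

lemma vanishes_in_prob_subseq:
  assumes "vanishes_in_prob Y" "c > 0"
  shows "vanishes_in_prob (\<lambda>k. Y (c * k))"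
proof -
  have "strict_mono (\<lambda>k. c * k)" using assms(2) by (auto simp: strict_mono_def)
  then have "filterlim (\<lambda>k. c * k) sequentially sequentially" by (rule filterlim_subseq)
  from eventually_compose_filterlim[OF vanishes_in_probD[OF assms(1)] this]
  show ?thesis by (simp add: vanishes_in_prob_def)
qed

lemma ito_sum_vanishes:
  assumes I: "is_ito_integral M W H u t I" and "u \<le> t"
    and [measurable]: "\<And>s. s \<in> {u..t} \<Longrightarrow> H s \<in> borel_measurable M" "\<And>s. s \<in> {u..t} \<Longrightarrow> W s \<in> borel_measurable M"
  shows "vanishes_in_prob (\<lambda>k \<omega>. ito_sum W H u t k \<omega> - I \<omega>)"
  unfolding vanishes_in_prob_def
proof (intro allI impI)
  fix \<epsilon> \<eta> :: real assume "\<epsilon> > 0" "\<eta> > 0"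
  have [measurable]: "I \<in> borel_measurable M" using I by (simp add: is_ito_integral_def)
  have "(\<lambda>k. prob {\<omega>\<in>space M. \<bar>ito_sum W H u t k \<omega> - I \<omega>\<bar> > \<eta>}) \<longlonglongrightarrow> 0"
    using I \<open>\<eta> > 0\<close> by (simp add: is_ito_integral_def)
  from order_tendstoD(2)[OF this \<open>\<epsilon> > 0\<close>]
  show "\<forall>\<^sub>F k in sequentially. holds_except \<epsilon> (\<lambda>\<omega>. \<bar>ito_sum W H u t k \<omega> - I \<omega>\<bar> \<le> \<eta>)"
  proof eventually_elim
    case (elim k)
    \<comment> \<open>All evaluation points stay in the interval; for k = 0 division by zero gives
      0, so the point is u.\<close>
    have pt: "u + (t - u) * real i / real k \<in> {u..t}" if "i \<le> k" for i
    proof -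
      have "real i / real k \<le> 1" using that by (cases "k = 0") auto
      then have "(t - u) * (real i / real k) \<le> (t - u) * 1" using assms(2) by (intro mult_left_mono) auto
      then show ?thesis using assms(2) by simp
    qed
    have "ito_sum W H u t k \<in> borel_measurable M"
      unfolding ito_sum_def[abs_def] using pt
      by (intro borel_measurable_sum borel_measurable_times borel_measurable_diff assms(3,4))
        (metis Suc_leI lessThan_iff less_imp_le)+
    then have "{\<omega>\<in>space M. \<bar>ito_sum W H u t k \<omega> - I \<omega>\<bar> > \<eta>} \<in> events" by measurable
    then show ?case
      using elim by (rule holds_exceptI) auto
  qed
qed

lemma riemann_sum_vanishes:
  fixes c :: "real \<Rightarrow> 'a \<Rightarrow> real"
  assumes "u \<le> t" and meas: "\<And>s. s \<in> {u..t} \<Longrightarrow> c s \<in> borel_measurable M"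
    and cont: "AE \<omega> in M. continuous_on {u..t} (\<lambda>s. c s \<omega>)"
  shows "vanishes_in_prob (\<lambda>k \<omega>. (\<Sum>i<k. c (u + (t - u) * real i / real k) \<omega> * ((t - u) / real k))
           - integral {u..t} (\<lambda>s. c s \<omega>))"
  unfolding vanishes_in_prob_def
proof (intro allI impI)
  fix \<epsilon> \<eta> :: real assume "\<epsilon> > 0" "\<eta> > 0"
  \<comment> \<open>The summand 1 keeps the denominator positive when u = t.\<close>
  have "\<eta> / (t - u + 1) > 0" using \<open>\<eta> > 0\<close> assms(1) by simp
  from path_modulus[OF meas cont compact_Icc this \<open>\<epsilon> > 0\<close>] obtain d where d: "d > 0"
    "holds_except \<epsilon> (\<lambda>\<omega>. \<forall>r\<in>{u..t}. \<forall>s\<in>{u..t}. \<bar>r - s\<bar> < d \<longrightarrow> \<bar>c r \<omega> - c s \<omega>\<bar> \<le> \<eta> / (t - u + 1))"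
    by blast
  have "(\<lambda>k. (t - u) / real k) \<longlonglongrightarrow> 0" by (rule lim_const_over_n)
  from order_tendstoD(2)[OF this d(1)] eventually_gt_at_top[of 0]
  show "\<forall>\<^sub>F k in sequentially. holds_except \<epsilon> (\<lambda>\<omega>.
      \<bar>(\<Sum>i<k. c (u + (t - u) * real i / real k) \<omega> * ((t - u) / real k)) - integral {u..t} (\<lambda>s. c s \<omega>)\<bar> \<le> \<eta>)"
  proof eventually_elim
    case (elim k)
    show ?case
    proof (rule holds_except_AE[OF d(2) cont])
      fix \<omega> assume "\<forall>r\<in>{u..t}. \<forall>s\<in>{u..t}. \<bar>r - s\<bar> < d \<longrightarrow> \<bar>c r \<omega> - c s \<omega>\<bar> \<le> \<eta> / (t - u + 1)"
        and "continuous_on {u..t} (\<lambda>s. c s \<omega>)"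
      then have "\<bar>(\<Sum>i<k. c (u + (t - u) * real i / real k) \<omega> * ((t - u) / real k)) - integral {u..t} (\<lambda>s. c s \<omega>)\<bar>
          \<le> \<eta> / (t - u + 1) * (t - u)"
        using elim assms(1) by (intro riemann_sum_error[where d = d]) auto
      also have "\<dots> \<le> \<eta>" using assms(1) \<open>\<eta> > 0\<close> by (simp add: field_simps)
      finally show "\<bar>(\<Sum>i<k. c (u + (t - u) * real i / real k) \<omega> * ((t - u) / real k)) - integral {u..t} (\<lambda>s. c s \<omega>)\<bar> \<le> \<eta>" .
    qed
  qed
qed

end

subsection \<open>Consequences of Assumption A\<close>

definition grid :: "real \<Rightarrow> nat \<Rightarrow> nat \<Rightarrow> real" where
  "grid T n i = real i * (T / real n)"

lemma grid_mult: "c > 0 \<Longrightarrow> grid T (n * c) (i * c) = grid T n i"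
  by (simp add: grid_def)

lemma grid_mono: "T \<ge> 0 \<Longrightarrow> i \<le> j \<Longrightarrow> grid T n i \<le> grid T n j"
  by (auto simp: grid_def intro!: divide_right_mono mult_right_mono)

lemma grid_bounds: "T \<ge> 0 \<Longrightarrow> i \<le> n \<Longrightarrow> grid T n i \<in> {0..T}"
  by (cases "n = 0") (auto simp: grid_def field_simps intro!: mult_left_mono)

text \<open>The square root is part of the bound so that \<open>g\<close> fits; \<open>f\<close>
  fits by weakening its own. Continuity of the coefficients is what the limits of the sums require:
  measurable integrands at each time and, for the drift, continuous paths.\<close>

lemma locally_bounded_increments_continuous:
  fixes h :: "real \<Rightarrow> real \<Rightarrow> real \<Rightarrow> real \<Rightarrow> real"
  assumes "\<And>R. R > 0 \<Longrightarrow> \<exists>C. \<forall>s1\<in>S. \<forall>s2\<in>S. \<forall>r1\<in>S. \<forall>r2\<in>S. \<forall>x1 x2 y1 y2.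
        max (max \<bar>x1\<bar> \<bar>x2\<bar>) (max \<bar>y1\<bar> \<bar>y2\<bar>) \<le> R \<longrightarrow>
        \<bar>h s1 r1 x1 y1 - h s2 r2 x2 y2\<bar> \<le> C * (\<bar>s1 - s2\<bar> + \<bar>r1 - r2\<bar> + \<bar>x1 - x2\<bar> + \<bar>y1 - y2\<bar> + sqrt \<bar>x1 - x2\<bar>)"
  shows "continuous_on (S \<times> S \<times> UNIV \<times> UNIV) (\<lambda>(s, r, x, y). h s r x y)"
  unfolding continuous_on_def
proof (safe)
  fix s0 r0 x0 y0 :: real assume sr: "s0 \<in> S" "r0 \<in> S"
  let ?p = "(s0, r0, x0, y0)" and ?D = "S \<times> S \<times> (UNIV :: real set) \<times> (UNIV :: real set)"
  \<comment> \<open>Points within distance 1 of the base point keep both state variables within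
    \<open>R\<close>, so one constant serves in a whole neighbourhood.\<close>
  define R where "R = \<bar>x0\<bar> + \<bar>y0\<bar> + 1"
  have "R > 0" by (simp add: R_def)
  from assms[OF this] obtain C where C: "\<forall>s1\<in>S. \<forall>s2\<in>S. \<forall>r1\<in>S. \<forall>r2\<in>S. \<forall>x1 x2 y1 y2.
        max (max \<bar>x1\<bar> \<bar>x2\<bar>) (max \<bar>y1\<bar> \<bar>y2\<bar>) \<le> R \<longrightarrow>
        \<bar>h s1 r1 x1 y1 - h s2 r2 x2 y2\<bar> \<le> C * (\<bar>s1 - s2\<bar> + \<bar>r1 - r2\<bar> + \<bar>x1 - x2\<bar> + \<bar>y1 - y2\<bar> + sqrt \<bar>x1 - x2\<bar>)"
    by (elim exE)
  define P where "P = (\<lambda>(s, r, x, y). C * (\<bar>s - s0\<bar> + \<bar>r - r0\<bar> + \<bar>x - x0\<bar> + \<bar>y - y0\<bar> + sqrt \<bar>x - x0\<bar>))"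
  have "((\<lambda>p. (case p of (s, r, x, y) \<Rightarrow> h s r x y) - h s0 r0 x0 y0) \<longlongrightarrow> 0) (at ?p within ?D)"
  proof (rule Lim_null_comparison)
    have "\<forall>\<^sub>F p in at ?p within ?D. p \<in> ?D \<and> dist p ?p < 1"
      unfolding eventually_at by (intro exI[of _ 1]) auto
    then show "\<forall>\<^sub>F p in at ?p within ?D. norm ((case p of (s, r, x, y) \<Rightarrow> h s r x y) - h s0 r0 x0 y0) \<le> P p"
    proof eventually_elim
      case (elim p)
      obtain s r x y where p: "p = (s, r, x, y)" by (cases p) auto
      have "dist (r, x, y) (r0, x0, y0) < 1" using elim dist_snd_le[of p ?p] by (simp add: p)
      then have "dist (x, y) (x0, y0) < 1" using dist_snd_le[of "(r, x, y)" "(r0, x0, y0)"] by simp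
      then have "\<bar>x - x0\<bar> < 1" "\<bar>y - y0\<bar> < 1"
        using dist_fst_le[of "(x, y)" "(x0, y0)"] dist_snd_le[of "(x, y)" "(x0, y0)"] by (auto simp: dist_real_def)
      then have "max (max \<bar>x\<bar> \<bar>x0\<bar>) (max \<bar>y\<bar> \<bar>y0\<bar>) \<le> R" by (auto simp: R_def)
      then show ?case using C[rule_format, of s s0 r r0 x x0 y y0] elim sr by (simp add: p P_def)
    qed
    have "continuous_on UNIV P" unfolding P_def case_prod_beta by (intro continuous_intros)
    then have "(P \<longlongrightarrow> P ?p) (at ?p within ?D)"
      by (metis continuous_on_def tendsto_within_subset subset_UNIV UNIV_I)
    then show "(P \<longlongrightarrow> 0) (at ?p within ?D)" by (simp add: P_def)
  qed
  then show "((\<lambda>(s, r, x, y). h s r x y) \<longlongrightarrow> h s0 r0 x0 y0) (at ?p within ?D)"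
    by (rule LIM_zero_iff[THEN iffD1])
qed

lemma assumption_A_bound:
  assumes "assumption_A T a b f g" "R > 0"
  obtains C where "C \<ge> 0"
    "\<And>s1 s2 r1 r2 x1 x2 y1 y2. s1 \<in> {0..T} \<Longrightarrow> s2 \<in> {0..T} \<Longrightarrow> r1 \<in> {0..T} \<Longrightarrow> r2 \<in> {0..T} \<Longrightarrow>
      \<bar>x1\<bar> \<le> R \<Longrightarrow> \<bar>x2\<bar> \<le> R \<Longrightarrow> \<bar>y1\<bar> \<le> R \<Longrightarrow> \<bar>y2\<bar> \<le> R \<Longrightarrow>
      \<bar>f s1 r1 x1 y1 - f s2 r2 x2 y2\<bar> \<le> C * (\<bar>s1 - s2\<bar> + \<bar>r1 - r2\<bar> + \<bar>x1 - x2\<bar> + \<bar>y1 - y2\<bar>) \<and>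
      \<bar>g s1 r1 x1 y1 - g s2 r2 x2 y2\<bar> \<le> C * (\<bar>s1 - s2\<bar> + \<bar>r1 - r2\<bar> + \<bar>x1 - x2\<bar> + \<bar>y1 - y2\<bar> + sqrt \<bar>x1 - x2\<bar>)"
proof -
  from assms obtain C where C: "\<forall>s1\<in>{0..T}. \<forall>s2\<in>{0..T}. \<forall>r1\<in>{0..T}. \<forall>r2\<in>{0..T}. \<forall>x1 x2 y1 y2.
        max (max \<bar>x1\<bar> \<bar>x2\<bar>) (max \<bar>y1\<bar> \<bar>y2\<bar>) \<le> R \<longrightarrow>
        \<bar>f s1 r1 x1 y1 - f s2 r2 x2 y2\<bar> \<le> C * (\<bar>s1 - s2\<bar> + \<bar>r1 - r2\<bar> + \<bar>x1 - x2\<bar> + \<bar>y1 - y2\<bar>) \<and>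
        \<bar>g s1 r1 x1 y1 - g s2 r2 x2 y2\<bar> \<le> C * (\<bar>s1 - s2\<bar> + \<bar>r1 - r2\<bar> + \<bar>x1 - x2\<bar> + \<bar>y1 - y2\<bar> + sqrt \<bar>x1 - x2\<bar>)"
    unfolding assumption_A_def by blast
  \<comment> \<open>Assumption A leaves the sign of its constant open. Passing to \<bar>C\<bar> is
    sound because the bracket is nonnegative, and it allows multiplying inequalities by the constant
    later.\<close>
  have mono: "u \<le> C * v \<Longrightarrow> v \<ge> 0 \<Longrightarrow> u \<le> \<bar>C\<bar> * v" for u v
    by (meson abs_ge_self mult_right_mono order.trans)
  show thesis
  proof (rule that[of "\<bar>C\<bar>"])
    fix s1 s2 r1 r2 x1 x2 y1 y2
    assume *: "s1 \<in> {0..T}" "s2 \<in> {0..T}" "r1 \<in> {0..T}" "r2 \<in> {0..T}" "\<bar>x1\<bar> \<le> R" "\<bar>x2\<bar> \<le> R" "\<bar>y1\<bar> \<le> R" "\<bar>y2\<bar> \<le> R"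
    then have "max (max \<bar>x1\<bar> \<bar>x2\<bar>) (max \<bar>y1\<bar> \<bar>y2\<bar>) \<le> R" by simp
    then have "\<bar>f s1 r1 x1 y1 - f s2 r2 x2 y2\<bar> \<le> C * (\<bar>s1 - s2\<bar> + \<bar>r1 - r2\<bar> + \<bar>x1 - x2\<bar> + \<bar>y1 - y2\<bar>)"
      "\<bar>g s1 r1 x1 y1 - g s2 r2 x2 y2\<bar> \<le> C * (\<bar>s1 - s2\<bar> + \<bar>r1 - r2\<bar> + \<bar>x1 - x2\<bar> + \<bar>y1 - y2\<bar> + sqrt \<bar>x1 - x2\<bar>)"
      using C * by blast+
    then show "\<bar>f s1 r1 x1 y1 - f s2 r2 x2 y2\<bar> \<le> \<bar>C\<bar> * (\<bar>s1 - s2\<bar> + \<bar>r1 - r2\<bar> + \<bar>x1 - x2\<bar> + \<bar>y1 - y2\<bar>) \<and>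
      \<bar>g s1 r1 x1 y1 - g s2 r2 x2 y2\<bar> \<le> \<bar>C\<bar> * (\<bar>s1 - s2\<bar> + \<bar>r1 - r2\<bar> + \<bar>x1 - x2\<bar> + \<bar>y1 - y2\<bar> + sqrt \<bar>x1 - x2\<bar>)"
      by (intro conjI mono) auto
  qed simp
qed

lemma assumption_A_continuous:
  assumes A: "assumption_A T a b f g"
  shows "continuous_on ({0..T} \<times> {0..T} \<times> UNIV \<times> UNIV) (\<lambda>(s, r, x, y). f s r x y)"
    and "continuous_on ({0..T} \<times> {0..T} \<times> UNIV \<times> UNIV) (\<lambda>(s, r, x, y). g s r x y)"
proof -
  have "\<exists>C. \<forall>s1\<in>{0..T}. \<forall>s2\<in>{0..T}. \<forall>r1\<in>{0..T}. \<forall>r2\<in>{0..T}. \<forall>x1 x2 y1 y2.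
        max (max \<bar>x1\<bar> \<bar>x2\<bar>) (max \<bar>y1\<bar> \<bar>y2\<bar>) \<le> R \<longrightarrow>
        \<bar>f s1 r1 x1 y1 - f s2 r2 x2 y2\<bar> \<le> C * (\<bar>s1 - s2\<bar> + \<bar>r1 - r2\<bar> + \<bar>x1 - x2\<bar> + \<bar>y1 - y2\<bar> + sqrt \<bar>x1 - x2\<bar>)"
    if R: "R > 0" for R
  proof -
    obtain C where C: "C \<ge> 0"
      "\<And>s1 s2 r1 r2 x1 x2 y1 y2. s1 \<in> {0..T} \<Longrightarrow> s2 \<in> {0..T} \<Longrightarrow> r1 \<in> {0..T} \<Longrightarrow> r2 \<in> {0..T} \<Longrightarrow>
      \<bar>x1\<bar> \<le> R \<Longrightarrow> \<bar>x2\<bar> \<le> R \<Longrightarrow> \<bar>y1\<bar> \<le> R \<Longrightarrow> \<bar>y2\<bar> \<le> R \<Longrightarrow>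
      \<bar>f s1 r1 x1 y1 - f s2 r2 x2 y2\<bar> \<le> C * (\<bar>s1 - s2\<bar> + \<bar>r1 - r2\<bar> + \<bar>x1 - x2\<bar> + \<bar>y1 - y2\<bar>)"
      using assumption_A_bound[OF A R] by (metis (no_types))
    show ?thesis
    proof (intro exI[of _ C] ballI allI impI)
      fix s1 s2 r1 r2 x1 x2 y1 y2 :: real
      assume *: "s1 \<in> {0..T}" "s2 \<in> {0..T}" "r1 \<in> {0..T}" "r2 \<in> {0..T}" "max (max \<bar>x1\<bar> \<bar>x2\<bar>) (max \<bar>y1\<bar> \<bar>y2\<bar>) \<le> R"
      have "\<bar>f s1 r1 x1 y1 - f s2 r2 x2 y2\<bar> \<le> C * (\<bar>s1 - s2\<bar> + \<bar>r1 - r2\<bar> + \<bar>x1 - x2\<bar> + \<bar>y1 - y2\<bar>)"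
        using C(2) * by simp
      also have "\<dots> \<le> C * (\<bar>s1 - s2\<bar> + \<bar>r1 - r2\<bar> + \<bar>x1 - x2\<bar> + \<bar>y1 - y2\<bar> + sqrt \<bar>x1 - x2\<bar>)"
        using C(1) by (intro mult_left_mono) auto
      finally show "\<bar>f s1 r1 x1 y1 - f s2 r2 x2 y2\<bar> \<le> \<dots>" .
    qed
  qed
  then show "continuous_on ({0..T} \<times> {0..T} \<times> UNIV \<times> UNIV) (\<lambda>(s, r, x, y). f s r x y)"
    by (rule locally_bounded_increments_continuous)
  show "continuous_on ({0..T} \<times> {0..T} \<times> UNIV \<times> UNIV) (\<lambda>(s, r, x, y). g s r x y)"
    using A unfolding assumption_A_def by (intro locally_bounded_increments_continuous) metis
qed

lemma continuous_coefficient_path: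
  assumes h: "continuous_on (S \<times> S \<times> UNIV \<times> UNIV) (\<lambda>(s, r, x, y). h s r x y :: real)"
    and "continuous_on I s" "continuous_on I r" "continuous_on I X" "continuous_on I Y" "s ` I \<subseteq> S" "r ` I \<subseteq> S"
  shows "continuous_on I (\<lambda>v. h (s v) (r v) (X v) (Y v))"
proof -
  have "continuous_on I (\<lambda>v. (s v, r v, X v, Y v))"
    by (intro continuous_on_Pair assms)
  from continuous_on_compose2[OF h this] assms(6,7) show ?thesis by auto
qed

lemma continuous_coefficient_measurable:
  assumes "continuous_on (S \<times> S \<times> UNIV \<times> UNIV) (\<lambda>(s, r, x, y). h s r x y :: real)" "s \<in> S" "r \<in> S"
    and "X \<in> borel_measurable N" "Y \<in> borel_measurable N"
  shows "(\<lambda>\<omega>. h s r (X \<omega> :: real) (Y \<omega> :: real)) \<in> borel_measurable N"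
proof -
  have "continuous_on UNIV (\<lambda>p. h s r (fst p) (snd p))"
    using continuous_coefficient_path[OF assms(1), of UNIV "\<lambda>_. s" "\<lambda>_. r" fst snd] assms(2,3)
      continuous_on_fst[OF continuous_on_id] continuous_on_snd[OF continuous_on_id] by auto
  from borel_measurable_continuous_Pair[OF assms(4,5) this] show ?thesis .
qed

text \<open>A subinterval of the grid with \<open>P\<close> points is cut by the grid with \<open>P * l\<close> points into equal pieces, so that
  the uniform partitions in \<^const>\<open>ito_sum\<close> are pieces of one global grid.\<close>

lemma (in prob_space) grid_sum_vanishes:
  fixes c H W :: "real \<Rightarrow> 'a \<Rightarrow> real"
  assumes P: "P > 0" and T: "T \<ge> 0"
    and I: "is_ito_integral M W H (grid T P i0) (grid T P (i0 + q)) I"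
    and meas: "\<And>s. s \<in> {grid T P i0..grid T P (i0 + q)} \<Longrightarrow> c s \<in> borel_measurable M"
      "\<And>s. s \<in> {grid T P i0..grid T P (i0 + q)} \<Longrightarrow> H s \<in> borel_measurable M"
      "\<And>s. s \<in> {grid T P i0..grid T P (i0 + q)} \<Longrightarrow> W s \<in> borel_measurable M"
    and cont: "AE \<omega> in M. continuous_on {grid T P i0..grid T P (i0 + q)} (\<lambda>s. c s \<omega>)"
    and Z: "AE \<omega> in M. Z \<omega> = integral {grid T P i0..grid T P (i0 + q)} (\<lambda>s. c s \<omega>) + I \<omega>"
  shows "vanishes_in_prob (\<lambda>l \<omega>. (\<Sum>i<q * l. c (grid T (P * l) (i0 * l + i)) \<omega> * (T / real (P * l)) +
      H (grid T (P * l) (i0 * l + i)) \<omega> * (W (grid T (P * l) (Suc (i0 * l + i))) \<omega> - W (grid T (P * l) (i0 * l + i)) \<omega>))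
      - Z \<omega>)"
proof -
  define u where "u = grid T P i0"
  define t where "t = grid T P (i0 + q)"
  have ut: "u \<le> t" unfolding u_def t_def using T by (intro grid_mono) auto
  \<comment> \<open>\<open>vanishes_in_prob_subseq\<close> asks for a positive factor. For q = 0 the
    interval is a point and all terms of the sums taken with q' = 1 vanish, so the replacement
    changes nothing.\<close>
  define q' where "q' = max q 1"
  have q': "q' > 0" by (simp add: q'_def)
  have "vanishes_in_prob (\<lambda>l \<omega>. ((\<Sum>i<q' * l. c (u + (t - u) * real i / real (q' * l)) \<omega> * ((t - u) / real (q' * l)))
           - integral {u..t} (\<lambda>s. c s \<omega>)) + (ito_sum W H u t (q' * l) \<omega> - I \<omega>))"
    using meas cont I unfolding u_def[symmetric] t_def[symmetric]
    by (intro vanishes_in_prob_add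
        vanishes_in_prob_subseq[OF riemann_sum_vanishes[of u t c] q']
        vanishes_in_prob_subseq[OF ito_sum_vanishes[of W H u t I] q']) (use ut in auto)
  then show ?thesis
  proof (rule vanishes_in_prob_AE_bound)
    show "\<forall>\<^sub>F l in sequentially. AE \<omega> in M. \<bar>(\<Sum>i<q * l. c (grid T (P * l) (i0 * l + i)) \<omega> * (T / real (P * l)) +
      H (grid T (P * l) (i0 * l + i)) \<omega> * (W (grid T (P * l) (Suc (i0 * l + i))) \<omega> - W (grid T (P * l) (i0 * l + i)) \<omega>))
      - Z \<omega>\<bar> \<le> \<bar>((\<Sum>i<q' * l. c (u + (t - u) * real i / real (q' * l)) \<omega> * ((t - u) / real (q' * l)))
           - integral {u..t} (\<lambda>s. c s \<omega>)) + (ito_sum W H u t (q' * l) \<omega> - I \<omega>)\<bar>"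
      using eventually_gt_at_top[of 0]
    proof eventually_elim
      case (elim l)
      have "(\<Sum>i<q * l. c (grid T (P * l) (i0 * l + i)) \<omega> * (T / real (P * l)) +
        H (grid T (P * l) (i0 * l + i)) \<omega> * (W (grid T (P * l) (Suc (i0 * l + i))) \<omega> - W (grid T (P * l) (i0 * l + i)) \<omega>))
        = (\<Sum>i<q' * l. c (u + (t - u) * real i / real (q' * l)) \<omega> * ((t - u) / real (q' * l))) + ito_sum W H u t (q' * l) \<omega>"
        for \<omega>
      proof (cases "q = 0")
        case True
        then have "u = t" by (simp add: u_def t_def)
        then show ?thesis using True by (simp add: ito_sum_def)
      next
        case False
        then have [simp]: "q' = q" by (simp add: q'_def)
        have tu: "t - u = real q * (T / real P)" by (simp add: t_def u_def grid_def algebra_simps)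
        have pt: "u + (t - u) * real i / real (q * l) = grid T (P * l) (i0 * l + i)" for i
          unfolding tu using False P elim by (simp add: u_def grid_def field_simps)
        have len: "(t - u) / real (q * l) = T / real (P * l)"
          unfolding tu using False P elim by (simp add: field_simps)
        show ?thesis
          unfolding ito_sum_def \<open>q' = q\<close> pt len by (simp add: sum.distrib)
      qed
      then show ?case using Z unfolding u_def[symmetric] t_def[symmetric] by (auto elim!: eventually_mono)
    qed
  qed
qed

subsection \<open>The error walk on a refined grid\<close>

lemma sum_lessThan_add:
  fixes h :: "nat \<Rightarrow> real"
  shows "(\<Sum>i<p + q. h i) = (\<Sum>i<p. h i) + (\<Sum>i<q. h (p + i))"
  by (induction q) auto

locale semi_discrete = prob_space M for M :: "'a measure" +
  fixes F :: "real \<Rightarrow> 'a measure" and T :: real and W :: "real \<Rightarrow> 'a \<Rightarrow> real"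
    and a b :: "real \<Rightarrow> real \<Rightarrow> real" and f g :: "real \<Rightarrow> real \<Rightarrow> real \<Rightarrow> real \<Rightarrow> real"
    and x0 :: "'a \<Rightarrow> real" and x :: "real \<Rightarrow> 'a \<Rightarrow> real" and y :: "nat \<Rightarrow> real \<Rightarrow> 'a \<Rightarrow> real"
  assumes T_pos: "T > 0" and filtration: "usual_filtration M F T" and wiener: "wiener_process M F T W"
    and sde: "is_sde_solution M F T W a b x0 x" and A: "assumption_A T a b f g"
    and sd: "\<And>N. N \<ge> 1 \<Longrightarrow> is_sd_solution M F T W f g x0 N (y N)"
begin

lemma F_subalgebra: "subalgebra M (F t)"
  using filtration by (auto simp: usual_filtration_def subalgebra_def)

lemma F_mono: "s \<le> t \<Longrightarrow> sets (F s) \<subseteq> sets (F t)"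
  using filtration by (auto simp: usual_filtration_def)

lemma measurable_F_mono: "s \<le> t \<Longrightarrow> X \<in> borel_measurable (F s) \<Longrightarrow> X \<in> borel_measurable (F t)"
  using F_mono F_subalgebra by (intro measurable_from_subalg[of "F t" "F s"]) (auto simp: subalgebra_def)

lemma measurable_F_M: "X \<in> borel_measurable (F t) \<Longrightarrow> X \<in> borel_measurable M"
  by (rule measurable_from_subalg[OF F_subalgebra])

lemma adapted:
  assumes "t \<in> {0..T}"
  shows "x t \<in> borel_measurable (F t)" "W t \<in> borel_measurable (F t)" "N \<ge> 1 \<Longrightarrow> y N t \<in> borel_measurable (F t)"
  using sde wiener sd assms by (auto simp: is_sde_solution_def wiener_process_def is_sd_solution_def)

lemma x_continuous: "AE \<omega> in M. continuous_on {0..T} (\<lambda>t. x t \<omega>)"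
  using sde by (simp add: is_sde_solution_def)

lemma y_continuous: "N \<ge> 1 \<Longrightarrow> AE \<omega> in M. continuous_on {0..T} (\<lambda>t. y N t \<omega>)"
  using sd by (simp add: is_sd_solution_def)

lemma f_diag: "f s s z z = a s z" and g_diag: "g s s z z = b s z"
  using A by (auto simp: assumption_A_def)

lemmas f_continuous = assumption_A_continuous(1)[OF A]
lemmas g_continuous = assumption_A_continuous(2)[OF A]

text \<open>On the grid with \<open>N * m * l\<close> points, \<open>i div (m * l) * (m * l)\<close> is the index of the last point of the
  scheme's own grid (the \<open>s\<close>-hat of the paper), and \<open>i div l * l\<close> that of the last point of the grid with \<open>N * m\<close> points.\<close>

definition err_drift :: "nat \<Rightarrow> nat \<Rightarrow> nat \<Rightarrow> nat \<Rightarrow> 'a \<Rightarrow> real" where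
  "err_drift N m l i \<omega> =
     f (grid T (N * m * l) (i div (m * l) * (m * l))) (grid T (N * m * l) i)
       (y N (grid T (N * m * l) (i div (m * l) * (m * l))) \<omega>) (y N (grid T (N * m * l) i) \<omega>)
     - a (grid T (N * m * l) i) (x (grid T (N * m * l) i) \<omega>)"

definition err_diffusion :: "nat \<Rightarrow> nat \<Rightarrow> nat \<Rightarrow> nat \<Rightarrow> 'a \<Rightarrow> real" where
  "err_diffusion N m l i \<omega> =
     g (grid T (N * m * l) (i div (m * l) * (m * l))) (grid T (N * m * l) i)
       (y N (grid T (N * m * l) (i div (m * l) * (m * l))) \<omega>) (y N (grid T (N * m * l) i) \<omega>)
     - b (grid T (N * m * l) i) (x (grid T (N * m * l) i) \<omega>)"

definition W_step :: "nat \<Rightarrow> nat \<Rightarrow> 'a \<Rightarrow> real" where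
  "W_step n i \<omega> = W (grid T n (Suc i)) \<omega> - W (grid T n i) \<omega>"

abbreviation err_walk :: "nat \<Rightarrow> nat \<Rightarrow> nat \<Rightarrow> nat \<Rightarrow> 'a \<Rightarrow> real" where
  "err_walk N m l \<equiv> walk (T / real (N * m * l)) (W_step (N * m * l)) (err_drift N m l) (err_diffusion N m l)"

lemma interval_subset: "i \<le> j \<Longrightarrow> j \<le> P \<Longrightarrow> {grid T P i..grid T P j} \<subseteq> {0..T}"
  using grid_bounds[of T i P] grid_bounds[of T j P] T_pos by auto

lemma sde_grid_vanishes:
  assumes P: "P > 0" and c: "c \<le> P"
  shows "vanishes_in_prob (\<lambda>l \<omega>. (\<Sum>i<c * l. a (grid T (P * l) i) (x (grid T (P * l) i) \<omega>) * (T / real (P * l)) +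
      b (grid T (P * l) i) (x (grid T (P * l) i) \<omega>) * W_step (P * l) i \<omega>) - (x (grid T P c) \<omega> - x0 \<omega>))"
proof -
  let ?J = "{grid T P 0..grid T P (0 + c)}"
  have J: "?J \<subseteq> {0..T}" using interval_subset[of 0 c P] c by simp
  have g0: "grid T P 0 = 0" by (simp add: grid_def)
  have "grid T P c \<in> {0..T}" using grid_bounds[of T c P] T_pos c by simp
  then obtain I where I: "is_ito_integral M W (\<lambda>s \<omega>. b s (x s \<omega>)) 0 (grid T P c) I"
      "AE \<omega> in M. x (grid T P c) \<omega> = x0 \<omega> + integral {0..grid T P c} (\<lambda>s. a s (x s \<omega>)) + I \<omega>"
    using bspec[OF conjunct2[OF conjunct2[OF sde[unfolded is_sde_solution_def]]]] by blast
  have "vanishes_in_prob (\<lambda>l \<omega>. (\<Sum>i<c * l. a (grid T (P * l) (0 * l + i)) (x (grid T (P * l) (0 * l + i)) \<omega>) * (T / real (P * l)) +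
      b (grid T (P * l) (0 * l + i)) (x (grid T (P * l) (0 * l + i)) \<omega>) *
        (W (grid T (P * l) (Suc (0 * l + i))) \<omega> - W (grid T (P * l) (0 * l + i)) \<omega>)) - (x (grid T P c) \<omega> - x0 \<omega>))"
  proof (rule grid_sum_vanishes[where I = I])
    fix s assume "s \<in> ?J"
    then have s: "s \<in> {0..T}" using J by blast
    then show "W s \<in> borel_measurable M" using adapted measurable_F_M by blast
    \<comment> \<open>\<open>a\<close> and \<open>b\<close> are the diagonal values of
      \<open>f\<close> and \<open>g\<close> and inherit their continuity; hence x s is inserted in
      both state arguments.\<close>
    note xs = measurable_F_M[OF adapted(1)[OF s]]
    show "(\<lambda>\<omega>. a s (x s \<omega>)) \<in> borel_measurable M"
      using continuous_coefficient_measurable[OF f_continuous s s xs xs] by (simp add: f_diag)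
    show "(\<lambda>\<omega>. b s (x s \<omega>)) \<in> borel_measurable M"
      using continuous_coefficient_measurable[OF g_continuous s s xs xs] by (simp add: g_diag)
  next
    show "AE \<omega> in M. continuous_on ?J (\<lambda>s. a s (x s \<omega>))"
      using x_continuous
    proof eventually_elim
      case (elim \<omega>)
      then have "continuous_on ?J (\<lambda>s. x s \<omega>)" using J continuous_on_subset by blast
      from continuous_coefficient_path[OF f_continuous continuous_on_id continuous_on_id this this] J
      show ?case by (simp add: f_diag)
    qed
    show "AE \<omega> in M. x (grid T P c) \<omega> - x0 \<omega> = integral ?J (\<lambda>s. a s (x s \<omega>)) + I \<omega>"
      using I(2) by eventually_elim (simp add: g0)
  qed (use P T_pos I(1) in \<open>auto simp: g0\<close>)
  then show ?thesis by (simp add: W_step_def)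
qed

text \<open>Within one step of the scheme the time \<open>s\<close> and the value of y at
  \<open>s\<close> are frozen, so the step equation itself provides the stochastic integral to be
  approximated. The interval may end at an intermediate point, since the error will be compared with
  the walk there too.\<close>

lemma sd_block_vanishes:
  assumes N: "N > 0" and m: "m > 0" and k: "k < N" and q: "q \<le> m"
  defines "s \<equiv> grid T N k"
  shows "vanishes_in_prob (\<lambda>l \<omega>. (\<Sum>i<q * l.
      f s (grid T (N * m * l) (k * m * l + i)) (y N s \<omega>) (y N (grid T (N * m * l) (k * m * l + i)) \<omega>) * (T / real (N * m * l)) +
      g s (grid T (N * m * l) (k * m * l + i)) (y N s \<omega>) (y N (grid T (N * m * l) (k * m * l + i)) \<omega>) * W_step (N * m * l) (k * m * l + i) \<omega>)
      - (y N (grid T (N * m) (k * m + q)) \<omega> - y N s \<omega>))"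
proof -
  define t where "t = grid T (N * m) (k * m + q)"
  have s: "s = grid T (N * m) (k * m)" using m by (simp add: s_def grid_mult)
  have le: "k * m + q \<le> N * m"
  proof -
    have "k * m + m \<le> N * m" using k by (metis Suc_leI mult_Suc mult_le_mono1 add.commute)
    then show ?thesis using q by linarith
  qed
  let ?J = "{grid T (N * m) (k * m)..grid T (N * m) (k * m + q)}"
  have J: "?J \<subseteq> {0..T}" by (rule interval_subset) (use le in auto)
  have s0T: "s \<in> {0..T}" unfolding s_def using T_pos k by (intro grid_bounds) auto
  have tn: "t \<in> {real k * (T / real N)..real (Suc k) * (T / real N)}"
  proof -
    have "grid T (N * m) (k * m) \<le> t" "t \<le> grid T (N * m) (Suc k * m)"
      unfolding t_def using T_pos q by (auto intro!: grid_mono)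
    then have "t \<in> {grid T N k..grid T N (Suc k)}" unfolding grid_mult[OF m] by simp
    then show ?thesis unfolding grid_def .
  qed
  have sd': "\<forall>n<N. \<forall>t\<in>{real n * (T / real N)..real (Suc n) * (T / real N)}. \<exists>I. is_ito_integral M W (\<lambda>v \<omega>. g (real n * (T / real N)) v (y N (real n * (T / real N)) \<omega>) (y N v \<omega>)) (real n * (T / real N)) t I \<and>
     (AE \<omega> in M. y N t \<omega> = y N (real n * (T / real N)) \<omega> + integral {real n * (T / real N)..t} (\<lambda>v. f (real n * (T / real N)) v (y N (real n * (T / real N)) \<omega>) (y N v \<omega>)) + I \<omega>)"
    using sd[of N] N by (simp add: is_sd_solution_def Let_def)
  obtain I where I: "is_ito_integral M W (\<lambda>v \<omega>. g s v (y N s \<omega>) (y N v \<omega>)) s t I"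
      "AE \<omega> in M. y N t \<omega> = y N s \<omega> + integral {s..t} (\<lambda>v. f s v (y N s \<omega>) (y N v \<omega>)) + I \<omega>"
    using sd'[rule_format, OF k tn] by (auto simp: s_def grid_def)
  have N1: "N \<ge> 1" using N by simp
  show ?thesis
    unfolding W_step_def t_def[symmetric]
  proof (rule grid_sum_vanishes[where I = I and P = "N * m" and ?i0.0 = "k * m" and q = q
      and c = "\<lambda>v \<omega>. f s v (y N s \<omega>) (y N v \<omega>)" and H = "\<lambda>v \<omega>. g s v (y N s \<omega>) (y N v \<omega>)"])
    fix v assume "v \<in> ?J"
    then have v: "v \<in> {0..T}" using J by blast
    then show "W v \<in> borel_measurable M" using adapted measurable_F_M by blast
    have "y N v \<in> borel_measurable M" "y N s \<in> borel_measurable M" using adapted(3) N1 v s0T measurable_F_M by blast+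
    then show "(\<lambda>\<omega>. f s v (y N s \<omega>) (y N v \<omega>)) \<in> borel_measurable M" "(\<lambda>\<omega>. g s v (y N s \<omega>) (y N v \<omega>)) \<in> borel_measurable M"
      by (auto intro!: continuous_coefficient_measurable[OF f_continuous s0T v] continuous_coefficient_measurable[OF g_continuous s0T v])
  next
    show "AE \<omega> in M. continuous_on ?J (\<lambda>v. f s v (y N s \<omega>) (y N v \<omega>))"
      using y_continuous[OF N1]
    proof eventually_elim
      case (elim \<omega>)
      then have "continuous_on ?J (\<lambda>s. y N s \<omega>)" using J continuous_on_subset by blast
      from continuous_coefficient_path[OF f_continuous, of ?J "\<lambda>_. s" "\<lambda>v. v" "\<lambda>_. y N s \<omega>", OF _ _ _ this] J
        image_subsetI[of ?J "\<lambda>_. s" "{0..T}", OF s0T]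
      show ?case by auto
    qed
    show "AE \<omega> in M. y N t \<omega> - y N s \<omega> = integral ?J (\<lambda>v. f s v (y N s \<omega>) (y N v \<omega>)) + I \<omega>"
      using I(2) by eventually_elim (simp add: s t_def)
    show "is_ito_integral M W (\<lambda>v \<omega>. g s v (y N s \<omega>) (y N v \<omega>)) (grid T (N * m) (k * m)) (grid T (N * m) (k * m + q)) I"
      using I(1) by (simp add: s[symmetric] t_def)
  qed (use N m T_pos in auto)
qed

text \<open>The scheme is given step by step, so its sums are joined block by block: full steps by
  induction from the common initial value, then one partial step.\<close>

lemma sd_grid_vanishes:
  assumes N: "N > 0" and m: "m > 0" and c: "c \<le> N * m"
  shows "vanishes_in_prob (\<lambda>l \<omega>. (\<Sum>i<c * l.
      f (grid T (N * m * l) (i div (m * l) * (m * l))) (grid T (N * m * l) i)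
        (y N (grid T (N * m * l) (i div (m * l) * (m * l))) \<omega>) (y N (grid T (N * m * l) i) \<omega>) * (T / real (N * m * l)) +
      g (grid T (N * m * l) (i div (m * l) * (m * l))) (grid T (N * m * l) i)
        (y N (grid T (N * m * l) (i div (m * l) * (m * l))) \<omega>) (y N (grid T (N * m * l) i) \<omega>) * W_step (N * m * l) i \<omega>)
      - (y N (grid T (N * m) c) \<omega> - x0 \<omega>))"
proof -
  define h where "h = (\<lambda>l i \<omega>. f (grid T (N * m * l) (i div (m * l) * (m * l))) (grid T (N * m * l) i)
        (y N (grid T (N * m * l) (i div (m * l) * (m * l))) \<omega>) (y N (grid T (N * m * l) i) \<omega>) * (T / real (N * m * l)) +
      g (grid T (N * m * l) (i div (m * l) * (m * l))) (grid T (N * m * l) i)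
        (y N (grid T (N * m * l) (i div (m * l) * (m * l))) \<omega>) (y N (grid T (N * m * l) i) \<omega>) * W_step (N * m * l) i \<omega>)"
  define V where "V = (\<lambda>c. vanishes_in_prob (\<lambda>l \<omega>. (\<Sum>i<c * l. h l i \<omega>) - (y N (grid T (N * m) c) \<omega> - x0 \<omega>)))"
  have block: "V (k * m + q)" if "V (k * m)" "k < N" "q \<le> m" for k q
  proof -
    have "vanishes_in_prob (\<lambda>l \<omega>. (\<Sum>i<q * l. h l (k * m * l + i) \<omega>) - (y N (grid T (N * m) (k * m + q)) \<omega> - y N (grid T (N * m) (k * m)) \<omega>))"
    proof (rule vanishes_in_prob_AE_bound[OF sd_block_vanishes[OF N m that(2,3)]])
      show "\<forall>\<^sub>F l in sequentially. AE \<omega> in M.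
        \<bar>(\<Sum>i<q * l. h l (k * m * l + i) \<omega>) - (y N (grid T (N * m) (k * m + q)) \<omega> - y N (grid T (N * m) (k * m)) \<omega>)\<bar>
        \<le> \<bar>(\<Sum>i<q * l. f (grid T N k) (grid T (N * m * l) (k * m * l + i)) (y N (grid T N k) \<omega>) (y N (grid T (N * m * l) (k * m * l + i)) \<omega>) * (T / real (N * m * l)) +
      g (grid T N k) (grid T (N * m * l) (k * m * l + i)) (y N (grid T N k) \<omega>) (y N (grid T (N * m * l) (k * m * l + i)) \<omega>) * W_step (N * m * l) (k * m * l + i) \<omega>)
      - (y N (grid T (N * m) (k * m + q)) \<omega> - y N (grid T N k) \<omega>)\<bar>"
        using eventually_gt_at_top[of 0]
      proof eventually_elim
        case (elim l)
        \<comment> \<open>Left-point sums use only indices i < q l \<le> m l, so rounding down never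
          reaches the next block, even when q = m.\<close>
        have block: "(k * m * l + i) div (m * l) * (m * l) = k * (m * l)" if "i < q * l" for i
        proof -
          have "i < m * l" using that \<open>q \<le> m\<close> by (meson less_le_trans mult_le_mono1)
          then show ?thesis using elim m by (simp add: mult.assoc div_mult_self3)
        qed
        have start: "grid T (N * m * l) (k * (m * l)) = grid T N k"
          using grid_mult[of "m * l" T N k] m elim by (simp add: mult.assoc)
        have "h l (k * m * l + i) \<omega> = f (grid T N k) (grid T (N * m * l) (k * m * l + i)) (y N (grid T N k) \<omega>) (y N (grid T (N * m * l) (k * m * l + i)) \<omega>) * (T / real (N * m * l)) +
      g (grid T N k) (grid T (N * m * l) (k * m * l + i)) (y N (grid T N k) \<omega>) (y N (grid T (N * m * l) (k * m * l + i)) \<omega>) * W_step (N * m * l) (k * m * l + i) \<omega>"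
          if "i < q * l" for i \<omega> unfolding h_def block[OF that] start by (rule refl)
        then show ?case by (simp add: grid_mult[OF m])
      qed
    qed
    from vanishes_in_prob_add[OF that(1)[unfolded V_def] this]
    show ?thesis
      unfolding V_def by (rule vanishes_in_prob_AE_bound) (simp add: distrib_right sum_lessThan_add)
  qed
  have V0: "V 0"
    unfolding V_def
  proof (rule vanishes_in_prob_AE_bound[where Y = "\<lambda>_ _. 0"])
    show "vanishes_in_prob (\<lambda>_ _. 0)" by (auto simp: vanishes_in_prob_def intro!: holds_exceptI[of "{}"])
    have "AE \<omega> in M. y N 0 \<omega> = x0 \<omega>" using sd[of N] N by (simp add: is_sd_solution_def)
    then have y0: "AE \<omega> in M. y N (grid T (N * m) 0) \<omega> - x0 \<omega> = 0"
      by eventually_elim (simp add: grid_def)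
    show "\<forall>\<^sub>F l in sequentially. AE \<omega> in M. \<bar>(\<Sum>i<0 * l. h l i \<omega>) - (y N (grid T (N * m) 0) \<omega> - x0 \<omega>)\<bar> \<le> \<bar>0\<bar>"
      by (rule always_eventually, rule allI, rule eventually_mono[OF y0]) simp
  qed
  have Vk: "V (k * m)" if "k \<le> N" for k
    using that
  proof (induction k)
    case (Suc k)
    then show ?case using block[of k m] by (simp add: add.commute)
  qed (simp add: V0)
  \<comment> \<open>Any c consists of c div m full blocks and c mod m further points. At c = N m
    there is no further block to enter, so this end point belongs to the case of full
    blocks.\<close>
  have "V c"
  proof (cases "c = N * m")
    case False
    then have "c div m < N" using c m by (simp add: less_mult_imp_div_less)
    then show ?thesis using block[of "c div m" "c mod m"] Vk[of "c div m"] m by simp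
  qed (simp add: Vk)
  then show ?thesis by (simp add: V_def h_def)
qed

text \<open>Both processes start from \<open>x0\<close>, which cancels. Their sums use the same grid
  and the same increments of W, so subtracting them amounts to subtracting the coefficients.\<close>

lemma err_walk_vanishes:
  assumes N: "N > 0" and m: "m > 0" and c: "c \<le> N * m"
  shows "vanishes_in_prob (\<lambda>l \<omega>. err_walk N m l (c * l) \<omega> - (y N (grid T (N * m) c) \<omega> - x (grid T (N * m) c) \<omega>))"
proof -
  have "N * m > 0" using N m by simp
  from vanishes_in_prob_diff[OF sd_grid_vanishes[OF N m c] sde_grid_vanishes[OF this c]]
  show ?thesis
  proof (rule vanishes_in_prob_AE_bound, intro always_eventually allI AE_I2)
    fix l \<omega>
    let ?n = "N * m * l" and ?\<kappa> = "\<lambda>i. i div (m * l) * (m * l)"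
    have "err_walk N m l (c * l) \<omega> =
      (\<Sum>i<c * l. f (grid T ?n (?\<kappa> i)) (grid T ?n i) (y N (grid T ?n (?\<kappa> i)) \<omega>) (y N (grid T ?n i) \<omega>) * (T / real ?n) +
        g (grid T ?n (?\<kappa> i)) (grid T ?n i) (y N (grid T ?n (?\<kappa> i)) \<omega>) (y N (grid T ?n i) \<omega>) * W_step ?n i \<omega>)
      - (\<Sum>i<c * l. a (grid T ?n i) (x (grid T ?n i) \<omega>) * (T / real ?n) + b (grid T ?n i) (x (grid T ?n i) \<omega>) * W_step ?n i \<omega>)"
      unfolding walk_def sum_subtractf[symmetric]
      by (intro sum.cong refl) (simp only: err_drift_def err_diffusion_def left_diff_distrib add_diff_add)
    then show "\<bar>err_walk N m l (c * l) \<omega> - (y N (grid T (N * m) c) \<omega> - x (grid T (N * m) c) \<omega>)\<bar> \<le>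
      \<bar>(\<Sum>i<c * l. f (grid T ?n (?\<kappa> i)) (grid T ?n i) (y N (grid T ?n (?\<kappa> i)) \<omega>) (y N (grid T ?n i) \<omega>) * (T / real ?n) +
        g (grid T ?n (?\<kappa> i)) (grid T ?n i) (y N (grid T ?n (?\<kappa> i)) \<omega>) (y N (grid T ?n i) \<omega>) * W_step ?n i \<omega>)
       - (y N (grid T (N * m) c) \<omega> - x0 \<omega>) -
      ((\<Sum>i<c * l. a (grid T ?n i) (x (grid T ?n i) \<omega>) * (T / real ?n) + b (grid T ?n i) (x (grid T ?n i) \<omega>) * W_step ?n i \<omega>)
       - (x (grid T (N * m) c) \<omega> - x0 \<omega>))\<bar>"
      by linarith
  qed
qed

end

subsection \<open>The stopped error walk\<close>

lemma walk_cong: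
  "(\<And>j. j < i \<Longrightarrow> \<alpha> j \<omega> = \<alpha>' j \<omega> \<and> \<beta> j \<omega> = \<beta>' j \<omega>) \<Longrightarrow> walk \<delta> \<xi> \<alpha> \<beta> i \<omega> = walk \<delta> \<xi> \<alpha>' \<beta>' i \<omega>"
  by (simp add: walk_def)

lemma walk_frozen:
  assumes "i \<le> n" "\<And>j. i \<le> j \<Longrightarrow> j < n \<Longrightarrow> \<alpha> j \<omega> = 0 \<and> \<beta> j \<omega> = 0"
  shows "walk \<delta> \<xi> \<alpha> \<beta> n \<omega> = walk \<delta> \<xi> \<alpha> \<beta> i \<omega>"
  using assms by (induction n rule: dec_induct) (auto simp: walk_Suc)

context semi_discrete
begin

lemma grid_gaussian_steps:
  assumes n: "n > 0"
  shows "gaussian_steps M (\<lambda>i. F (grid T n i)) (W_step n) (T / real n) n"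
proof (unfold_locales)
  fix i assume i: "i < n"
  have in_T: "grid T n i \<in> {0..T}" "grid T n (Suc i) \<in> {0..T}"
    using grid_bounds[of T i n] grid_bounds[of T "Suc i" n] T_pos i by auto
  have len: "grid T n (Suc i) - grid T n i = T / real n" by (simp add: grid_def add_divide_distrib algebra_simps)
  have "T / real n > 0" using T_pos n by simp
  then have less: "grid T n i < grid T n (Suc i)" using len by linarith
  have "W (grid T n i) \<in> borel_measurable (F (grid T n (Suc i)))" "W (grid T n (Suc i)) \<in> borel_measurable (F (grid T n (Suc i)))"
    using measurable_F_mono[OF less_imp_le[OF less] adapted(2)[OF in_T(1)]] adapted(2)[OF in_T(2)] by auto
  then show "W_step n i \<in> borel_measurable (F (grid T n (Suc i)))"
    unfolding W_step_def[abs_def] by measurable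
  have wp: "distributed M lborel (\<lambda>\<omega>. W (grid T n (Suc i)) \<omega> - W (grid T n i) \<omega>) (\<lambda>z. ennreal (normal_density 0 (sqrt (grid T n (Suc i) - grid T n i)) z))"
    "\<forall>A\<in>sets (F (grid T n i)). \<forall>B\<in>sets borel.
        measure M (A \<inter> ((\<lambda>\<omega>. W (grid T n (Suc i)) \<omega> - W (grid T n i) \<omega>) -` B \<inter> space M)) =
        measure M A * measure M ((\<lambda>\<omega>. W (grid T n (Suc i)) \<omega> - W (grid T n i) \<omega>) -` B \<inter> space M)"
    using wiener less in_T unfolding wiener_process_def by auto
  show "distributed M lborel (W_step n i) (\<lambda>z. ennreal (normal_density 0 (sqrt (T / real n)) z))"
    using wp(1) unfolding len W_step_def[abs_def] .
  show "prob (A \<inter> (W_step n i -` B \<inter> space M)) = prob A * prob (W_step n i -` B \<inter> space M)"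
    if "A \<in> sets (F (grid T n i))" "B \<in> sets borel" for A B
    using wp(2) that unfolding W_step_def[abs_def] by blast
next
  show "sets (F (grid T n i)) \<subseteq> sets (F (grid T n j))" if "i \<le> j" for i j
    using that T_pos by (intro F_mono grid_mono) auto
qed (use F_subalgebra T_pos n in auto)

lemma err_coefficients_adapted:
  assumes "N \<ge> 1" "i \<le> N * m * l"
  shows "err_drift N m l i \<in> borel_measurable (F (grid T (N * m * l) i))"
    and "err_diffusion N m l i \<in> borel_measurable (F (grid T (N * m * l) i))"
proof -
  let ?s = "grid T (N * m * l) i" and ?u = "grid T (N * m * l) (i div (m * l) * (m * l))"
  have le: "i div (m * l) * (m * l) \<le> i" by simp
  have s: "?s \<in> {0..T}" and u: "?u \<in> {0..T}"
    using grid_bounds[of T] assms(2) T_pos le by (meson le_trans less_imp_le)+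
  have us: "?u \<le> ?s" using T_pos le by (intro grid_mono) auto
  have meas: "x ?s \<in> borel_measurable (F ?s)" "y N ?s \<in> borel_measurable (F ?s)" "y N ?u \<in> borel_measurable (F ?s)"
    using adapted(1)[OF s] adapted(3)[OF s assms(1)] measurable_F_mono[OF us adapted(3)[OF u assms(1)]] by auto
  have "(\<lambda>\<omega>. a ?s (x ?s \<omega>)) \<in> borel_measurable (F ?s)" "(\<lambda>\<omega>. b ?s (x ?s \<omega>)) \<in> borel_measurable (F ?s)"
    using continuous_coefficient_measurable[OF f_continuous s s meas(1) meas(1)]
      continuous_coefficient_measurable[OF g_continuous s s meas(1) meas(1)] by (auto simp: f_diag g_diag)
  then show "err_drift N m l i \<in> borel_measurable (F ?s)" "err_diffusion N m l i \<in> borel_measurable (F ?s)"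
    unfolding err_drift_def[abs_def] err_diffusion_def[abs_def]
    using continuous_coefficient_measurable[OF f_continuous u s meas(3,2)]
      continuous_coefficient_measurable[OF g_continuous u s meas(3,2)] by (auto intro!: borel_measurable_diff)
qed

text \<open>Writing a(s, xs) as f(s, s, xs, xs), and \<open>b\<close> likewise, makes q the distance
  between two argument tuples. Squaring removes the square root of Assumption A: (q + sqrt q)^2
  \<le> 2 (q + 1) q, and q + 1 is bounded on the ball. The result is linear in q, which is the
  growth that the Yamada-Watanabe function absorbs.\<close>

lemma coefficient_error_bound:
  assumes C: "C \<ge> 0"
    "\<And>s1 s2 r1 r2 x1 x2 y1 y2. s1 \<in> {0..T} \<Longrightarrow> s2 \<in> {0..T} \<Longrightarrow> r1 \<in> {0..T} \<Longrightarrow> r2 \<in> {0..T} \<Longrightarrow>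
      \<bar>x1\<bar> \<le> R \<Longrightarrow> \<bar>x2\<bar> \<le> R \<Longrightarrow> \<bar>y1\<bar> \<le> R \<Longrightarrow> \<bar>y2\<bar> \<le> R \<Longrightarrow>
      \<bar>f s1 r1 x1 y1 - f s2 r2 x2 y2\<bar> \<le> C * (\<bar>s1 - s2\<bar> + \<bar>r1 - r2\<bar> + \<bar>x1 - x2\<bar> + \<bar>y1 - y2\<bar>) \<and>
      \<bar>g s1 r1 x1 y1 - g s2 r2 x2 y2\<bar> \<le> C * (\<bar>s1 - s2\<bar> + \<bar>r1 - r2\<bar> + \<bar>x1 - x2\<bar> + \<bar>y1 - y2\<bar> + sqrt \<bar>x1 - x2\<bar>)"
    and "u \<in> {0..T}" "s \<in> {0..T}" "\<bar>yu\<bar> \<le> R" "\<bar>ys\<bar> \<le> R" "\<bar>xs\<bar> \<le> R"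
    and q: "q = \<bar>u - s\<bar> + \<bar>yu - xs\<bar> + \<bar>ys - xs\<bar>"
  shows "\<bar>f u s yu ys - a s xs\<bar> \<le> C * q" "\<bar>g u s yu ys - b s xs\<bar> \<le> C * (q + sqrt q)" "q \<le> T + 4 * R"
    "(g u s yu ys - b s xs)\<^sup>2 \<le> 2 * C\<^sup>2 * (T + 4 * R + 1) * q"
proof -
  have q0: "q \<ge> 0" by (simp add: q)
  show "\<bar>f u s yu ys - a s xs\<bar> \<le> C * q"
    using C(2)[of u s s s yu xs ys xs] assms by (simp add: f_diag)
  have "\<bar>g u s yu ys - b s xs\<bar> \<le> C * (q + sqrt \<bar>yu - xs\<bar>)"
    using C(2)[of u s s s yu xs ys xs] assms by (simp add: g_diag)
  also have "\<dots> \<le> C * (q + sqrt q)"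
    using C(1) by (intro mult_left_mono add_left_mono real_sqrt_le_mono) (auto simp: q)
  finally show g: "\<bar>g u s yu ys - b s xs\<bar> \<le> C * (q + sqrt q)" .
  show qQ: "q \<le> T + 4 * R" using assms by (auto simp: q)
  have "(g u s yu ys - b s xs)\<^sup>2 \<le> (C * (q + sqrt q))\<^sup>2"
    using g by (metis abs_ge_zero power2_abs power_mono)
  also have "\<dots> \<le> C\<^sup>2 * (2 * q\<^sup>2 + 2 * q)"
    using sum_squares_bound[of q "sqrt q"] q0 by (simp add: power_mult_distrib power2_sum mult_left_mono)
  also have "\<dots> = 2 * C\<^sup>2 * ((q + 1) * q)" by (simp add: power2_eq_square algebra_simps)
  also have "\<dots> \<le> 2 * C\<^sup>2 * ((T + 4 * R + 1) * q)"
    using qQ q0 by (intro mult_left_mono mult_right_mono) auto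
  finally show "(g u s yu ys - b s xs)\<^sup>2 \<le> 2 * C\<^sup>2 * (T + 4 * R + 1) * q" by simp
qed

text \<open>Stopping the error walk as soon as it exceeds the threshold turns a bound on the final value into
  a bound on the maximum, so that no maximal inequality is needed.\<close>

lemma err_walk_max_small:
  fixes R \<theta> \<epsilon> :: real
  assumes R: "R > 0" and \<theta>: "0 < \<theta>" "\<theta> \<le> 1" and \<epsilon>: "\<epsilon> > 0"
  obtains \<rho> where "\<rho> > 0"
    "\<And>N m l. N > 0 \<Longrightarrow> m > 0 \<Longrightarrow> l > 0 \<Longrightarrow> T / real N \<le> \<rho> \<Longrightarrow>
      holds_except \<epsilon> (\<lambda>\<omega>. (\<forall>j\<le>N * m * l. let n = N * m * l; \<kappa> = j div (m * l) * (m * l); \<gamma> = j div l * l in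
          \<bar>x (grid T n j) \<omega>\<bar> \<le> R \<and> \<bar>y N (grid T n j) \<omega>\<bar> \<le> R \<and> \<bar>x (grid T n \<kappa>) \<omega> - x (grid T n j) \<omega>\<bar> \<le> \<rho> \<and>
          \<bar>err_walk N m l \<gamma> \<omega> - (y N (grid T n \<gamma>) \<omega> - x (grid T n \<gamma>) \<omega>)\<bar> \<le> \<rho> \<and>
          \<bar>(y N (grid T n \<gamma>) \<omega> - x (grid T n \<gamma>) \<omega>) - (y N (grid T n j) \<omega> - x (grid T n j) \<omega>)\<bar> \<le> \<rho>)
        \<longrightarrow> (\<forall>j\<le>N * m * l. \<bar>err_walk N m l j \<omega>\<bar> \<le> \<theta>))"
proof -
  obtain C where C: "C \<ge> 0"
    "\<And>s1 s2 r1 r2 x1 x2 y1 y2. s1 \<in> {0..T} \<Longrightarrow> s2 \<in> {0..T} \<Longrightarrow> r1 \<in> {0..T} \<Longrightarrow> r2 \<in> {0..T} \<Longrightarrow>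
      \<bar>x1\<bar> \<le> R \<Longrightarrow> \<bar>x2\<bar> \<le> R \<Longrightarrow> \<bar>y1\<bar> \<le> R \<Longrightarrow> \<bar>y2\<bar> \<le> R \<Longrightarrow>
      \<bar>f s1 r1 x1 y1 - f s2 r2 x2 y2\<bar> \<le> C * (\<bar>s1 - s2\<bar> + \<bar>r1 - r2\<bar> + \<bar>x1 - x2\<bar> + \<bar>y1 - y2\<bar>) \<and>
      \<bar>g s1 r1 x1 y1 - g s2 r2 x2 y2\<bar> \<le> C * (\<bar>s1 - s2\<bar> + \<bar>r1 - r2\<bar> + \<bar>x1 - x2\<bar> + \<bar>y1 - y2\<bar> + sqrt \<bar>x1 - x2\<bar>)"
    by (rule assumption_A_bound[OF A R]) blast
  \<comment> \<open>\<open>Q\<close> bounds the argument distance q on the ball of radius R and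
    \<open>K\<close> the stopped coefficients. \<open>D\<close> dominates the linear constants of
    the drift and of the squared diffusion; its factor 2 comes from \<open>q_le\<close>.\<close>
  define Q where "Q = T + 4 * R"
  define K where "K = C * (Q + sqrt Q)"
  define D where "D = 2 * (C + 2 * C\<^sup>2 * (Q + 1))"
  have Q: "Q \<ge> 0" using R T_pos by (simp add: Q_def)
  have K: "K \<ge> 0" using C(1) Q by (simp add: K_def)
  have D: "D \<ge> 0" using C(1) Q by (simp add: D_def)
  \<comment> \<open>Markov's inequality at level \<theta> turns this bound on the mean into a
    probability of at most \<epsilon> / 2, strictly below \<epsilon>.\<close>
  have tol: "\<theta> * (\<epsilon> / 2) > 0" using \<theta> \<epsilon> by simp
  show thesis
  proof (rule walk_L1_small[OF D less_imp_le[OF T_pos] tol, where 'a = 'a and K = K])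
    fix \<rho> :: real
    assume \<rho>: "\<rho> > 0"
    "\<And>(M :: 'a measure) G \<xi> \<delta> n \<alpha> \<beta> \<kappa> \<gamma>.
      bounded_walk M G \<xi> \<delta> n \<alpha> \<beta> K \<Longrightarrow> real n * \<delta> \<le> T \<Longrightarrow> \<delta> \<le> \<rho> \<Longrightarrow>
      (\<And>i. i < n \<Longrightarrow> \<kappa> i \<le> i \<and> real (i - \<kappa> i) * \<delta> \<le> \<rho>) \<Longrightarrow> (\<And>i. i < n \<Longrightarrow> \<gamma> i \<le> i \<and> real (i - \<gamma> i) * \<delta> \<le> \<rho>) \<Longrightarrow>
      (\<And>i \<omega>. i < n \<Longrightarrow> \<omega> \<in> space M \<Longrightarrow> \<alpha> i \<omega> \<noteq> 0 \<or> \<beta> i \<omega> \<noteq> 0 \<Longrightarrow> \<bar>walk \<delta> \<xi> \<alpha> \<beta> i \<omega>\<bar> \<le> 1) \<Longrightarrow>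
      (\<And>i \<omega>. i < n \<Longrightarrow> \<omega> \<in> space M \<Longrightarrow> \<bar>\<alpha> i \<omega>\<bar> \<le> D * (\<rho> + \<bar>walk \<delta> \<xi> \<alpha> \<beta> i \<omega>\<bar>
         + \<bar>walk \<delta> \<xi> \<alpha> \<beta> i \<omega> - walk \<delta> \<xi> \<alpha> \<beta> (\<kappa> i) \<omega>\<bar> + \<bar>walk \<delta> \<xi> \<alpha> \<beta> i \<omega> - walk \<delta> \<xi> \<alpha> \<beta> (\<gamma> i) \<omega>\<bar>)) \<Longrightarrow>
      (\<And>i \<omega>. i < n \<Longrightarrow> \<omega> \<in> space M \<Longrightarrow> (\<beta> i \<omega>)\<^sup>2 \<le> D * (\<rho> + \<bar>walk \<delta> \<xi> \<alpha> \<beta> i \<omega>\<bar>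
         + \<bar>walk \<delta> \<xi> \<alpha> \<beta> i \<omega> - walk \<delta> \<xi> \<alpha> \<beta> (\<kappa> i) \<omega>\<bar> + \<bar>walk \<delta> \<xi> \<alpha> \<beta> i \<omega> - walk \<delta> \<xi> \<alpha> \<beta> (\<gamma> i) \<omega>\<bar>)) \<Longrightarrow>
      integrable M (walk \<delta> \<xi> \<alpha> \<beta> n) \<and> (\<integral>\<omega>. \<bar>walk \<delta> \<xi> \<alpha> \<beta> n \<omega>\<bar> \<partial>M) \<le> \<theta> * (\<epsilon> / 2)"
    \<comment> \<open>Five errors of size \<rho> / 8 enter \<open>q_le\<close>: the time lag, the
      increment of x, the two gaps between walk and error, and the change of the error since the
      last intermediate point. Their sum stays below \<rho>.\<close>
    show thesis
    proof (rule that[of "\<rho> / 8"])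
      show "\<rho> / 8 > 0" using \<rho>(1) by simp
      fix N m l :: nat assume N: "N > 0" and m: "m > 0" and l: "l > 0" and \<Delta>: "T / real N \<le> \<rho> / 8"
      define n where "n = N * m * l"
      have n: "n > 0" using N m l by (simp add: n_def)
      define \<delta> where "\<delta> = T / real n"
      define \<kappa> where "\<kappa> j = j div (m * l) * (m * l)" for j
      define \<gamma> where "\<gamma> j = j div l * l" for j
      define S where "S = err_walk N m l"
      define e where "e = (\<lambda>j \<omega>. y N (grid T n j) \<omega> - x (grid T n j) \<omega>)"
      define side where "side = (\<lambda>\<omega> j. \<bar>x (grid T n j) \<omega>\<bar> \<le> R \<and> \<bar>y N (grid T n j) \<omega>\<bar> \<le> R \<and>
         \<bar>x (grid T n (\<kappa> j)) \<omega> - x (grid T n j) \<omega>\<bar> \<le> \<rho> / 8 \<and> \<bar>S (\<gamma> j) \<omega> - e (\<gamma> j) \<omega>\<bar> \<le> \<rho> / 8 \<and> \<bar>e (\<gamma> j) \<omega> - e j \<omega>\<bar> \<le> \<rho> / 8)"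
      \<comment> \<open>Activity at i looks only at indices up to i, so it is measurable at the time
        of the i-th point and the stopped coefficients stay adapted. Once lost it never returns. The
        size of \<open>S\<close> is tested before step i is made, so the stopped walk still performs
        the step that first carries it beyond \<theta>.\<close>
      define act where "act = (\<lambda>i \<omega>. \<forall>j\<in>{..i}. side \<omega> j \<and> \<bar>S j \<omega>\<bar> \<le> \<theta>)"
      define \<alpha> where "\<alpha> = (\<lambda>i \<omega>. if act i \<omega> then err_drift N m l i \<omega> else 0)"
      define \<beta> where "\<beta> = (\<lambda>i \<omega>. if act i \<omega> then err_diffusion N m l i \<omega> else 0)"
      define V where "V = walk \<delta> (W_step n) \<alpha> \<beta>"
      have \<kappa>_le: "\<kappa> j \<le> j" and \<gamma>_le: "\<gamma> j \<le> j" for j by (simp_all add: \<kappa>_def \<gamma>_def)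
      \<comment> \<open>Points of the scheme's grid are also intermediate points. Hence the side
        condition at the index \<open>\<kappa> i\<close> compares walk and error at
        \<open>\<kappa> i\<close> itself.\<close>
      have \<gamma>\<kappa>: "\<gamma> (\<kappa> j) = \<kappa> j" for j using l by (simp add: \<gamma>_def \<kappa>_def flip: mult.assoc)
      have S_eq: "S = walk \<delta> (W_step n) (err_drift N m l) (err_diffusion N m l)"
        by (simp add: S_def \<delta>_def n_def)
      have V_eq: "V i \<omega> = S i \<omega>" if "\<And>j. j < i \<Longrightarrow> act j \<omega>" for i \<omega>
        unfolding V_def S_eq by (rule walk_cong) (use that in \<open>simp add: \<alpha>_def \<beta>_def\<close>)
      have act_mono: "act i \<omega> \<Longrightarrow> j \<le> i \<Longrightarrow> act j \<omega>" for i j \<omega> by (auto simp: act_def)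
      interpret gs: gaussian_steps M "\<lambda>i. F (grid T n i)" "W_step n" \<delta> n
        unfolding \<delta>_def by (rule grid_gaussian_steps[OF n])
      have N1: "N \<ge> 1" using N by simp
      have in_T: "grid T n j \<in> {0..T}" if "j \<le> n" for j using grid_bounds[of T j n] that T_pos by simp
      have S_adapted: "S i \<in> borel_measurable (F (grid T n i))" if "i \<le> n" for i
        unfolding S_eq using err_coefficients_adapted[OF N1] that
        by (intro gs.walk_measurable) (auto simp: n_def)
      have x_adapted: "x (grid T n j) \<in> borel_measurable (F (grid T n i))"
        and y_adapted: "y N (grid T n j) \<in> borel_measurable (F (grid T n i))"
        and S_adapted': "S j \<in> borel_measurable (F (grid T n i))" if "j \<le> i" "i \<le> n" for i j
        using gs.measurable_G_mono[OF that] S_adapted[of j] in_T[of j] adapted(1)[of "grid T n j"]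
          adapted(3)[of "grid T n j" N] N1 that by simp_all
      have act_meas: "Measurable.pred (F (grid T n i)) (act i)" if i: "i \<le> n" for i
      proof -
        have "Measurable.pred (F (grid T n i)) (\<lambda>\<omega>. side \<omega> j \<and> \<bar>S j \<omega>\<bar> \<le> \<theta>)" if "j \<in> {..i}" for j
        proof -
          have j: "j \<le> i" "\<kappa> j \<le> i" "\<gamma> j \<le> i" using that \<kappa>_le[of j] \<gamma>_le[of j] by auto
          note [measurable] = x_adapted[OF j(1) i] x_adapted[OF j(2) i] x_adapted[OF j(3) i]
            y_adapted[OF j(1) i] y_adapted[OF j(3) i] S_adapted'[OF j(1) i] S_adapted'[OF j(3) i]
          show ?thesis unfolding side_def e_def by measurable
        qed
        then show ?thesis unfolding act_def[abs_def] by (intro pred_intros_finite) auto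
      qed
      define q where "q i \<omega> = \<bar>grid T n (\<kappa> i) - grid T n i\<bar> + \<bar>y N (grid T n (\<kappa> i)) \<omega> - x (grid T n i) \<omega>\<bar>
          + \<bar>y N (grid T n i) \<omega> - x (grid T n i) \<omega>\<bar>" for i \<omega>
      have coeff: "\<bar>err_drift N m l i \<omega>\<bar> \<le> C * q i \<omega>" "\<bar>err_diffusion N m l i \<omega>\<bar> \<le> C * (q i \<omega> + sqrt (q i \<omega>))"
          "q i \<omega> \<le> Q" "(err_diffusion N m l i \<omega>)\<^sup>2 \<le> 2 * C\<^sup>2 * (Q + 1) * q i \<omega>"
        if "act i \<omega>" "i \<le> n" for i \<omega>
      proof -
        have "side \<omega> i" "side \<omega> (\<kappa> i)" using that(1) \<kappa>_le[of i] by (auto simp: act_def)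
        then have bd: "\<bar>y N (grid T n (\<kappa> i)) \<omega>\<bar> \<le> R" "\<bar>y N (grid T n i) \<omega>\<bar> \<le> R" "\<bar>x (grid T n i) \<omega>\<bar> \<le> R"
          by (auto simp: side_def)
        have gr: "grid T n (\<kappa> i) \<in> {0..T}" "grid T n i \<in> {0..T}" using in_T that(2) \<kappa>_le[of i] by auto
        note * = coefficient_error_bound[where C = C and R = R and u = "grid T n (\<kappa> i)" and s = "grid T n i"
            and yu = "y N (grid T n (\<kappa> i)) \<omega>" and ys = "y N (grid T n i) \<omega>" and xs = "x (grid T n i) \<omega>"
            and q = "q i \<omega>", OF C gr bd q_def]
        show "\<bar>err_drift N m l i \<omega>\<bar> \<le> C * q i \<omega>" "\<bar>err_diffusion N m l i \<omega>\<bar> \<le> C * (q i \<omega> + sqrt (q i \<omega>))"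
          "q i \<omega> \<le> Q" "(err_diffusion N m l i \<omega>)\<^sup>2 \<le> 2 * C\<^sup>2 * (Q + 1) * q i \<omega>"
          using * unfolding err_drift_def err_diffusion_def Q_def n_def[symmetric] \<kappa>_def[symmetric] by blast+
      qed
      have idx: "real (i - \<kappa> i) * \<delta> \<le> T / real N" "real (i - \<gamma> i) * \<delta> \<le> T / real N" for i
      proof -
        have "i - \<kappa> i \<le> m * l" "i - \<gamma> i \<le> m * l"
        proof -
          have "i - \<kappa> i = i mod (m * l)" "i - \<gamma> i = i mod l"
            by (simp_all add: \<kappa>_def \<gamma>_def minus_div_mult_eq_mod)
          moreover have "i mod (m * l) < m * l" "i mod l < l" using m l by simp_all
          moreover have "l \<le> m * l" using m by simp
          ultimately show "i - \<kappa> i \<le> m * l" "i - \<gamma> i \<le> m * l" by linarith+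
        qed
        moreover have "real (m * l) * \<delta> = T / real N" using m l by (simp add: \<delta>_def n_def)
        moreover have "\<delta> \<ge> 0" using T_pos by (simp add: \<delta>_def)
        ultimately show "real (i - \<kappa> i) * \<delta> \<le> T / real N" "real (i - \<gamma> i) * \<delta> \<le> T / real N"
          by (metis mult_right_mono of_nat_le_iff)+
      qed
      \<comment> \<open>\<open>q\<close> involves the true error at \<open>\<kappa> i\<close> and at
        i. The first is read off the walk directly, the second through \<open>\<gamma> i\<close>,
        where walk and error are known to be close. Moving the walk from these two indices to i
        produces the two lag terms.\<close>
      have q_le: "q i \<omega> \<le> 2 * (\<rho> + \<bar>V i \<omega>\<bar> + \<bar>V i \<omega> - V (\<kappa> i) \<omega>\<bar> + \<bar>V i \<omega> - V (\<gamma> i) \<omega>\<bar>)" if "act i \<omega>" for i \<omega>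
      proof -
        have "side \<omega> i" "side \<omega> (\<kappa> i)" using that \<kappa>_le[of i] by (auto simp: act_def)
        then have s: "\<bar>x (grid T n (\<kappa> i)) \<omega> - x (grid T n i) \<omega>\<bar> \<le> \<rho> / 8" "\<bar>S (\<gamma> i) \<omega> - e (\<gamma> i) \<omega>\<bar> \<le> \<rho> / 8"
            "\<bar>e (\<gamma> i) \<omega> - e i \<omega>\<bar> \<le> \<rho> / 8" "\<bar>S (\<kappa> i) \<omega> - e (\<kappa> i) \<omega>\<bar> \<le> \<rho> / 8"
          by (auto simp: side_def \<gamma>\<kappa>)
        have VS: "V j \<omega> = S j \<omega>" if "j \<le> i" for j using V_eq[of j \<omega>] act_mono[OF \<open>act i \<omega>\<close>] that by simp
        have "grid T n (\<kappa> i) \<le> grid T n i" using \<kappa>_le[of i] T_pos by (intro grid_mono) auto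
        moreover have "grid T n i - grid T n (\<kappa> i) = real (i - \<kappa> i) * \<delta>"
          using \<kappa>_le[of i] by (simp only: grid_def \<delta>_def of_nat_diff left_diff_distrib)
        ultimately have "\<bar>grid T n (\<kappa> i) - grid T n i\<bar> \<le> \<rho> / 8" using idx(1)[of i] \<Delta> by linarith
        moreover have "\<bar>y N (grid T n (\<kappa> i)) \<omega> - x (grid T n i) \<omega>\<bar> \<le> \<bar>e (\<kappa> i) \<omega>\<bar> + \<rho> / 8"
          using s(1) unfolding e_def by linarith
        moreover have "\<bar>e (\<kappa> i) \<omega>\<bar> \<le> \<bar>S i \<omega>\<bar> + \<bar>S i \<omega> - S (\<kappa> i) \<omega>\<bar> + \<rho> / 8" using s(4) by linarith
        moreover have "\<bar>e i \<omega>\<bar> \<le> \<bar>e (\<gamma> i) \<omega>\<bar> + \<rho> / 8" using s(3) by linarith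
        moreover have "\<bar>e (\<gamma> i) \<omega>\<bar> \<le> \<bar>S i \<omega>\<bar> + \<bar>S i \<omega> - S (\<gamma> i) \<omega>\<bar> + \<rho> / 8" using s(2) by linarith
        moreover have "q i \<omega> = \<bar>grid T n (\<kappa> i) - grid T n i\<bar> + \<bar>y N (grid T n (\<kappa> i)) \<omega> - x (grid T n i) \<omega>\<bar> + \<bar>e i \<omega>\<bar>"
          by (simp add: q_def e_def)
        ultimately have "q i \<omega> \<le> \<rho> + 2 * \<bar>S i \<omega>\<bar> + \<bar>S i \<omega> - S (\<kappa> i) \<omega>\<bar> + \<bar>S i \<omega> - S (\<gamma> i) \<omega>\<bar>"
          using \<rho>(1) by simp
        moreover have "z \<le> 2 * (\<rho> + z1 + z2 + z3)" if "z \<le> \<rho> + 2 * z1 + z2 + z3" "z1 \<ge> 0" "z2 \<ge> 0" "z3 \<ge> 0" for z z1 z2 z3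
          using that \<rho>(1) by simp
        ultimately show ?thesis
          unfolding VS[OF order.refl] VS[OF \<kappa>_le] VS[OF \<gamma>_le] by simp
      qed
      have bw: "bounded_walk M (\<lambda>i. F (grid T n i)) (W_step n) \<delta> n \<alpha> \<beta> K"
      proof (unfold_locales)
        fix i assume i: "i < n"
        then have i': "i \<le> N * m * l" "i \<le> n" by (simp_all add: n_def)
        note [measurable] = act_meas[OF i'(2)] err_coefficients_adapted[OF N1 i'(1), folded n_def]
        show "\<alpha> i \<in> borel_measurable (F (grid T n i))" "\<beta> i \<in> borel_measurable (F (grid T n i))"
          unfolding \<alpha>_def \<beta>_def by measurable
        fix \<omega>
        have "C * q i \<omega> \<le> K" "C * (q i \<omega> + sqrt (q i \<omega>)) \<le> K" if "act i \<omega>"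
        proof -
          have "q i \<omega> \<le> Q + sqrt Q" "q i \<omega> + sqrt (q i \<omega>) \<le> Q + sqrt Q"
            using coeff(3)[OF that i'(2)] Q by (auto intro: add_mono real_sqrt_le_mono add_increasing2)
          then show "C * q i \<omega> \<le> K" "C * (q i \<omega> + sqrt (q i \<omega>)) \<le> K"
            unfolding K_def using C(1) by (auto intro: mult_left_mono)
        qed
        then show "\<bar>\<alpha> i \<omega>\<bar> \<le> K" "\<bar>\<beta> i \<omega>\<bar> \<le> K"
          using coeff(1,2)[OF _ i'(2), of \<omega>] K unfolding \<alpha>_def \<beta>_def by (auto intro: order.trans)
      qed (rule K)
      have key: "integrable M (V n) \<and> expectation (\<lambda>\<omega>. \<bar>V n \<omega>\<bar>) \<le> \<theta> * (\<epsilon> / 2)"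
      proof (rule \<rho>(2)[OF bw, of \<kappa> \<gamma>, folded V_def])
        show "real n * \<delta> \<le> T" using n by (simp add: \<delta>_def)
        show "\<delta> \<le> \<rho>"
        proof -
          have "N \<le> n" using m l by (simp add: n_def)
          then have "\<delta> \<le> T / real N" unfolding \<delta>_def using N T_pos by (intro divide_left_mono) auto
          then show ?thesis using \<Delta> \<rho>(1) by linarith
        qed
        show "\<kappa> i \<le> i \<and> real (i - \<kappa> i) * \<delta> \<le> \<rho>" "\<gamma> i \<le> i \<and> real (i - \<gamma> i) * \<delta> \<le> \<rho>" for i
          using \<kappa>_le[of i] \<gamma>_le[of i] idx[of i] \<Delta> \<rho>(1) by linarith+
        fix i \<omega> assume i: "i < n"
        let ?B = "\<rho> + \<bar>V i \<omega>\<bar> + \<bar>V i \<omega> - V (\<kappa> i) \<omega>\<bar> + \<bar>V i \<omega> - V (\<gamma> i) \<omega>\<bar>"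
        have B: "?B \<ge> 0" using \<rho>(1) by simp
        \<comment> \<open>Here \<theta> \<le> 1 enters: an active walk stays where the first
          derivative of the Yamada-Watanabe function is bounded by 1.\<close>
        show "\<bar>V i \<omega>\<bar> \<le> 1" if "\<alpha> i \<omega> \<noteq> 0 \<or> \<beta> i \<omega> \<noteq> 0"
        proof -
          have act: "act i \<omega>" using that by (auto simp: \<alpha>_def \<beta>_def split: if_splits)
          then have "V i \<omega> = S i \<omega>" using V_eq[of i \<omega>] act_mono by simp
          moreover have "\<bar>S i \<omega>\<bar> \<le> \<theta>" using act by (simp add: act_def)
          ultimately show ?thesis using \<theta>(2) by simp
        qed
        have D1: "C * (2 * ?B) \<le> D * ?B"
        proof -
          have "2 * C * ?B \<le> D * ?B" using C(1) Q B by (intro mult_right_mono) (auto simp: D_def)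
          then show ?thesis by (simp only: mult_ac)
        qed
        have D2: "2 * C\<^sup>2 * (Q + 1) * (2 * ?B) \<le> D * ?B"
        proof -
          have "2 * (2 * C\<^sup>2 * (Q + 1)) * ?B \<le> D * ?B" using C(1) Q B by (intro mult_right_mono) (auto simp: D_def)
          then show ?thesis by (simp only: mult_ac)
        qed
        show "\<bar>\<alpha> i \<omega>\<bar> \<le> D * ?B"
        proof (cases "act i \<omega>")
          case True
          then have "\<bar>\<alpha> i \<omega>\<bar> \<le> C * q i \<omega>" using coeff(1) i by (simp add: \<alpha>_def)
          also have "\<dots> \<le> C * (2 * ?B)" using q_le[OF True] C(1) by (intro mult_left_mono) auto
          finally show ?thesis using D1 by linarith
        qed (use D B in \<open>simp add: \<alpha>_def\<close>)
        show "(\<beta> i \<omega>)\<^sup>2 \<le> D * ?B"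
        proof (cases "act i \<omega>")
          case True
          then have "(\<beta> i \<omega>)\<^sup>2 \<le> 2 * C\<^sup>2 * (Q + 1) * q i \<omega>" using coeff(4) i by (simp add: \<beta>_def)
          also have "\<dots> \<le> 2 * C\<^sup>2 * (Q + 1) * (2 * ?B)" using q_le[OF True] C(1) Q by (intro mult_left_mono) auto
          finally show ?thesis using D2 by linarith
        qed (use D B in \<open>simp add: \<beta>_def\<close>)
      qed
      define E where "E = {\<omega>\<in>space M. \<bar>V n \<omega>\<bar> \<ge> \<theta>}"
      have V_meas: "V n \<in> borel_measurable M" using key by auto
      have E: "E \<in> events" unfolding E_def using V_meas by measurable
      have "prob E \<le> expectation (\<lambda>\<omega>. \<bar>V n \<omega>\<bar>) / \<theta>"
        unfolding E_def using key \<theta> by (intro integral_Markov_inequality_measure[where A = "space M"]) auto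
      also have "\<dots> \<le> \<theta> * (\<epsilon> / 2) / \<theta>" using key \<theta> by (intro divide_right_mono) auto
      also have "\<dots> < \<epsilon>" using \<theta> \<epsilon> by simp
      finally have E_small: "prob E < \<epsilon>" .
      \<comment> \<open>At the first index where \<open>S\<close> exceeds \<theta> the stopped walk
        still equals \<open>S\<close>, and from there on it is frozen. Its final value would then
        exceed \<theta>, which happens only on \<open>E\<close>.\<close>
      have "\<forall>j\<le>n. \<bar>S j \<omega>\<bar> \<le> \<theta>" if \<omega>: "\<omega> \<in> space M" "\<omega> \<notin> E" and side: "\<forall>j\<le>n. side \<omega> j" for \<omega>
      proof (rule ccontr)
        assume "\<not> (\<forall>j\<le>n. \<bar>S j \<omega>\<bar> \<le> \<theta>)"
        then obtain j0 where j0: "j0 \<le> n \<and> \<bar>S j0 \<omega>\<bar> > \<theta>" by (auto simp: not_le)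
        define j where "j = (LEAST j. j \<le> n \<and> \<bar>S j \<omega>\<bar> > \<theta>)"
        have j: "j \<le> n" "\<bar>S j \<omega>\<bar> > \<theta>" using LeastI[of "\<lambda>j. j \<le> n \<and> \<bar>S j \<omega>\<bar> > \<theta>", OF j0] by (auto simp: j_def)
        have before: "\<bar>S i \<omega>\<bar> \<le> \<theta>" if "i < j" for i
          using not_less_Least[of i "\<lambda>j. j \<le> n \<and> \<bar>S j \<omega>\<bar> > \<theta>"] that j(1) by (simp add: j_def[symmetric])
        have "V n \<omega> = V j \<omega>"
          unfolding V_def
        proof (rule walk_frozen[OF j(1)])
          fix i assume "j \<le> i"
          then have "\<not> act i \<omega>" using j(2) by (auto simp: act_def not_le)
          then show "\<alpha> i \<omega> = 0 \<and> \<beta> i \<omega> = 0" by (simp add: \<alpha>_def \<beta>_def)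
        qed
        also have "\<dots> = S j \<omega>"
          using before side j(1) by (intro V_eq) (auto simp: act_def)
        finally show False using j(2) \<omega> by (simp add: E_def)
      qed
      then have "holds_except \<epsilon> (\<lambda>\<omega>. (\<forall>j\<le>n. side \<omega> j) \<longrightarrow> (\<forall>j\<le>n. \<bar>S j \<omega>\<bar> \<le> \<theta>))"
        using E E_small by (intro holds_exceptI[of E]) auto
      then show "holds_except \<epsilon> (\<lambda>\<omega>. (\<forall>j\<le>N * m * l. let n = N * m * l; \<kappa> = j div (m * l) * (m * l); \<gamma> = j div l * l in
            \<bar>x (grid T n j) \<omega>\<bar> \<le> R \<and> \<bar>y N (grid T n j) \<omega>\<bar> \<le> R \<and> \<bar>x (grid T n \<kappa>) \<omega> - x (grid T n j) \<omega>\<bar> \<le> \<rho> / 8 \<and>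
            \<bar>err_walk N m l \<gamma> \<omega> - (y N (grid T n \<gamma>) \<omega> - x (grid T n \<gamma>) \<omega>)\<bar> \<le> \<rho> / 8 \<and>
            \<bar>(y N (grid T n \<gamma>) \<omega> - x (grid T n \<gamma>) \<omega>) - (y N (grid T n j) \<omega> - x (grid T n j) \<omega>)\<bar> \<le> \<rho> / 8)
          \<longrightarrow> (\<forall>j\<le>N * m * l. \<bar>err_walk N m l j \<omega>\<bar> \<le> \<theta>))"
        unfolding side_def e_def S_def n_def \<kappa>_def \<gamma>_def Let_def .
    qed
  qed
qed

end

subsection \<open>Mean square convergence\<close>

context semi_discrete
begin

text \<open>All premises of the walk estimate are arranged outside six small events. The bound on
  the walk then spreads to all times: it is read at the multiples of l, compared there with the
  error at intermediate points, and carried to arbitrary t by the path modulus of the error.\<close>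

lemma err_uniformly_small:
  assumes tight: "\<And>\<epsilon>. \<epsilon> > 0 \<Longrightarrow> \<exists>R>0. holds_except \<epsilon> (\<lambda>\<omega>. \<forall>t\<in>{0..T}. \<bar>x t \<omega>\<bar> \<le> R) \<and>
      (\<forall>N\<ge>1. holds_except \<epsilon> (\<lambda>\<omega>. \<forall>t\<in>{0..T}. \<bar>y N t \<omega>\<bar> \<le> R))"
    and "\<theta> > 0" "\<epsilon> > 0"
  shows "\<forall>\<^sub>F N in sequentially. holds_except \<epsilon> (\<lambda>\<omega>. \<forall>t\<in>{0..T}. \<bar>y N t \<omega> - x t \<omega>\<bar> \<le> \<theta>)"
proof -
  \<comment> \<open>At most 1, as the walk estimate requires, and at most \<theta> / 2: the other
    half is spent on two errors \<eta> \<le> \<theta>' / 2, one from the sums and one from the path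
    modulus.\<close>
  define \<theta>' where "\<theta>' = min \<theta> 1 / 2"
  have \<theta>': "\<theta>' > 0" "\<theta>' \<le> 1" "2 * \<theta>' \<le> \<theta>" using \<open>\<theta> > 0\<close> by (auto simp: \<theta>'_def)
  \<comment> \<open>Six exceptional events of probability below \<mu> are united at the end.\<close>
  define \<mu> where "\<mu> = \<epsilon> / 8"
  have \<mu>: "\<mu> > 0" using \<open>\<epsilon> > 0\<close> by (simp add: \<mu>_def)
  obtain R where R: "R > 0" "holds_except \<mu> (\<lambda>\<omega>. \<forall>t\<in>{0..T}. \<bar>x t \<omega>\<bar> \<le> R)"
      "\<And>N. N \<ge> 1 \<Longrightarrow> holds_except \<mu> (\<lambda>\<omega>. \<forall>t\<in>{0..T}. \<bar>y N t \<omega>\<bar> \<le> R)"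
    using tight[OF \<mu>] by blast
  show ?thesis
  proof (rule err_walk_max_small[OF R(1) \<theta>'(1,2) \<mu>])
    fix \<rho> :: real
    assume \<rho>: "\<rho> > 0" and max_small: "\<And>N m l. N > 0 \<Longrightarrow> m > 0 \<Longrightarrow> l > 0 \<Longrightarrow> T / real N \<le> \<rho> \<Longrightarrow>
      holds_except \<mu> (\<lambda>\<omega>. (\<forall>j\<le>N * m * l. let n = N * m * l; \<kappa> = j div (m * l) * (m * l); \<gamma> = j div l * l in
          \<bar>x (grid T n j) \<omega>\<bar> \<le> R \<and> \<bar>y N (grid T n j) \<omega>\<bar> \<le> R \<and> \<bar>x (grid T n \<kappa>) \<omega> - x (grid T n j) \<omega>\<bar> \<le> \<rho> \<and>
          \<bar>err_walk N m l \<gamma> \<omega> - (y N (grid T n \<gamma>) \<omega> - x (grid T n \<gamma>) \<omega>)\<bar> \<le> \<rho> \<and>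
          \<bar>(y N (grid T n \<gamma>) \<omega> - x (grid T n \<gamma>) \<omega>) - (y N (grid T n j) \<omega> - x (grid T n j) \<omega>)\<bar> \<le> \<rho>)
        \<longrightarrow> (\<forall>j\<le>N * m * l. \<bar>err_walk N m l j \<omega>\<bar> \<le> \<theta>'))"
    define \<eta> where "\<eta> = min \<rho> (\<theta>' / 2)"
    have \<eta>: "\<eta> > 0" "\<eta> \<le> \<rho>" "2 * \<eta> \<le> \<theta>'" using \<rho> \<theta>' by (auto simp: \<eta>_def)
    have x_meas: "x t \<in> borel_measurable M" if "t \<in> {0..T}" for t using adapted(1)[OF that] measurable_F_M by blast
    \<comment> \<open>The modulus of x is independent of N, so N can be chosen after it. That of the
      error varies with N and is taken only once N is fixed, which is why m is chosen later.\<close>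
    from path_modulus[OF x_meas x_continuous compact_Icc \<eta>(1) \<mu>] obtain dx where dx: "dx > 0"
      "holds_except \<mu> (\<lambda>\<omega>. \<forall>s\<in>{0..T}. \<forall>t\<in>{0..T}. \<bar>s - t\<bar> < dx \<longrightarrow> \<bar>x s \<omega> - x t \<omega>\<bar> \<le> \<eta>)" by blast
    have "(\<lambda>N. T / real N) \<longlonglongrightarrow> 0" by (rule lim_const_over_n)
    from order_tendstoD(2)[OF this dx(1)] order_tendstoD(2)[OF this \<rho>] eventually_gt_at_top[of 0]
    show ?thesis
    proof eventually_elim
      case (elim N)
      then have N: "N \<ge> 1" "N > 0" by auto
      define e where "e t \<omega> = y N t \<omega> - x t \<omega>" for t \<omega>
      have e_meas: "e t \<in> borel_measurable M" if "t \<in> {0..T}" for t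
        unfolding e_def[abs_def] using x_meas[OF that] adapted(3)[OF that N(1)] measurable_F_M by (intro borel_measurable_diff) blast+
      have "AE \<omega> in M. continuous_on {0..T} (\<lambda>t. e t \<omega>)"
        using x_continuous y_continuous[OF N(1)] by eventually_elim (auto simp: e_def intro: continuous_on_diff)
      from path_modulus[OF e_meas this compact_Icc \<eta>(1) \<mu>] obtain de where de: "de > 0"
        "holds_except \<mu> (\<lambda>\<omega>. \<forall>s\<in>{0..T}. \<forall>t\<in>{0..T}. \<bar>s - t\<bar> < de \<longrightarrow> \<bar>e s \<omega> - e t \<omega>\<bar> \<le> \<eta>)" by blast
      obtain m :: nat where "T / de < real m" using reals_Archimedean2 by blast
      moreover have "T / de > 0" using T_pos de(1) by simp
      ultimately have "m > 0" by (cases "m = 0") auto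
      with \<open>T / de < real m\<close> have m: "m > 0" "T / real m < de" using de(1) by (auto simp: field_simps)
      define P where "P = N * m"
      have P: "P > 0" "m \<le> P" using N m by (auto simp: P_def)
      have "T / real P \<le> T / real m" using P m T_pos by (intro divide_left_mono) auto
      then have Pde: "T / real P < de" using m(2) by linarith
      \<comment> \<open>There are P + 1 intermediate points, and \<open>holds_except_ball\<close>
        charges one share more.\<close>
      define \<nu> where "\<nu> = \<mu> / real (P + 2)"
      have \<nu>: "\<nu> > 0" using \<mu> by (simp add: \<nu>_def)
      have "\<forall>\<^sub>F l in sequentially. \<forall>c\<in>{..P}. holds_except \<nu> (\<lambda>\<omega>. \<bar>err_walk N m l (c * l) \<omega> - e (grid T P c) \<omega>\<bar> \<le> \<eta>)"
      proof (rule eventually_ball_finite)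
        show "\<forall>c\<in>{..P}. \<forall>\<^sub>F l in sequentially. holds_except \<nu> (\<lambda>\<omega>. \<bar>err_walk N m l (c * l) \<omega> - e (grid T P c) \<omega>\<bar> \<le> \<eta>)"
          unfolding e_def P_def using vanishes_in_probD[OF err_walk_vanishes[OF N(2) m(1)] \<nu> \<eta>(1)] by blast
      qed simp
      then have "\<forall>\<^sub>F l in sequentially. (\<forall>c\<in>{..P}. holds_except \<nu> (\<lambda>\<omega>. \<bar>err_walk N m l (c * l) \<omega> - e (grid T P c) \<omega>\<bar> \<le> \<eta>)) \<and> l > 0"
        using eventually_gt_at_top[of 0] by (rule eventually_conj)
      then obtain l where l: "l > 0" and coarse:
        "\<And>c. c \<in> {..P} \<Longrightarrow> holds_except \<nu> (\<lambda>\<omega>. \<bar>err_walk N m l (c * l) \<omega> - e (grid T P c) \<omega>\<bar> \<le> \<eta>)"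
        using eventually_happens'[OF sequentially_bot] by blast
      have "holds_except (real (card {..P} + 1) * \<nu>) (\<lambda>\<omega>. \<forall>c\<in>{..P}. \<bar>err_walk N m l (c * l) \<omega> - e (grid T P c) \<omega>\<bar> \<le> \<eta>)"
        by (rule holds_except_ball[OF _ coarse \<nu>]) simp
      then have coarse': "holds_except \<mu> (\<lambda>\<omega>. \<forall>c\<in>{..P}. \<bar>err_walk N m l (c * l) \<omega> - e (grid T P c) \<omega>\<bar> \<le> \<eta>)"
        by (simp add: \<nu>_def del: of_nat_add)
      define n where "n = N * m * l"
      note all = holds_except_conj[OF R(2) holds_except_conj[OF R(3)[OF N(1)] holds_except_conj[OF dx(2)
            holds_except_conj[OF de(2) holds_except_conj[OF coarse' max_small[OF N(2) m(1) l less_imp_le[OF elim(2)]]]]]]]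
      show ?case
      proof (rule holds_except_mono[OF all])
        show "\<mu> + (\<mu> + (\<mu> + (\<mu> + (\<mu> + \<mu>)))) \<le> \<epsilon>" using \<open>\<epsilon> > 0\<close> by (simp add: \<mu>_def)
        fix \<omega>
        assume "(\<forall>t\<in>{0..T}. \<bar>x t \<omega>\<bar> \<le> R) \<and> (\<forall>t\<in>{0..T}. \<bar>y N t \<omega>\<bar> \<le> R) \<and>
          (\<forall>s\<in>{0..T}. \<forall>t\<in>{0..T}. \<bar>s - t\<bar> < dx \<longrightarrow> \<bar>x s \<omega> - x t \<omega>\<bar> \<le> \<eta>) \<and>
          (\<forall>s\<in>{0..T}. \<forall>t\<in>{0..T}. \<bar>s - t\<bar> < de \<longrightarrow> \<bar>e s \<omega> - e t \<omega>\<bar> \<le> \<eta>) \<and>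
          (\<forall>c\<in>{..P}. \<bar>err_walk N m l (c * l) \<omega> - e (grid T P c) \<omega>\<bar> \<le> \<eta>) \<and>
          ((\<forall>j\<le>N * m * l. let n = N * m * l; \<kappa> = j div (m * l) * (m * l); \<gamma> = j div l * l in
          \<bar>x (grid T n j) \<omega>\<bar> \<le> R \<and> \<bar>y N (grid T n j) \<omega>\<bar> \<le> R \<and> \<bar>x (grid T n \<kappa>) \<omega> - x (grid T n j) \<omega>\<bar> \<le> \<rho> \<and>
          \<bar>err_walk N m l \<gamma> \<omega> - (y N (grid T n \<gamma>) \<omega> - x (grid T n \<gamma>) \<omega>)\<bar> \<le> \<rho> \<and>
          \<bar>(y N (grid T n \<gamma>) \<omega> - x (grid T n \<gamma>) \<omega>) - (y N (grid T n j) \<omega> - x (grid T n j) \<omega>)\<bar> \<le> \<rho>)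
        \<longrightarrow> (\<forall>j\<le>N * m * l. \<bar>err_walk N m l j \<omega>\<bar> \<le> \<theta>'))"
        then have bd: "\<And>t. t \<in> {0..T} \<Longrightarrow> \<bar>x t \<omega>\<bar> \<le> R" "\<And>t. t \<in> {0..T} \<Longrightarrow> \<bar>y N t \<omega>\<bar> \<le> R"
          and xm: "\<And>s t. s \<in> {0..T} \<Longrightarrow> t \<in> {0..T} \<Longrightarrow> \<bar>s - t\<bar> < dx \<Longrightarrow> \<bar>x s \<omega> - x t \<omega>\<bar> \<le> \<eta>"
          and em: "\<And>s t. s \<in> {0..T} \<Longrightarrow> t \<in> {0..T} \<Longrightarrow> \<bar>s - t\<bar> < de \<Longrightarrow> \<bar>e s \<omega> - e t \<omega>\<bar> \<le> \<eta>"
          and cm: "\<And>c. c \<le> P \<Longrightarrow> \<bar>err_walk N m l (c * l) \<omega> - e (grid T P c) \<omega>\<bar> \<le> \<eta>"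
          and mx: "(\<And>j. j \<le> n \<Longrightarrow> let \<kappa> = j div (m * l) * (m * l); \<gamma> = j div l * l in
          \<bar>x (grid T n j) \<omega>\<bar> \<le> R \<and> \<bar>y N (grid T n j) \<omega>\<bar> \<le> R \<and> \<bar>x (grid T n \<kappa>) \<omega> - x (grid T n j) \<omega>\<bar> \<le> \<rho> \<and>
          \<bar>err_walk N m l \<gamma> \<omega> - e (grid T n \<gamma>) \<omega>\<bar> \<le> \<rho> \<and>
          \<bar>e (grid T n \<gamma>) \<omega> - e (grid T n j) \<omega>\<bar> \<le> \<rho>) \<Longrightarrow> (\<forall>j\<le>n. \<bar>err_walk N m l j \<omega>\<bar> \<le> \<theta>')"
          unfolding e_def Let_def n_def by blast+
        have nP: "n = P * l" by (simp add: n_def P_def)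
        have n: "n > 0" using P l by (simp add: nP)
        have in_T: "grid T n j \<in> {0..T}" if "j \<le> n" for j using grid_bounds[of T j n] T_pos that by simp
        have gdiff: "\<bar>grid T n (j div k * k) - grid T n j\<bar> \<le> real k * (T / real n)" if "k > 0" for j k
        proof -
          have "grid T n j - grid T n (j div k * k) = real (j - j div k * k) * (T / real n)"
            by (simp only: grid_def of_nat_diff[OF div_times_less_eq_dividend] left_diff_distrib)
          also have "j - j div k * k = j mod k" by (rule minus_div_mult_eq_mod)
          finally have *: "grid T n j - grid T n (j div k * k) = real (j mod k) * (T / real n)" .
          have "j mod k \<le> k" using that by (simp add: less_imp_le)
          then have "real (j mod k) * (T / real n) \<le> real k * (T / real n)" using T_pos by (intro mult_right_mono) auto
          moreover have "real (j mod k) * (T / real n) \<ge> 0" using T_pos by simp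
          ultimately show ?thesis
            unfolding abs_minus_commute[of "grid T n (j div k * k)"] * by (simp only: abs_of_nonneg)
        qed
        have S: "\<forall>j\<le>n. \<bar>err_walk N m l j \<omega>\<bar> \<le> \<theta>'"
        proof (rule mx, unfold Let_def, intro conjI)
          fix j assume j: "j \<le> n"
          have \<kappa>: "j div (m * l) * (m * l) \<le> n" and \<gamma>: "j div l * l \<le> n"
            using j div_times_less_eq_dividend le_trans by blast+
          show "\<bar>x (grid T n j) \<omega>\<bar> \<le> R" "\<bar>y N (grid T n j) \<omega>\<bar> \<le> R" using bd in_T[OF j] by auto
          have "real (m * l) * (T / real n) = T / real N" using m l by (simp add: n_def)
          then have "\<bar>grid T n (j div (m * l) * (m * l)) - grid T n j\<bar> < dx"
            using gdiff[of "m * l" j] m l elim(1) by (simp del: of_nat_mult)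
          then show "\<bar>x (grid T n (j div (m * l) * (m * l))) \<omega> - x (grid T n j) \<omega>\<bar> \<le> \<rho>"
            using xm[OF in_T[OF \<kappa>] in_T[OF j]] \<eta>(2) by linarith
          have "j div l \<le> P" using j l unfolding nP by (metis div_le_mono nonzero_mult_div_cancel_right neq0_conv)
          from cm[OF this] show "\<bar>err_walk N m l (j div l * l) \<omega> - e (grid T n (j div l * l)) \<omega>\<bar> \<le> \<rho>"
            using \<eta>(2) unfolding nP grid_mult[OF l] by linarith
          have "real l * (T / real n) = T / real P" using l by (simp add: nP)
          then have "\<bar>grid T n (j div l * l) - grid T n j\<bar> < de"
            using gdiff[of l j] l Pde by simp
          then show "\<bar>e (grid T n (j div l * l)) \<omega> - e (grid T n j) \<omega>\<bar> \<le> \<rho>"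
            using em[OF in_T[OF \<gamma>] in_T[OF j]] \<eta>(2) by linarith
        qed
        show "\<forall>t\<in>{0..T}. \<bar>y N t \<omega> - x t \<omega>\<bar> \<le> \<theta>"
        proof
          fix t assume t: "t \<in> {0..T}"
          define h where "h = T / real P"
          have h: "h > 0" "h * real P = T" using T_pos P by (auto simp: h_def)
          \<comment> \<open>The last intermediate point not after t; for t = T this is the index
            P.\<close>
          define c where "c = nat \<lfloor>t / h\<rfloor>"
          have "t / h \<ge> 0" using t h by simp
          then have c1: "real c \<le> t / h" "t / h < real c + 1" unfolding c_def by linarith+
          have "t / h \<le> real P" using t h by (simp add: field_simps)
          then have c: "c \<le> P" using c1(1) by linarith
          have "real c * h \<le> t" "t < real c * h + h" using c1 h by (auto simp: field_simps)
          then have "\<bar>grid T P c - t\<bar> < de" using Pde by (simp add: grid_def h_def[symmetric])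
          moreover have "grid T P c \<in> {0..T}" using grid_bounds[of T c P] T_pos c by simp
          ultimately have "\<bar>e (grid T P c) \<omega> - e t \<omega>\<bar> \<le> \<eta>" using em t by blast
          moreover have "\<bar>err_walk N m l (c * l) \<omega>\<bar> \<le> \<theta>'" using S c by (simp add: nP)
          ultimately have "\<bar>e t \<omega>\<bar> \<le> \<theta>" using cm[OF c] \<eta>(3) \<theta>'(3) by linarith
          then show "\<bar>y N t \<omega> - x t \<omega>\<bar> \<le> \<theta>" by (simp add: e_def)
        qed
      qed
    qed
  qed
qed

end

section \<open>Suprema over paths, moment bounds and truncation\<close>

lemma SUP_dense_continuous:
  fixes h :: "real \<Rightarrow> real"
  assumes "continuous_on S h" "D \<subseteq> S" "S \<subseteq> closure D"
  shows "(SUP t\<in>S. ennreal (h t)) = (SUP t\<in>D. ennreal (h t))"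
proof (rule antisym)
  show "(SUP t\<in>S. ennreal (h t)) \<le> (SUP t\<in>D. ennreal (h t))"
  proof (rule SUP_least)
    fix t assume t: "t \<in> S"
    obtain s where s: "\<And>n. s n \<in> D" "s \<longlonglongrightarrow> t" using subsetD[OF assms(3) t] unfolding closure_sequential by blast
    have "(\<lambda>n. h (s n)) \<longlonglongrightarrow> h t"
      using s assms(2) t by (intro continuous_on_tendsto_compose[OF assms(1)]) (auto intro!: always_eventually)
    then have "(\<lambda>n. ennreal (h (s n))) \<longlonglongrightarrow> ennreal (h t)" by (rule tendsto_ennrealI)
    then show "ennreal (h t) \<le> (SUP t\<in>D. ennreal (h t))"
      using s(1) by (intro LIMSEQ_le_const2[where X = "\<lambda>n. ennreal (h (s n))"]) (auto intro!: SUP_upper)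
  qed
  show "(SUP t\<in>D. ennreal (h t)) \<le> (SUP t\<in>S. ennreal (h t))"
    using assms(2) by (intro SUP_subset_mono) auto
qed

context prob_space
begin

text \<open>A supremum over uncountably many times need not be measurable. Over a countable dense
  set of times it is, and path continuity makes the two agree almost everywhere, so Markov's
  inequality and additivity of the integral can be applied to the version.\<close>

lemma SUP_path_measurable_version:
  fixes Z :: "real \<Rightarrow> 'a \<Rightarrow> real"
  assumes meas: "\<And>t. t \<in> S \<Longrightarrow> Z t \<in> borel_measurable M" and cont: "AE \<omega> in M. continuous_on S (\<lambda>t. Z t \<omega>)"
    and h: "continuous_on UNIV h"
  obtains U where "U \<in> borel_measurable M" "AE \<omega> in M. U \<omega> = (SUP t\<in>S. ennreal (h (Z t \<omega>)))"
proof -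
  obtain D where D: "countable D" "D \<subseteq> S" "S \<subseteq> closure D" by (rule countable_dense_subset)
  show thesis
  proof (rule that[of "\<lambda>\<omega>. SUP t\<in>D. ennreal (h (Z t \<omega>))"])
    show "(\<lambda>\<omega>. SUP t\<in>D. ennreal (h (Z t \<omega>))) \<in> borel_measurable M"
      using D meas borel_measurable_continuous_onI[OF h]
      by (intro borel_measurable_SUP measurable_compose[OF _ measurable_ennreal]) (auto intro: measurable_compose)
    show "AE \<omega> in M. (SUP t\<in>D. ennreal (h (Z t \<omega>))) = (SUP t\<in>S. ennreal (h (Z t \<omega>)))"
      using cont
    proof eventually_elim
      case (elim \<omega>)
      then have "continuous_on S (\<lambda>t. h (Z t \<omega>))" by (rule continuous_on_compose2[OF h]) auto
      from SUP_dense_continuous[OF this D(2,3)] show ?case by simp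
    qed
  qed
qed

text \<open>Markov's inequality for the p-th power of the supremum, in its measurable version.
  Combined with a moment bound uniform in N it yields one radius for x and for all schemes at
  once.\<close>

lemma sup_moment_tight:
  fixes Z :: "real \<Rightarrow> 'a \<Rightarrow> real"
  assumes meas: "\<And>t. t \<in> S \<Longrightarrow> Z t \<in> borel_measurable M" and cont: "AE \<omega> in M. continuous_on S (\<lambda>t. Z t \<omega>)"
    and p: "p > 0" and R: "R > 0" "A \<le> \<epsilon> * R powr p"
    and moment: "(\<integral>\<^sup>+\<omega>. (SUP t\<in>S. ennreal (\<bar>Z t \<omega>\<bar> powr p)) \<partial>M) < ennreal A"
  shows "holds_except \<epsilon> (\<lambda>\<omega>. \<forall>t\<in>S. \<bar>Z t \<omega>\<bar> \<le> R)"
proof -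
  have "continuous_on UNIV (\<lambda>z::real. \<bar>z\<bar> powr p)"
    using p by (intro continuous_on_powr' continuous_intros) auto
  then obtain U where U: "U \<in> borel_measurable M" "AE \<omega> in M. U \<omega> = (SUP t\<in>S. ennreal (\<bar>Z t \<omega>\<bar> powr p))"
    using SUP_path_measurable_version[OF meas cont] by blast
  have IU: "(\<integral>\<^sup>+\<omega>. U \<omega> \<partial>M) < ennreal A"
    using moment nn_integral_cong_AE[OF U(2)] by simp
  have Rp: "R powr p > 0" using R by simp
  define E where "E = {\<omega>\<in>space M. 1 \<le> ennreal (1 / R powr p) * U \<omega>}"
  have E: "E \<in> events" unfolding E_def using U(1) by measurable
  have "emeasure M E \<le> ennreal (1 / R powr p) * (\<integral>\<^sup>+\<omega>. U \<omega> * indicator (space M) \<omega> \<partial>M)"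
    unfolding E_def using U(1) by (intro nn_integral_Markov_inequality) auto
  also have "(\<integral>\<^sup>+\<omega>. U \<omega> * indicator (space M) \<omega> \<partial>M) = (\<integral>\<^sup>+\<omega>. U \<omega> \<partial>M)"
    by (intro nn_integral_cong) simp
  also have "ennreal (1 / R powr p) * (\<integral>\<^sup>+\<omega>. U \<omega> \<partial>M) < ennreal (1 / R powr p) * ennreal A"
    using IU Rp by (intro ennreal_mult_strict_left_mono) auto
  also have "\<dots> \<le> ennreal \<epsilon>"
    using R Rp by (subst ennreal_mult'[symmetric]) (auto intro!: ennreal_leI simp: field_simps)
  finally have "prob E < \<epsilon>"
    by (simp add: emeasure_eq_measure ennreal_less_iff)
  then show ?thesis
  proof (rule holds_exceptI_AE[OF E _ U(2)], intro ballI)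
    fix \<omega> t assume U\<omega>: "U \<omega> = (SUP t\<in>S. ennreal (\<bar>Z t \<omega>\<bar> powr p))" and \<omega>: "\<omega> \<in> space M" "\<omega> \<notin> E" and t: "t \<in> S"
    show "\<bar>Z t \<omega>\<bar> \<le> R"
    proof (rule ccontr)
      assume "\<not> \<bar>Z t \<omega>\<bar> \<le> R"
      then have "R powr p \<le> \<bar>Z t \<omega>\<bar> powr p" using R p by (intro powr_mono2) auto
      then have "ennreal (R powr p) \<le> U \<omega>" unfolding U\<omega> using t by (intro SUP_upper2[OF t] ennreal_leI)
      then have "ennreal (1 / R powr p) * ennreal (R powr p) \<le> ennreal (1 / R powr p) * U \<omega>"
        by (intro mult_left_mono) auto
      moreover have "ennreal (1 / R powr p) * ennreal (R powr p) = 1"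
        using Rp by (subst ennreal_mult'[symmetric]) auto
      ultimately show False using \<omega> by (simp add: E_def)
    qed
  qed
qed

end

text \<open>Truncation at level \<Lambda>. Where d = \<bar>u - v\<bar> exceeds \<Lambda>, the square
  d^2 is d^(2 - p) times d^p, and the exponent 2 - p is negative, so the first factor is at most its
  value at \<Lambda>. The factor 2^p comes from d being at most twice the larger of \<bar>u\<bar>
  and \<bar>v\<bar>.\<close>

lemma sq_diff_le_moments:
  fixes u v p \<Lambda> :: real
  assumes p: "p > 2" and \<Lambda>: "\<Lambda> > 0"
  shows "(u - v)\<^sup>2 \<le> \<Lambda>\<^sup>2 + \<Lambda> powr (2 - p) * 2 powr p * (\<bar>v\<bar> powr p + \<bar>u\<bar> powr p)"
proof (cases "\<bar>u - v\<bar> \<le> \<Lambda>")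
  case True
  then have "(u - v)\<^sup>2 \<le> \<Lambda>\<^sup>2" by (metis abs_ge_zero power2_abs power_mono)
  then show ?thesis by (simp add: add_increasing2)
next
  case False
  define d where "d = \<bar>u - v\<bar>"
  have d: "d > \<Lambda>" "d > 0" using False \<Lambda> by (auto simp: d_def)
  have "(u - v)\<^sup>2 = d powr 2" using d by (simp add: d_def powr_numeral)
  also have "\<dots> = d powr (2 - p) * d powr p" using d by (simp flip: powr_add)
  also have "\<dots> \<le> \<Lambda> powr (2 - p) * d powr p"
    using d p \<Lambda> by (intro mult_right_mono powr_mono2') auto
  finally have 1: "(u - v)\<^sup>2 \<le> \<Lambda> powr (2 - p) * d powr p" .
  have 2: "d powr p \<le> 2 powr p * (\<bar>v\<bar> powr p + \<bar>u\<bar> powr p)"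
  proof -
    have "d \<le> 2 * max \<bar>u\<bar> \<bar>v\<bar>" by (simp add: d_def)
    then have "d powr p \<le> (2 * max \<bar>u\<bar> \<bar>v\<bar>) powr p" using d p by (intro powr_mono2) auto
    also have "\<dots> = 2 powr p * max \<bar>u\<bar> \<bar>v\<bar> powr p" by (simp add: powr_mult)
    also have "max \<bar>u\<bar> \<bar>v\<bar> powr p \<le> \<bar>v\<bar> powr p + \<bar>u\<bar> powr p" by (simp add: max_def)
    finally show ?thesis by simp
  qed
  have "(u - v)\<^sup>2 \<le> \<Lambda> powr (2 - p) * (2 powr p * (\<bar>v\<bar> powr p + \<bar>u\<bar> powr p))"
    by (rule order.trans[OF 1 mult_left_mono[OF 2]]) simp
  then show ?thesis by (simp add: mult.assoc add_increasing)
qed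

context semi_discrete
begin

text \<open>Outside the exceptional event the error is at most \<theta>; on it the truncation bound
  applies and gives \<Lambda>^2 times its probability plus a tail controlled by the moments. The
  tail is independent of N and decays with \<Lambda>: this is uniform integrability in quantitative
  form.\<close>

lemma err_second_moment_bound:
  fixes p A :: real
  assumes N: "N \<ge> 1" and p: "p > 2" and A: "A > 0" and \<Lambda>: "\<Lambda> > 0"
    and momx: "(\<integral>\<^sup>+\<omega>. (SUP t\<in>{0..T}. ennreal (\<bar>x t \<omega>\<bar> powr p)) \<partial>M) < ennreal A"
    and momy: "(\<integral>\<^sup>+\<omega>. (SUP t\<in>{0..T}. ennreal (\<bar>y N t \<omega>\<bar> powr p)) \<partial>M) < ennreal A"
    and small: "holds_except \<epsilon> (\<lambda>\<omega>. \<forall>t\<in>{0..T}. \<bar>y N t \<omega> - x t \<omega>\<bar> \<le> \<theta>)"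
  shows "(\<integral>\<^sup>+\<omega>. (SUP t\<in>{0..T}. ennreal ((y N t \<omega> - x t \<omega>)\<^sup>2)) \<partial>M)
    \<le> ennreal (\<theta>\<^sup>2 + \<Lambda>\<^sup>2 * \<epsilon> + \<Lambda> powr (2 - p) * 2 powr p * (2 * A))"
proof -
  define c where "c = \<Lambda> powr (2 - p) * 2 powr p"
  have c: "c \<ge> 0" by (simp add: c_def)
  have cont: "continuous_on UNIV (\<lambda>z::real. \<bar>z\<bar> powr p)"
    using p by (intro continuous_on_powr' continuous_intros) auto
  have meas: "x t \<in> borel_measurable M" "y N t \<in> borel_measurable M" if "t \<in> {0..T}" for t
    using adapted(1)[OF that] adapted(3)[OF that N] measurable_F_M by blast+
  obtain U where U: "U \<in> borel_measurable M" "AE \<omega> in M. U \<omega> = (SUP t\<in>{0..T}. ennreal (\<bar>x t \<omega>\<bar> powr p))"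
    using SUP_path_measurable_version[OF meas(1) x_continuous cont] by blast
  obtain V where V: "V \<in> borel_measurable M" "AE \<omega> in M. V \<omega> = (SUP t\<in>{0..T}. ennreal (\<bar>y N t \<omega>\<bar> powr p))"
    using SUP_path_measurable_version[OF meas(2) y_continuous[OF N] cont] by blast
  have IU: "(\<integral>\<^sup>+\<omega>. U \<omega> \<partial>M) \<le> ennreal A" "(\<integral>\<^sup>+\<omega>. V \<omega> \<partial>M) \<le> ennreal A"
    using momx momy nn_integral_cong_AE[OF U(2)] nn_integral_cong_AE[OF V(2)] by simp_all
  obtain B where B: "B \<in> events" "prob B < \<epsilon>" "\<forall>\<omega>\<in>space M - B. \<forall>t\<in>{0..T}. \<bar>y N t \<omega> - x t \<omega>\<bar> \<le> \<theta>"
    using small by (auto simp: holds_except_def)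
  have "(\<integral>\<^sup>+\<omega>. (SUP t\<in>{0..T}. ennreal ((y N t \<omega> - x t \<omega>)\<^sup>2)) \<partial>M)
      \<le> (\<integral>\<^sup>+\<omega>. (ennreal (\<theta>\<^sup>2) + ennreal (\<Lambda>\<^sup>2) * indicator B \<omega>) + ennreal c * (U \<omega> + V \<omega>) \<partial>M)"
  proof (rule nn_integral_mono_AE)
    show "AE \<omega> in M. (SUP t\<in>{0..T}. ennreal ((y N t \<omega> - x t \<omega>)\<^sup>2))
        \<le> (ennreal (\<theta>\<^sup>2) + ennreal (\<Lambda>\<^sup>2) * indicator B \<omega>) + ennreal c * (U \<omega> + V \<omega>)"
      using U(2) V(2) AE_space
    proof eventually_elim
      case (elim \<omega>)
      show ?case
      proof (rule SUP_least)
        fix t assume t: "t \<in> {0..T}"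
        show "ennreal ((y N t \<omega> - x t \<omega>)\<^sup>2) \<le> (ennreal (\<theta>\<^sup>2) + ennreal (\<Lambda>\<^sup>2) * indicator B \<omega>) + ennreal c * (U \<omega> + V \<omega>)"
        proof (cases "\<omega> \<in> B")
          case False
          then have "\<bar>y N t \<omega> - x t \<omega>\<bar> \<le> \<theta>" using B(3) elim t by blast
          then have "(y N t \<omega> - x t \<omega>)\<^sup>2 \<le> \<theta>\<^sup>2" by (metis abs_ge_zero power2_abs power_mono)
          then have "ennreal ((y N t \<omega> - x t \<omega>)\<^sup>2) \<le> ennreal (\<theta>\<^sup>2)" by (rule ennreal_leI)
          then show ?thesis using False by (simp add: add_increasing2)
        next
          case True
          have "ennreal ((y N t \<omega> - x t \<omega>)\<^sup>2) \<le> ennreal (\<Lambda>\<^sup>2 + c * (\<bar>x t \<omega>\<bar> powr p + \<bar>y N t \<omega>\<bar> powr p))"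
            unfolding c_def by (intro ennreal_leI sq_diff_le_moments p \<Lambda>)
          also have "\<dots> = ennreal (\<Lambda>\<^sup>2) + ennreal c * (ennreal (\<bar>x t \<omega>\<bar> powr p) + ennreal (\<bar>y N t \<omega>\<bar> powr p))"
            using c by (simp add: ennreal_plus ennreal_mult')
          also have "\<dots> \<le> ennreal (\<Lambda>\<^sup>2) + ennreal c * (U \<omega> + V \<omega>)"
            unfolding elim(1,2) using t by (intro add_left_mono mult_left_mono add_mono SUP_upper) auto
          finally show ?thesis using True by (simp add: add_increasing add.assoc)
        qed
      qed
    qed
  qed
  also have "\<dots> = ennreal (\<theta>\<^sup>2) + ennreal (\<Lambda>\<^sup>2) * emeasure M B + ennreal c * ((\<integral>\<^sup>+\<omega>. U \<omega> \<partial>M) + (\<integral>\<^sup>+\<omega>. V \<omega> \<partial>M))"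
    using U(1) V(1) B(1) by (simp add: nn_integral_add nn_integral_cmult nn_integral_cmult_indicator emeasure_space_1)
  also have "\<dots> \<le> ennreal (\<theta>\<^sup>2) + ennreal (\<Lambda>\<^sup>2) * ennreal \<epsilon> + ennreal c * (ennreal A + ennreal A)"
    using IU B(2) by (intro add_mono mult_left_mono order.refl) (auto simp: emeasure_eq_measure intro!: ennreal_leI)
  also have "\<dots> = ennreal (\<theta>\<^sup>2 + \<Lambda>\<^sup>2 * \<epsilon> + c * (2 * A))"
  proof -
    have "\<epsilon> \<ge> 0" using B(2) measure_nonneg[of M B] by linarith
    then show ?thesis using A c by (simp add: ennreal_plus[symmetric] ennreal_mult'[symmetric] del: ennreal_plus)
  qed
  finally show ?thesis by (simp add: c_def)
qed

lemma mean_square_convergence: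
  fixes p A :: real
  assumes p: "p > 2" and A: "A > 0"
    and momx: "(\<integral>\<^sup>+\<omega>. (SUP t\<in>{0..T}. ennreal (\<bar>x t \<omega>\<bar> powr p)) \<partial>M) < ennreal A"
    and momy: "\<And>N. N \<ge> 1 \<Longrightarrow> (\<integral>\<^sup>+\<omega>. (SUP t\<in>{0..T}. ennreal (\<bar>y N t \<omega>\<bar> powr p)) \<partial>M) < ennreal A"
  shows "(\<lambda>N. \<integral>\<^sup>+\<omega>. (SUP t\<in>{0..T}. ennreal ((y N t \<omega> - x t \<omega>)\<^sup>2)) \<partial>M) \<longlonglongrightarrow> 0"
proof (rule order_tendstoI)
  fix v :: ennreal assume "0 < v"
  \<comment> \<open>A value strictly between 0 and v is finite even if v is infinite, so the
    remaining estimates can be made in the reals.\<close>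
  then obtain z where z: "0 < z" "z < v" using dense by blast
  define d where "d = enn2real z"
  have "z < top" using z(2) by (rule less_le_trans) simp
  then have zd: "z = ennreal d" "d > 0" using z(1) by (auto simp: d_def enn2real_positive_iff)
  have "((\<lambda>\<Lambda>. \<Lambda> powr (2 - p) * 2 powr p * (2 * A)) \<longlongrightarrow> 0 * 2 powr p * (2 * A)) at_top"
    using p by (intro tendsto_intros tendsto_neg_powr filterlim_ident) auto
  then have "\<forall>\<^sub>F \<Lambda> in at_top. \<Lambda> powr (2 - p) * 2 powr p * (2 * A) < d / 3"
    using zd(2) by (intro order_tendstoD(2)) auto
  then have "\<forall>\<^sub>F \<Lambda> in at_top. \<Lambda> powr (2 - p) * 2 powr p * (2 * A) < d / 3 \<and> \<Lambda> > 0"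
    using eventually_gt_at_top[of 0] by (rule eventually_conj)
  then obtain \<Lambda> :: real where \<Lambda>: "\<Lambda> powr (2 - p) * 2 powr p * (2 * A) < d / 3" "\<Lambda> > 0"
    using eventually_happens'[OF trivial_limit_at_top_linorder] by blast
  \<comment> \<open>The target d is split into thirds. \<Lambda> has been fixed by the tail alone;
    now \<epsilon> compensates the factor \<Lambda>^2, and \<theta>^2 is the last third.\<close>
  define \<epsilon> where "\<epsilon> = d / (3 * \<Lambda>\<^sup>2)"
  define \<theta> where "\<theta> = sqrt (d / 3)"
  have \<epsilon>: "\<epsilon> > 0" "\<Lambda>\<^sup>2 * \<epsilon> = d / 3" and \<theta>: "\<theta> > 0" "\<theta>\<^sup>2 = d / 3"
    using zd(2) \<Lambda>(2) by (auto simp: \<epsilon>_def \<theta>_def)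
  have meas: "x t \<in> borel_measurable M" "N \<ge> 1 \<Longrightarrow> y N t \<in> borel_measurable M" if "t \<in> {0..T}" for t N
    using adapted(1)[OF that] adapted(3)[OF that] measurable_F_M by blast+
  have tight: "\<exists>R>0. holds_except \<mu> (\<lambda>\<omega>. \<forall>t\<in>{0..T}. \<bar>x t \<omega>\<bar> \<le> R) \<and>
      (\<forall>N\<ge>1. holds_except \<mu> (\<lambda>\<omega>. \<forall>t\<in>{0..T}. \<bar>y N t \<omega>\<bar> \<le> R))" if \<mu>: "\<mu> > 0" for \<mu>
  \<comment> \<open>This radius R satisfies \<mu> R^p = A, which is exactly what
    \<open>sup_moment_tight\<close> asks for.\<close>
  proof (intro exI[of _ "(A / \<mu>) powr (1 / p)"] conjI allI impI)
    have R: "(A / \<mu>) powr (1 / p) > 0" "A \<le> \<mu> * ((A / \<mu>) powr (1 / p)) powr p"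
      using A \<mu> p by (auto simp: powr_powr)
    then show "(A / \<mu>) powr (1 / p) > 0" by simp
    have "p > 0" using p by simp
    show "holds_except \<mu> (\<lambda>\<omega>. \<forall>t\<in>{0..T}. \<bar>x t \<omega>\<bar> \<le> (A / \<mu>) powr (1 / p))"
      by (rule sup_moment_tight[OF meas(1) x_continuous \<open>p > 0\<close> R momx])
    show "holds_except \<mu> (\<lambda>\<omega>. \<forall>t\<in>{0..T}. \<bar>y N t \<omega>\<bar> \<le> (A / \<mu>) powr (1 / p))" if "N \<ge> 1" for N
      by (rule sup_moment_tight[OF meas(2)[OF _ that] y_continuous[OF that] \<open>p > 0\<close> R momy[OF that]])
  qed
  have small: "\<forall>\<^sub>F N in sequentially. holds_except \<epsilon> (\<lambda>\<omega>. \<forall>t\<in>{0..T}. \<bar>y N t \<omega> - x t \<omega>\<bar> \<le> \<theta>)"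
    by (rule err_uniformly_small[OF tight \<theta>(1) \<epsilon>(1)])
  show "\<forall>\<^sub>F N in sequentially. (\<integral>\<^sup>+\<omega>. (SUP t\<in>{0..T}. ennreal ((y N t \<omega> - x t \<omega>)\<^sup>2)) \<partial>M) < v"
    using small eventually_ge_at_top[of 1]
  proof eventually_elim
    case (elim N)
    have "(\<integral>\<^sup>+\<omega>. (SUP t\<in>{0..T}. ennreal ((y N t \<omega> - x t \<omega>)\<^sup>2)) \<partial>M)
        \<le> ennreal (\<theta>\<^sup>2 + \<Lambda>\<^sup>2 * \<epsilon> + \<Lambda> powr (2 - p) * 2 powr p * (2 * A))"
      by (rule err_second_moment_bound[OF elim(2) p A \<Lambda>(2) momx momy[OF elim(2)] elim(1)])
    also have "\<dots> \<le> ennreal d"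
      unfolding \<epsilon>(2) \<theta>(2) using \<Lambda>(1) by (intro ennreal_leI) linarith
    also have "\<dots> < v" using z(2) zd(1) by simp
    finally show ?case .
  qed
qed simp

end

theorem theorem2p1:
  fixes M :: "'a measure" and F :: "real \<Rightarrow> 'a measure" and T :: real
    and W :: "real \<Rightarrow> 'a \<Rightarrow> real"
    and a b :: "real \<Rightarrow> real \<Rightarrow> real"
    and f g :: "real \<Rightarrow> real \<Rightarrow> real \<Rightarrow> real \<Rightarrow> real"
    and x0 :: "'a \<Rightarrow> real" and x :: "real \<Rightarrow> 'a \<Rightarrow> real"
    and y :: "nat \<Rightarrow> real \<Rightarrow> 'a \<Rightarrow> real"
    and p A :: real
  assumes "prob_space M" and "T > 0"
    and "usual_filtration M F T" and "wiener_process M F T W"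
    and "(\<lambda>(s, z). a s z) \<in> borel_measurable borel"
    and "(\<lambda>(s, z). b s z) \<in> borel_measurable borel"
    and "x0 \<in> borel_measurable (F 0)"
    and "AE \<omega> in M. x0 \<omega> > 0"
    and "integrable M (\<lambda>\<omega>. \<bar>x0 \<omega>\<bar> powr p)"
    and "is_sde_solution M F T W a b x0 x"
    and "\<And>z. is_sde_solution M F T W a b x0 z \<Longrightarrow> (AE \<omega> in M. \<forall>t\<in>{0..T}. z t \<omega> = x t \<omega>)"
    and "assumption_A T a b f g"
    and "\<And>N. N \<ge> 1 \<Longrightarrow> is_sd_solution M F T W f g x0 N (y N)"
    and "\<And>N z. N \<ge> 1 \<Longrightarrow> is_sd_solution M F T W f g x0 N z \<Longrightarrow>
           (AE \<omega> in M. \<forall>t\<in>{0..T}. z t \<omega> = y N t \<omega>)"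
    and "p > 2" and "A > 0"
    and "(\<integral>\<^sup>+\<omega>. (SUP t\<in>{0..T}. ennreal (\<bar>x t \<omega>\<bar> powr p)) \<partial>M) < ennreal A"
    and "\<And>N. N \<ge> 1 \<Longrightarrow> (\<integral>\<^sup>+\<omega>. (SUP t\<in>{0..T}. ennreal (\<bar>y N t \<omega>\<bar> powr p)) \<partial>M) < ennreal A"
  shows "(\<lambda>N. \<integral>\<^sup>+\<omega>. (SUP t\<in>{0..T}. ennreal ((y N t \<omega> - x t \<omega>)\<^sup>2)) \<partial>M) \<longlonglongrightarrow> 0"
proof -
  interpret prob_space M by fact
  interpret semi_discrete M F T W a b f g x0 x y
    by unfold_locales (use assms in auto)
  show ?thesis
    using mean_square_convergence assms by blast
qed

end
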